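(* Let $\Gamma$ be a finite ranked poset and $A'_\Gamma$ the associated graded algebra of its splitting algebra with respect to the rank filtration. Then: (1) $A'_\Gamma$ is quadratic if and only if $\Gamma$ is uniform; (2) $A'_\Gamma$ is Koszul if and only if $\Gamma$ is Cohen–Macaulay.
   Context: Fix a field $\mathbb{F}$. A finite ranked poset is a finite poset $\Gamma$ (strict order $<$) with a unique minimal element $*$ such that for every $x\in\Gamma$ all maximal chains in $[*,x]$ have the same length, denoted $rk(x)$. For $y<x$ put $d(x,y)=rk(x)-rk(y)$; $x$ covers $y$ ($x\to y$) if $y<x$ and $d(x,y)=1$; these pairs are the edges. Let $W$ be the $\mathbb{F}$-vector space with basis the edges and $T(W)$ the free associative algebra on $W$. For $a<b$ let $\Pi(b,a)$ be the set of paths $b=c_0\to c_1\to\cdots\to c_n=a$ ($n=d(b,a)$); for such a path $\pi$ with edges $e_1,\dots,e_n$ define $e(\pi,j)$ by $(s-e_1)\cdots(s-e_n)=\sum_{j=0}^n e(\pi,j)s^{n-j}$ with $s$ a central indeterminate. The splitting algebra $A_\Gamma=T(W)/I$, $I$ generated by all $e(\pi,j)-e(\pi',j)$ with $a<b$, $\pi,\pi'\in\Pi(b,a)$, $0\le j\le d(b,a)$; it is graded with edges in degree 1. An edge $x\to y$ has rank $rk(x)$; $F^nA_\Gamma$ is the span of images of products of edges $e_1\cdots e_r$ with $\sum rk(e_i)\le n$, and $A'_\Gamma=\bigoplus_n F^nA_\Gamma/F^{n-1}A_\Gamma$ is the associated graded algebra, graded by the degree inherited from $A_\Gamma$. For $x\in\Gamma$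 let $S_x(1)=\{a\in\Gamma: x\to a\}$. For $a,b\in S_x(1)$ write $a\sim_x b$ if some $c$ is covered by both $a$ and $b$, and extend $\sim_x$ to the equivalence relation it generates on $S_x(1)$. $\Gamma$ is uniform if for every $x\neq *$ in $\Gamma$ the relation $\sim_x$ has exactly one equivalence class. For a finite poset $P$, $\Delta(P)$ is its order complex (simplices are nonempty chains), and reduced cohomology has coefficients in $\mathbb{F}$, with $\tilde H^{-1}(\Delta(\emptyset))=\mathbb{F}$. $\Gamma$ is Cohen–Macaulay if for all $a<b$ in $\Gamma$, $\tilde H^n(\Delta((a,b)))\neq 0$ implies $n=\dim\Delta((a,b))$, where $(a,b)$ is the open interval. *)

theory Defs
  imports Main
begin

section \<open>Finite ranked posets\<close>

text \<open>A poset is given by a carrier set G, a strict order lt on it and the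
 distinguished minimal element z0.\<close>

definition closed_int :: "'a set \<Rightarrow> ('a \<Rightarrow> 'a \<Rightarrow> bool) \<Rightarrow> 'a \<Rightarrow> 'a \<Rightarrow> 'a set" where
  "closed_int G lt a b = {y \<in> G. (lt a y \<or> y = a) \<and> (lt y b \<or> y = b)}"

definition open_int :: "'a set \<Rightarrow> ('a \<Rightarrow> 'a \<Rightarrow> bool) \<Rightarrow> 'a \<Rightarrow> 'a \<Rightarrow> 'a set" where
  "open_int G lt a b = {y \<in> G. lt a y \<and> lt y b}"

definition is_chain :: "('a \<Rightarrow> 'a \<Rightarrow> bool) \<Rightarrow> 'a set \<Rightarrow> bool" where
  "is_chain lt C \<longleftrightarrow> (\<forall>u\<in>C. \<forall>v\<in>C. u = v \<or> lt u v \<or> lt v u)"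

definition maxchain_in :: "'a set \<Rightarrow> ('a \<Rightarrow> 'a \<Rightarrow> bool) \<Rightarrow> 'a set \<Rightarrow> bool" where
  "maxchain_in P lt C \<longleftrightarrow> C \<subseteq> P \<and> is_chain lt C \<and>
     \<not> (\<exists>C'. C \<subset> C' \<and> C' \<subseteq> P \<and> is_chain lt C')"

definition ranked_poset :: "'a set \<Rightarrow> ('a \<Rightarrow> 'a \<Rightarrow> bool) \<Rightarrow> 'a \<Rightarrow> bool" where
  "ranked_poset G lt z0 \<longleftrightarrow>
     finite G \<and>
     (\<forall>x\<in>G. \<not> lt x x) \<and>
     (\<forall>x\<in>G. \<forall>y\<in>G. \<forall>z\<in>G. lt x y \<longrightarrow> lt y z \<longrightarrow> lt x z) \<and>
     z0 \<in> G \<and>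
     (\<forall>x\<in>G. (\<not> (\<exists>y\<in>G. lt y x)) \<longleftrightarrow> x = z0) \<and>
     (\<forall>x\<in>G. \<forall>C C'. maxchain_in (closed_int G lt z0 x) lt C \<longrightarrow>
                     maxchain_in (closed_int G lt z0 x) lt C' \<longrightarrow> card C = card C')"

text \<open>rank = length (number of covering steps) of a maximal chain in [z0, x]\<close>
definition rk :: "'a set \<Rightarrow> ('a \<Rightarrow> 'a \<Rightarrow> bool) \<Rightarrow> 'a \<Rightarrow> 'a \<Rightarrow> nat" where
  "rk G lt z0 x = Max ((\<lambda>C. card C - 1) ` {C. maxchain_in (closed_int G lt z0 x) lt C})"

definition covers :: "'a set \<Rightarrow> ('a \<Rightarrow> 'a \<Rightarrow> bool) \<Rightarrow> 'a \<Rightarrow> 'a \<Rightarrow> 'a \<Rightarrow> bool" where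
  "covers G lt z0 x y \<longleftrightarrow> x \<in> G \<and> y \<in> G \<and> lt y x \<and>
      rk G lt z0 x = rk G lt z0 y + 1"

definition edges :: "'a set \<Rightarrow> ('a \<Rightarrow> 'a \<Rightarrow> bool) \<Rightarrow> 'a \<Rightarrow> ('a \<times> 'a) set" where
  "edges G lt z0 = {(x, y). covers G lt z0 x y}"

text \<open>A path b = c_0 -> c_1 -> ... -> c_n = a, as the list of its vertices.\<close>
definition is_path :: "'a set \<Rightarrow> ('a \<Rightarrow> 'a \<Rightarrow> bool) \<Rightarrow> 'a \<Rightarrow> 'a \<Rightarrow> 'a \<Rightarrow> 'a list \<Rightarrow> bool" where
  "is_path G lt z0 b a cs \<longleftrightarrow> cs \<noteq> [] \<and> hd cs = b \<and> last cs = a \<and>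
      (\<forall>i. Suc i < length cs \<longrightarrow> covers G lt z0 (cs ! i) (cs ! Suc i))"

definition path_edges :: "'a list \<Rightarrow> ('a \<times> 'a) list" where
  "path_edges cs = zip cs (tl cs)"

section \<open>Noncommutative polynomials (elements of T(W))\<close>

text \<open>An element of T(W) is a finitely supported function from words in the edges
  to the field.\<close>

definition tensor_alg :: "('e set) \<Rightarrow> ('e list \<Rightarrow> 'k::field) set" where
  "tensor_alg E = {f. finite {w. f w \<noteq> 0} \<and> (\<forall>w. f w \<noteq> 0 \<longrightarrow> set w \<subseteq> E)}"

definition mono :: "'e list \<Rightarrow> 'e list \<Rightarrow> 'k::field" where
  "mono u = (\<lambda>v. if v = u then 1 else 0)"

definition ncmul :: "('e list \<Rightarrow> 'k::field) \<Rightarrow> ('e list \<Rightarrow> 'k) \<Rightarrow> 'e list \<Rightarrow> 'k" where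
  "ncmul p q = (\<lambda>w. \<Sum>i\<le>length w. p (take i w) * q (drop i w))"

text \<open>two-sided ideal of T(W) generated by a set Gs\<close>
inductive_set ideal_of :: "'e set \<Rightarrow> ('e list \<Rightarrow> 'k::field) set \<Rightarrow> ('e list \<Rightarrow> 'k) set"
  for E :: "'e set" and Gs :: "('e list \<Rightarrow> 'k) set" where
  zero: "(\<lambda>_. 0) \<in> ideal_of E Gs"
| gen: "g \<in> Gs \<Longrightarrow> set u \<subseteq> E \<Longrightarrow> set v \<subseteq> E \<Longrightarrow>
          ncmul (ncmul (mono u) g) (mono v) \<in> ideal_of E Gs"
| add: "f \<in> ideal_of E Gs \<Longrightarrow> g \<in> ideal_of E Gs \<Longrightarrow> (\<lambda>w. f w + g w) \<in> ideal_of E Gs"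
| smult: "f \<in> ideal_of E Gs \<Longrightarrow> (\<lambda>w. c * f w) \<in> ideal_of E Gs"

definition homog :: "nat \<Rightarrow> ('e list \<Rightarrow> 'k::field) \<Rightarrow> bool" where
  "homog d f \<longleftrightarrow> (\<forall>w. f w \<noteq> 0 \<longrightarrow> length w = d)"

section \<open>The splitting algebra and its associated graded algebra\<close>

text \<open>e(pi, j): coefficient of s^(n-j) in (s - e_1)...(s - e_n), i.e.
  (-1)^j times the sum of all ordered length-j subwords of e_1...e_n.\<close>
definition esym :: "'e list \<Rightarrow> nat \<Rightarrow> 'e list \<Rightarrow> 'k::field" where
  "esym es j = (\<lambda>w. (-1) ^ j *
      of_nat (card {S. S \<subseteq> {..<length es} \<and> card S = j \<and> nths es S = w}))"

definition split_gens :: "'a set \<Rightarrow> ('a \<Rightarrow> 'a \<Rightarrow> bool) \<Rightarrow> 'a \<Rightarrow> (('a \<times> 'a) list \<Rightarrow> 'k::field) set" where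
  "split_gens G lt z0 =
     {(\<lambda>w. esym (path_edges cs) j w - esym (path_edges cs') j w) | a b cs cs' j.
        a \<in> G \<and> b \<in> G \<and> lt a b \<and> is_path G lt z0 b a cs \<and> is_path G lt z0 b a cs' \<and>
        j \<le> rk G lt z0 b - rk G lt z0 a}"

text \<open>The ideal I with A_Gamma = T(W)/I.\<close>
definition split_ideal :: "'a set \<Rightarrow> ('a \<Rightarrow> 'a \<Rightarrow> bool) \<Rightarrow> 'a \<Rightarrow> (('a \<times> 'a) list \<Rightarrow> 'k::field) set" where
  "split_ideal G lt z0 = ideal_of (edges G lt z0) (split_gens G lt z0)"

text \<open>rank weight of a word of edges: sum of the ranks of its edges\<close>
definition weight :: "'a set \<Rightarrow> ('a \<Rightarrow> 'a \<Rightarrow> bool) \<Rightarrow> 'a \<Rightarrow> ('a \<times> 'a) list \<Rightarrow> nat" where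
  "weight G lt z0 w = sum_list (map (\<lambda>e. rk G lt z0 (fst e)) w)"

definition wpart :: "'a set \<Rightarrow> ('a \<Rightarrow> 'a \<Rightarrow> bool) \<Rightarrow> 'a \<Rightarrow> nat \<Rightarrow> (('a \<times> 'a) list \<Rightarrow> 'k::field)
     \<Rightarrow> ('a \<times> 'a) list \<Rightarrow> 'k" where
  "wpart G lt z0 n f = (\<lambda>w. if weight G lt z0 w = n then f w else 0)"

text \<open>elements of T(W) of rank weight strictly lt than n (i.e. F^(n-1) T(W))\<close>
definition low_fil :: "'a set \<Rightarrow> ('a \<Rightarrow> 'a \<Rightarrow> bool) \<Rightarrow> 'a \<Rightarrow> nat \<Rightarrow> (('a \<times> 'a) list \<Rightarrow> 'k::field) set" where
  "low_fil G lt z0 n = {h \<in> tensor_alg (edges G lt z0). \<forall>w. h w \<noteq> 0 \<longrightarrow> weight G lt z0 w < n}"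

text \<open>Kernel J of the canonical surjection T(W) -> A'_Gamma sending an edge e to its class
  in F^(rk e) A / F^(rk e - 1) A. A word w of weight m goes to the class of w in
  F^m A/F^(m-1) A, so f is in the kernel iff each weight-m part of f lies in
  I + F^(m-1) T(W). Thus A'_Gamma = T(W)/J as graded algebras (degree = word length).\<close>
definition assoc_graded_ker :: "'a set \<Rightarrow> ('a \<Rightarrow> 'a \<Rightarrow> bool) \<Rightarrow> 'a \<Rightarrow> (('a \<times> 'a) list \<Rightarrow> 'k::field) set" where
  "assoc_graded_ker G lt z0 =
     {f \<in> tensor_alg (edges G lt z0). \<forall>n. \<exists>g \<in> split_ideal G lt z0. \<exists>h \<in> low_fil G lt z0 n.
         \<forall>w. wpart G lt z0 n f w = g w + h w}"

section \<open>Quadratic and Koszul graded algebras T(E)/J\<close>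

text \<open>A graded algebra generated in degree 1, presented as T(E)/J, is quadratic iff the
 kernel J is generated by its components of degree 1 and 2 (degree-1 relations just
 cut W down to A_1).\<close>
definition quadratic_pres :: "'e set \<Rightarrow> ('e list \<Rightarrow> 'k::field) set \<Rightarrow> bool" where
  "quadratic_pres E J \<longleftrightarrow> J = ideal_of E {f \<in> J. homog 1 f \<or> homog 2 f}"

text \<open>Koszul: the trivial module k = A_0 has a linear graded free resolution
   ... -> P_2 -> P_1 -> P_0 = A -> k -> 0,  P_i = A^(d i) generated in degree i,
 the map P_(i+1) -> P_i being right multiplication by a d(i+1) x d(i) matrix M i with entries
 in A_1. Elements of P_i are represented by tuples (index < d i) of elements of T(E),
 taken modulo J.\<close>

definition tuples :: "'e set \<Rightarrow> nat \<Rightarrow> (nat \<Rightarrow> 'e list \<Rightarrow> 'k::field) set" where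
  "tuples E n = {x. \<forall>k<n. x k \<in> tensor_alg E}"

definition congJ :: "('e list \<Rightarrow> 'k::field) set \<Rightarrow> nat \<Rightarrow> (nat \<Rightarrow> 'e list \<Rightarrow> 'k) \<Rightarrow> (nat \<Rightarrow> 'e list \<Rightarrow> 'k) \<Rightarrow> bool" where
  "congJ J n x y \<longleftrightarrow> (\<forall>l<n. (\<lambda>w. x l w - y l w) \<in> J)"

definition bdry :: "(nat \<Rightarrow> nat) \<Rightarrow> (nat \<Rightarrow> nat \<Rightarrow> nat \<Rightarrow> 'e list \<Rightarrow> 'k::field) \<Rightarrow> nat
     \<Rightarrow> (nat \<Rightarrow> 'e list \<Rightarrow> 'k) \<Rightarrow> nat \<Rightarrow> 'e list \<Rightarrow> 'k" where
  "bdry d M i x = (\<lambda>l w. \<Sum>k<d (Suc i). ncmul (x k) (M i k l) w)"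

definition koszul_pres :: "'e set \<Rightarrow> ('e list \<Rightarrow> 'k::field) set \<Rightarrow> bool" where
  "koszul_pres E J \<longleftrightarrow> (\<exists>(d :: nat \<Rightarrow> nat) (M :: nat \<Rightarrow> nat \<Rightarrow> nat \<Rightarrow> 'e list \<Rightarrow> 'k).
     d 0 = 1 \<and>
     (\<forall>i k l. M i k l \<in> tensor_alg E \<and> homog 1 (M i k l)) \<and>
     (\<forall>i. \<forall>x \<in> tuples E (d (Suc (Suc i))).
          congJ J (d i) (bdry d M i (bdry d M (Suc i) x)) (\<lambda>_ _. 0)) \<and>
     (\<forall>x \<in> tensor_alg E. x [] = 0 \<longrightarrow>
          (\<exists>y \<in> tuples E (d 1). (\<lambda>w. x w - bdry d M 0 y 0 w) \<in> J)) \<and>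
     (\<forall>i. \<forall>x \<in> tuples E (d (Suc i)). congJ J (d i) (bdry d M i x) (\<lambda>_ _. 0) \<longrightarrow>
          (\<exists>y \<in> tuples E (d (Suc (Suc i))). congJ J (d (Suc i)) x (bdry d M (Suc i) y))))"

section \<open>Uniformity\<close>

definition sim_rel :: "'a set \<Rightarrow> ('a \<Rightarrow> 'a \<Rightarrow> bool) \<Rightarrow> 'a \<Rightarrow> 'a \<Rightarrow> ('a \<times> 'a) set" where
  "sim_rel G lt z0 x = {(a, b). covers G lt z0 x a \<and> covers G lt z0 x b \<and>
       (\<exists>c. covers G lt z0 a c \<and> covers G lt z0 b c)}"

definition uniform :: "'a set \<Rightarrow> ('a \<Rightarrow> 'a \<Rightarrow> bool) \<Rightarrow> 'a \<Rightarrow> bool" where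
  "uniform G lt z0 \<longleftrightarrow> (\<forall>x\<in>G. x \<noteq> z0 \<longrightarrow>
      card ({a. covers G lt z0 x a} // (sim_rel G lt z0 x)\<^sup>*) = 1)"

section \<open>Order complexes, reduced cohomology, Cohen-Macaulay\<close>

definition chain_sets :: "'a set \<Rightarrow> ('a \<Rightarrow> 'a \<Rightarrow> bool) \<Rightarrow> 'a set set" where
  "chain_sets P lt = {s. s \<subseteq> P \<and> finite s \<and> is_chain lt s}"

text \<open>n-simplices (n >= -1) of the augmented order complex; the empty chain is the
 (-1)-simplex of the augmented cochain complex computing reduced cohomology.\<close>
definition simplices :: "'a set \<Rightarrow> ('a \<Rightarrow> 'a \<Rightarrow> bool) \<Rightarrow> int \<Rightarrow> 'a set set" where
  "simplices P lt n = {s \<in> chain_sets P lt. int (card s) = n + 1}"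

definition cobdry :: "('a \<Rightarrow> 'a \<Rightarrow> bool) \<Rightarrow> ('a set \<Rightarrow> 'k::field) \<Rightarrow> 'a set \<Rightarrow> 'k" where
  "cobdry lt phi t = (\<Sum>v\<in>t. (-1) ^ card {u \<in> t. lt u v} * phi (t - {v}))"

definition red_coh_nonzero :: "'k::field itself \<Rightarrow> 'a set \<Rightarrow> ('a \<Rightarrow> 'a \<Rightarrow> bool) \<Rightarrow> int \<Rightarrow> bool" where
  "red_coh_nonzero _ P lt n \<longleftrightarrow> n \<ge> -1 \<and>
     (\<exists>phi :: 'a set \<Rightarrow> 'k. (\<forall>t \<in> simplices P lt (n + 1). cobdry lt phi t = 0) \<and>
        \<not> (\<exists>psi :: 'a set \<Rightarrow> 'k. \<forall>s \<in> simplices P lt n. phi s = cobdry lt psi s))"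

text \<open>dimension of the order complex (= -1 for the empty complex)\<close>
definition cplx_dim :: "'a set \<Rightarrow> ('a \<Rightarrow> 'a \<Rightarrow> bool) \<Rightarrow> int" where
  "cplx_dim P lt = Max ((\<lambda>s. int (card s) - 1) ` chain_sets P lt)"

definition cohen_macaulay :: "'k::field itself \<Rightarrow> 'a set \<Rightarrow> ('a \<Rightarrow> 'a \<Rightarrow> bool) \<Rightarrow> bool" where
  "cohen_macaulay K G lt \<longleftrightarrow> (\<forall>a\<in>G. \<forall>b\<in>G. lt a b \<longrightarrow>
     (\<forall>n. red_coh_nonzero K (open_int G lt a b) lt n \<longrightarrow> n = cplx_dim (open_int G lt a b) lt))"

end

theory Submission
  imports Defs
begin

text \<open>The relations of the associated graded algebra A' say that the product of the first k
  edges of a path depends only on its source x and on k. Hence A' is the algebra of a monoid whose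
  normal words are sequences of pairs (x, k) that cannot be merged. That there are no further
  relations is seen from a representation of the splitting algebra: a module over it is a family of
  shift-invariant spaces of linear recurrent sequences, increasing along the order, and such a
  family can be written down on the functions on normal words by explicit triangular recurrences
  whose leading terms are the monoid multiplication.

  In degree 3 the relations of A' follow from those of degree 2 exactly along the equivalence
  relation generated by sharing a covered element, which gives the first claim.

  For the second claim, let C be the space of functions on saturated chains
  x > z_1 > ... > z_(p-1) whose slice at each x is a top-dimensional cycle of the poset of all
  z < x of rank > rk x - p. The linear complex with terms A' (x) C_p is the only candidate for a
  linear resolution of the trivial module. It splits, according to the last pair of a normal word,
  into finite complexes which compute, by filtering chains by the rank of their top element, the
  homology of the truncated intervals (z < b, rk z > r). So A' is Koszul iff all truncated intervals have
  homology only in the top dimension, and the long exact sequence obtained by removing the lowest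
  level of a truncated interval turns this into the same statement for all open intervals.\<close>

section \<open>Ranked posets\<close>

text \<open>The delicate inclusion is the one that excludes further relations: lower-weight terms of
  the splitting relations might combine into new leading terms. The representation avoids any
  analysis of overlaps. A solution at x is determined by its first rk x entries, and for an edge x
  -> y the solutions at x modulo those at y form one copy of the functions on normal words; the edge
  acts on this copy as the shift. Hence the product of the factors (s - e) along a path from b to a
  carries defects relative to a to defects relative to b, and it cannot depend on the path. A pair
  (x, k) remembers a depth below x but no end point. This is why the Koszul complex leads to
  intervals cut off at a rank instead of intervals with a lower end point. C is the only candidate
  because composing the matrices of a linear resolution maps the generators of its p-th term into
  p-fold tensors: two consecutive maps composing to zero place the image inside C, and exactness in
  the lowest degrees makes the map a bijection of bases.\<close>

locale rposet =
  fixes G :: "'a set" and lt :: "'a \<Rightarrow> 'a \<Rightarrow> bool" and z0 :: 'a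
  assumes rp: "ranked_poset G lt z0"
begin

abbreviation rho :: "'a \<Rightarrow> nat" where "rho \<equiv> rk G lt z0"
abbreviation E :: "('a \<times> 'a) set" where "E \<equiv> edges G lt z0"
abbreviation V :: "'a set" where "V \<equiv> G - {z0}"
abbreviation cov :: "'a \<Rightarrow> 'a \<Rightarrow> bool" where "cov \<equiv> covers G lt z0"

lemma finite_G [simp]: "finite G"
  and lt_irrefl [simp]: "x \<in> G \<Longrightarrow> \<not> lt x x"
  and lt_trans: "\<lbrakk>lt x y; lt y z; x \<in> G; y \<in> G; z \<in> G\<rbrakk> \<Longrightarrow> lt x z"
  and z0_in [simp]: "z0 \<in> G"
  using rp unfolding ranked_poset_def by blast+

lemma minimal_iff: "x \<in> G \<Longrightarrow> (\<not> (\<exists>y\<in>G. lt y x)) \<longleftrightarrow> x = z0"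
  using rp unfolding ranked_poset_def by blast

lemma not_lt_z0 [simp]: "x \<in> G \<Longrightarrow> \<not> lt x z0"
  using minimal_iff[of z0] by auto

lemma lt_asym: "\<lbrakk>lt x y; x \<in> G; y \<in> G\<rbrakk> \<Longrightarrow> \<not> lt y x"
  using lt_trans lt_irrefl by blast

lemma maximal_exists:
  assumes "A \<subseteq> G" "A \<noteq> {}"
  shows "\<exists>c\<in>A. \<forall>w\<in>A. \<not> lt c w"
proof -
  have "finite A" using assms finite_subset finite_G by blast
  then show ?thesis using assms(2,1)
  proof (induction A rule: finite_ne_induct)
    case (insert x F)
    then obtain c where c: "c \<in> F" "\<forall>w\<in>F. \<not> lt c w" by auto
    show ?case
    proof (cases "lt c x")
      case True
      have "\<not> lt x w" if "w \<in> F" for w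
        using that c insert.prems True lt_trans[of c x w] by auto
      then show ?thesis using insert.prems by auto
    next
      case False then show ?thesis using c by auto
    qed
  qed auto
qed

lemma minimal_exists:
  assumes "A \<subseteq> G" "A \<noteq> {}"
  shows "\<exists>c\<in>A. \<forall>w\<in>A. \<not> lt w c"
proof -
  have "finite A" using assms finite_subset finite_G by blast
  then show ?thesis using assms(2,1)
  proof (induction A rule: finite_ne_induct)
    case (insert x F)
    then obtain c where c: "c \<in> F" "\<forall>w\<in>F. \<not> lt w c" by auto
    show ?case
    proof (cases "lt x c")
      case True
      have "\<not> lt w x" if "w \<in> F" for w
        using that c insert.prems True lt_trans[of w x c] by auto
      then show ?thesis using insert.prems by auto
    next
      case False then show ?thesis using c by auto
    qed
  qed auto
qed

lemma z0_least: assumes "x \<in> G" "x \<noteq> z0" shows "lt z0 x"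
proof -
  let ?A = "{y\<in>G. lt y x}"
  have "?A \<noteq> {}" using minimal_iff[of x] assms by auto
  then obtain c where c: "c \<in> ?A" "\<forall>w\<in>?A. \<not> lt w c" using minimal_exists[of ?A] by auto
  have "\<not> (\<exists>w\<in>G. lt w c)" using c lt_trans[of _ c x] assms by blast
  then have "c = z0" using minimal_iff[of c] c by auto
  then show ?thesis using c by auto
qed

section \<open>Maximal chains and the rank function\<close>

abbreviation mc :: "'a \<Rightarrow> 'a set \<Rightarrow> bool" where "mc x \<equiv> maxchain_in (closed_int G lt z0 x) lt"

lemma closed_int_z0: "x \<in> G \<Longrightarrow> closed_int G lt z0 x = {y\<in>G. lt y x \<or> y = x}"
  using z0_least unfolding closed_int_def by auto

lemma mc_finite: "x \<in> G \<Longrightarrow> mc x C \<Longrightarrow> finite C \<and> C \<subseteq> G"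
  using finite_subset[OF _ finite_G, of C] unfolding maxchain_in_def closed_int_def by auto

lemma chain_extends:
  assumes "x \<in> G" "C \<subseteq> closed_int G lt z0 x" "is_chain lt C"
  shows "\<exists>C'. C \<subseteq> C' \<and> mc x C'"
proof -
  let ?P = "closed_int G lt z0 x"
  have fin: "finite ?P" unfolding closed_int_def by simp
  let ?S = "{D. C \<subseteq> D \<and> D \<subseteq> ?P \<and> is_chain lt D}"
  have "finite ?S" by (rule finite_subset[of _ "Pow ?P"]) (use fin in auto)
  moreover have "?S \<noteq> {}" using assms by auto
  ultimately have "\<exists>D\<in>?S. \<forall>D'\<in>?S. D \<subseteq> D' \<longrightarrow> D = D'" by (rule finite_has_maximal)
  then obtain D where D: "D \<in> ?S" "\<forall>D'\<in>?S. D \<subseteq> D' \<longrightarrow> D = D'" by (rule bexE)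
  have "mc x D" unfolding maxchain_in_def
  proof (intro conjI notI)
    assume "\<exists>D'. D \<subset> D' \<and> D' \<subseteq> ?P \<and> is_chain lt D'"
    then obtain D' where "D \<subset> D'" "D' \<in> ?S" using D(1) by blast
    then show False using D(2) by blast
  qed (use D(1) in simp_all)
  then show ?thesis using D(1) by blast
qed

text \<open>All maximal chains of [z0, x] have equal size, so the maximum in \<open>rk\<close> is
  taken over a single value. The form with \<open>Suc\<close> removes the truncated subtraction from
  later rank computations; it needs that a maximal chain is nonempty.\<close>

lemma mc_card: assumes "x \<in> G" "mc x C" shows "card C = Suc (rho x)"
proof -
  have eq: "card D = card C" if "mc x D" for D
    using rp assms that unfolding ranked_poset_def by blast
  have "x \<in> closed_int G lt z0 x" using closed_int_z0 assms by auto
  have "(\<lambda>C. card C - 1) ` {C. mc x C} = {card C - 1}"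
  proof
    show "(\<lambda>C. card C - 1) ` {C. mc x C} \<subseteq> {card C - 1}" using eq by auto
    show "{card C - 1} \<subseteq> (\<lambda>C. card C - 1) ` {C. mc x C}" using assms(2) by simp
  qed
  then have r: "rho x = card C - 1" unfolding rk_def by simp
  have "C \<noteq> {}"
  proof
    assume "C = {}"
    have "is_chain lt {x}" unfolding is_chain_def by auto
    then show False using assms(2) \<open>C = {}\<close> \<open>x \<in> closed_int G lt z0 x\<close> unfolding maxchain_in_def by blast
  qed
  then have "card C > 0" using mc_finite[OF assms] by (simp add: card_gt_0_iff)
  then show ?thesis using r by simp
qed

lemma mc_exists: "x \<in> G \<Longrightarrow> \<exists>C. mc x C"
  using chain_extends[of x "{}"] unfolding is_chain_def by auto

lemma mc_insert: assumes "mc x D" "y \<in> closed_int G lt z0 x" "\<And>v. v \<in> D \<Longrightarrow> y = v \<or> lt y v \<or> lt v y"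
  shows "y \<in> D"
proof (rule ccontr)
  assume "y \<notin> D"
  have D: "D \<subseteq> closed_int G lt z0 x" "is_chain lt D"
    "\<not> (\<exists>C'. D \<subset> C' \<and> C' \<subseteq> closed_int G lt z0 x \<and> is_chain lt C')"
    using assms(1) unfolding maxchain_in_def by simp_all
  have "is_chain lt (insert y D)" using D(2) assms(3) unfolding is_chain_def by blast
  moreover have "D \<subset> insert y D" using \<open>y \<notin> D\<close> by blast
  moreover have "insert y D \<subseteq> closed_int G lt z0 x" using D(1) assms(2) by simp
  ultimately show False using D(3) by blast
qed

text \<open>A maximal chain of [z0, y] together with x is a chain, hence part of a maximal chain of
  [z0, x] with at least one element more.\<close>

lemma rho_less: assumes "x \<in> G" "y \<in> G" "lt y x" shows "rho y < rho x"
proof -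
  obtain C where C: "mc y C" using mc_exists assms by blast
  have Cs: "C \<subseteq> {z\<in>G. lt z y \<or> z = y}" "is_chain lt C" using C assms closed_int_z0 unfolding maxchain_in_def by auto
  have lx: "lt z x" if "z \<in> C" for z using that Cs assms lt_trans[of z y x] by auto
  have "is_chain lt (insert x C)" using Cs lx unfolding is_chain_def by blast
  moreover have "insert x C \<subseteq> closed_int G lt z0 x" using closed_int_z0 assms lx Cs by auto
  ultimately have "\<exists>D. insert x C \<subseteq> D \<and> mc x D" by (intro chain_extends[OF assms(1)])
  then obtain D where D: "insert x C \<subseteq> D" "mc x D" by (elim exE conjE)
  have "x \<notin> C" using lx[of x] lt_irrefl[OF assms(1)] by blast
  then have "card (insert x C) = Suc (card C)" using mc_finite[OF assms(2) C] by simp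
  moreover have "card (insert x C) \<le> card D" using D(1) mc_finite[OF assms(1) D(2)] by (intro card_mono) auto
  ultimately show ?thesis using mc_card[OF assms(1) D(2)] mc_card[OF assms(2) C] by simp
qed

text \<open>\<open>covers\<close> is stated through ranks, whereas the order only supplies a c with
  nothing strictly between c and x. The notions agree because adding x to a maximal chain of [z0, c]
  gives a maximal chain of [z0, x].\<close>

lemma cover_below: assumes "x \<in> G" "y \<in> G" "lt y x"
  obtains c where "c \<in> G" "cov x c" "c = y \<or> lt y c"
proof -
  let ?A = "{c\<in>G. lt c x \<and> (c = y \<or> lt y c)}"
  have "?A \<noteq> {}" using assms by auto
  then obtain c where c: "c \<in> ?A" "\<forall>w\<in>?A. \<not> lt c w" using maximal_exists[of ?A] by auto
  obtain C where C: "mc c C" using mc_exists c by blast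
  have cG: "c \<in> G" "lt c x" using c by auto
  have Cs: "C \<subseteq> {z\<in>G. lt z c \<or> z = c}" "is_chain lt C" using C cG closed_int_z0 unfolding maxchain_in_def by auto
  have cC: "c \<in> C" by (rule mc_insert[OF C]) (use closed_int_z0 cG Cs in auto)
  have lx: "lt z x" if "z \<in> C" for z using that Cs assms cG lt_trans[of z c x] by auto
  have ch: "is_chain lt (insert x C)" using Cs lx unfolding is_chain_def by blast
  have sub: "insert x C \<subseteq> closed_int G lt z0 x" using closed_int_z0 assms lx Cs by auto
  \<comment> \<open>A further element w is comparable with c: below c it contradicts the maximality
    of C, above c it contradicts the choice of c.\<close>
  have "mc x (insert x C)" unfolding maxchain_in_def
  proof (intro conjI notI)
    assume "\<exists>D. insert x C \<subset> D \<and> D \<subseteq> closed_int G lt z0 x \<and> is_chain lt D"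
    then obtain D w where D: "insert x C \<subset> D" "D \<subseteq> closed_int G lt z0 x" "is_chain lt D" "w \<in> D" "w \<notin> insert x C" by blast
    have w: "w \<in> G" "lt w x" using D closed_int_z0 assms by auto
    have cmp: "w = v \<or> lt w v \<or> lt v w" if "v \<in> C" for v using D that unfolding is_chain_def by blast
    consider "w = c" | "lt w c" | "lt c w" using cmp cC by blast
    then show False
    proof cases
      case 1 then show False using D cC by auto
    next
      case 2
      have "w \<in> C" by (rule mc_insert[OF C]) (use 2 w cG closed_int_z0 cmp in auto)
      then show False using D by auto
    next
      case 3
      have "w \<in> ?A" using c 3 w lt_trans[of y c w] assms by blast
      then show False using c 3 by blast
    qed
  qed (fact sub, fact ch)
  then have "card (insert x C) = Suc (rho x)" by (rule mc_card[OF assms(1)])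
  moreover have "x \<notin> C" using lx[of x] lt_irrefl[OF assms(1)] by blast
  then have "card (insert x C) = Suc (card C)" using mc_finite[OF cG(1) C] by simp
  ultimately have "rho x = rho c + 1" using mc_card[OF cG(1) C] by linarith
  then have "cov x c" using cG assms(1) unfolding covers_def by blast
  with cG(1) show ?thesis by (rule that) (use c in simp)
qed

lemma rho_z0 [simp]: "rho z0 = 0"
proof -
  have "\<exists>C. mc z0 C" by (rule mc_exists) (rule z0_in)
  then obtain C where C: "mc z0 C" by (elim exE)
  have "closed_int G lt z0 z0 = {z0}" by (auto simp: closed_int_z0)
  then have "C \<subseteq> {z0}" using C unfolding maxchain_in_def by simp
  then have "card C \<le> card {z0}" by (intro card_mono) auto
  then show ?thesis using mc_card[OF z0_in C] by simp
qed

lemma rho_pos: "x \<in> V \<Longrightarrow> 0 < rho x"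
  using rho_less[of x z0] z0_least[of x] by simp

lemma covD: "cov x y \<Longrightarrow> x \<in> G \<and> y \<in> G \<and> x \<in> V \<and> lt y x \<and> rho x = Suc (rho y)"
  unfolding covers_def by auto

lemma E_iff: "(x, y) \<in> E \<longleftrightarrow> cov x y"
  unfolding edges_def by simp

lemma E_fst: "e \<in> E \<Longrightarrow> fst e \<in> V"
  by (cases e) (auto simp: E_iff dest: covD)

lemma cov_exists: "x \<in> V \<Longrightarrow> \<exists>y. cov x y"
  using cover_below[of x z0] z0_least by (metis Diff_iff insertI1 z0_in)

section \<open>Levels below an element\<close>

definition Sx :: "'a \<Rightarrow> nat \<Rightarrow> 'a set" where
  "Sx b k = {x\<in>G. (x = b \<or> lt x b) \<and> rho b = rho x + k}"

lemma Sx_0 [simp]: "b \<in> G \<Longrightarrow> Sx b 0 = {b}"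
  unfolding Sx_def using rho_less[of b] by fastforce

lemma Sx_1: "b \<in> G \<Longrightarrow> x \<in> Sx b (Suc 0) \<longleftrightarrow> cov b x"
  unfolding Sx_def covers_def by auto

lemma finite_Sx [simp]: "finite (Sx b k)"
  unfolding Sx_def by simp

lemma Sx_G: "x \<in> Sx b k \<Longrightarrow> x \<in> G"
  unfolding Sx_def by simp

lemma Sx_trans: "\<lbrakk>x \<in> Sx b k; y \<in> Sx x l; b \<in> G\<rbrakk> \<Longrightarrow> y \<in> Sx b (k + l)"
  unfolding Sx_def using lt_trans[of y x b] by auto

lemma Sx_Suc_elim: assumes "b \<in> G" "x \<in> Sx b (Suc k)"
  obtains c where "cov b c" "x \<in> Sx c k"
proof -
  have x: "x \<in> G" "lt x b" "rho b = rho x + Suc k" using assms unfolding Sx_def by auto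
  obtain c where c: "c \<in> G" "cov b c" "c = x \<or> lt x c" using cover_below[OF assms(1) x(1,2)] by metis
  have "x \<in> Sx c k" using c x covD[OF c(2)] unfolding Sx_def by auto
  with c(2) show ?thesis by (rule that)
qed

end

section \<open>Pairing of noncommutative polynomials with functions on words\<close>

abbreviation fsupp :: "('w \<Rightarrow> 'k::zero) \<Rightarrow> bool" where "fsupp f \<equiv> finite {w. f w \<noteq> 0}"

text \<open>Identities in T(W) are proved by testing against arbitrary functions on words, which
  turns products into concatenations inside the test function.\<close>

definition lin :: "('w \<Rightarrow> 'k::field) \<Rightarrow> ('w \<Rightarrow> 'k) \<Rightarrow> 'k" where
  "lin f \<Phi> = (\<Sum>w | f w \<noteq> 0. f w * \<Phi> w)"

lemma lin_on: "\<lbrakk>finite A; \<And>w. f w \<noteq> 0 \<Longrightarrow> w \<in> A\<rbrakk> \<Longrightarrow> lin f \<Phi> = (\<Sum>w\<in>A. f w * \<Phi> w)"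
  unfolding lin_def by (rule sum.mono_neutral_left) auto

lemma lin_cong: "(\<And>w. f w \<noteq> 0 \<Longrightarrow> \<Phi> w = \<Psi> w) \<Longrightarrow> lin f \<Phi> = lin f \<Psi>"
  unfolding lin_def by (rule sum.cong) auto

lemma lin_zero [simp]: "lin (\<lambda>_. 0) \<Phi> = 0"
  unfolding lin_def by simp

lemma lin_zero_right [simp]: "lin f (\<lambda>_. 0) = 0"
  unfolding lin_def by simp

lemma lin_mult_right: "lin f (\<lambda>w. c * \<Phi> w) = c * lin f \<Phi>"
  unfolding lin_def by (simp add: sum_distrib_left mult_ac)

lemma lin_sum_right: "lin f (\<lambda>w. \<Sum>a\<in>A. \<Phi> a w) = (\<Sum>a\<in>A. lin f (\<Phi> a))"
  unfolding lin_def sum_distrib_left by (rule sum.swap)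

lemma lin_smult: "lin (\<lambda>w. c * f w) \<Phi> = c * lin f \<Phi>"
proof (cases "c = 0")
  case False then show ?thesis unfolding lin_def by (simp add: sum_distrib_left mult_ac)
qed simp

lemma fsupp_add: "fsupp f \<Longrightarrow> fsupp g \<Longrightarrow> fsupp (\<lambda>w. f w + (g w :: 'k::field))"
  by (rule finite_subset[of _ "{w. f w \<noteq> 0} \<union> {w. g w \<noteq> 0}"]) auto

lemma fsupp_diff: "fsupp f \<Longrightarrow> fsupp g \<Longrightarrow> fsupp (\<lambda>w. f w - (g w :: 'k::field))"
  by (rule finite_subset[of _ "{w. f w \<noteq> 0} \<union> {w. g w \<noteq> 0}"]) auto

lemma fsupp_smult: "fsupp f \<Longrightarrow> fsupp (\<lambda>w. c * (f w :: 'k::field))"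
  by (rule finite_subset[of _ "{w. f w \<noteq> 0}"]) auto

lemma fsupp_sum: "finite A \<Longrightarrow> (\<And>a. a \<in> A \<Longrightarrow> fsupp (F a)) \<Longrightarrow> fsupp (\<lambda>w. \<Sum>a\<in>A. (F a w :: 'k::field))"
  by (rule finite_subset[of _ "\<Union>a\<in>A. {w. F a w \<noteq> 0}"]) (auto elim: sum.not_neutral_contains_not_neutral)

lemma lin_add: assumes "fsupp f" "fsupp g"
  shows "lin (\<lambda>w. f w + g w) \<Phi> = lin f \<Phi> + lin g \<Phi>"
proof -
  let ?A = "{w. f w \<noteq> 0} \<union> {w. g w \<noteq> 0}"
  have "lin (\<lambda>w. f w + g w) \<Phi> = (\<Sum>w\<in>?A. (f w + g w) * \<Phi> w)"
    by (rule lin_on) (use assms in auto)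
  also have "\<dots> = (\<Sum>w\<in>?A. f w * \<Phi> w) + (\<Sum>w\<in>?A. g w * \<Phi> w)"
    by (simp add: distrib_right sum.distrib)
  also have "(\<Sum>w\<in>?A. f w * \<Phi> w) = lin f \<Phi>" by (rule lin_on[symmetric]) (use assms in auto)
  also have "(\<Sum>w\<in>?A. g w * \<Phi> w) = lin g \<Phi>" by (rule lin_on[symmetric]) (use assms in auto)
  finally show ?thesis .
qed

lemma lin_diff: assumes "fsupp f" "fsupp g"
  shows "lin (\<lambda>w. f w - g w) \<Phi> = lin f \<Phi> - lin g \<Phi>"
  using lin_add[OF assms(1) fsupp_smult[OF assms(2), of "-1"], of \<Phi>] lin_smult[of "-1" g \<Phi>] by simp

lemma lin_sum: assumes "finite A" "\<And>a. a \<in> A \<Longrightarrow> fsupp (F a)"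
  shows "lin (\<lambda>w. \<Sum>a\<in>A. F a w) \<Phi> = (\<Sum>a\<in>A. lin (F a) \<Phi>)"
  using assms
proof (induction A rule: finite_induct)
  case (insert a A)
  have "fsupp (\<lambda>w. \<Sum>a\<in>A. F a w)" by (rule fsupp_sum) (use insert in auto)
  then show ?case using insert by (simp add: lin_add)
qed simp

lemma fsupp_mono [simp]: "fsupp (mono u :: 'e list \<Rightarrow> 'k::field)"
  unfolding mono_def by simp

lemma lin_mono [simp]: "lin (mono u) \<Phi> = \<Phi> u"
  unfolding lin_def mono_def by simp

lemma lin_indicator: assumes "fsupp f" shows "lin f (\<lambda>w. if w = u then 1 else 0) = f u"
proof -
  have "lin f (\<lambda>w. if w = u then 1 else 0) = (\<Sum>w\<in>insert u {w. f w \<noteq> 0}. f w * (if w = u then 1 else 0))"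
    by (rule lin_on) (use assms in auto)
  also have "\<dots> = (\<Sum>w\<in>{u}. f w * (if w = u then 1 else 0))"
    by (rule sum.mono_neutral_right) (use assms in auto)
  finally show ?thesis by simp
qed

lemma lin_eqI: assumes "fsupp f" "fsupp g" "\<And>\<Phi>. lin f \<Phi> = lin g \<Phi>" shows "f = g"
proof
  fix u show "f u = g u" using lin_indicator[OF assms(1), of u] lin_indicator[OF assms(2), of u] assms(3) by simp
qed

lemma mono_expansion: assumes "fsupp f" shows "(\<Sum>w | f w \<noteq> 0. f w * mono w v) = (f v :: 'k::field)"
proof -
  have "mono w v = (if w = v then 1 else 0 :: 'k)" for w by (auto simp: mono_def)
  then show ?thesis using lin_indicator[OF assms, of v] unfolding lin_def by simp
qed

lemma ncmul_supp: "{w. ncmul f g w \<noteq> 0} \<subseteq> (\<lambda>(u,v). u @ v) ` ({u. f u \<noteq> 0} \<times> {v. g v \<noteq> (0::'k::field)})"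
proof
  fix w assume "w \<in> {w. ncmul f g w \<noteq> 0}"
  then obtain i where "f (take i w) * g (drop i w) \<noteq> 0"
    unfolding ncmul_def by (auto elim: sum.not_neutral_contains_not_neutral)
  then show "w \<in> (\<lambda>(u,v). u @ v) ` ({u. f u \<noteq> 0} \<times> {v. g v \<noteq> 0})"
    by (intro image_eqI[of _ _ "(take i w, drop i w)"]) auto
qed

lemma fsupp_ncmul: "fsupp f \<Longrightarrow> fsupp g \<Longrightarrow> fsupp (ncmul f (g :: 'e list \<Rightarrow> 'k::field))"
  by (rule finite_subset[OF ncmul_supp]) auto

text \<open>Both sides sum \<open>f u * g v * \<Phi> (u @ v)\<close> over pairs (u, v). The left
  side groups the pairs by their concatenation w, and the cutting positions of w enumerate the group
  of w.\<close>

lemma lin_ncmul: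
  fixes f g :: "'e list \<Rightarrow> 'k::field"
  assumes "fsupp f" "fsupp g"
  shows "lin (ncmul f g) \<Phi> = lin f (\<lambda>u. lin g (\<lambda>v. \<Phi> (u @ v)))"
proof -
  let ?A = "{u. f u \<noteq> 0}" let ?B = "{v. g v \<noteq> 0}" let ?c = "\<lambda>(u,v). u @ v"
  let ?W = "?c ` (?A \<times> ?B)"
  let ?h = "\<lambda>(u,v). f u * g v * \<Phi> (u @ v)"
  have pt: "ncmul f g w * \<Phi> w = sum ?h {p \<in> ?A \<times> ?B. ?c p = w}" for w
  proof -
    have fin: "finite {p. ?c p = w}"
    proof (rule finite_subset[of _ "(\<lambda>i. (take i w, drop i w)) ` {..length w}"])
      show "{p. ?c p = w} \<subseteq> (\<lambda>i. (take i w, drop i w)) ` {..length w}"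
      proof clarify
        fix u v assume "w = u @ v"
        then show "(u, v) \<in> (\<lambda>i. (take i (u @ v), drop i (u @ v))) ` {..length (u @ v)}"
          by (intro image_eqI[of _ _ "length u"]) auto
      qed
    qed simp
    have "sum ?h {p \<in> ?A \<times> ?B. ?c p = w} = sum ?h {p. ?c p = w}"
      by (rule sum.mono_neutral_left[OF fin]) auto
    also have "\<dots> = (\<Sum>i\<in>{..length w}. f (take i w) * g (drop i w) * \<Phi> w)"
      by (rule sum.reindex_bij_witness[of _ "\<lambda>i. (take i w, drop i w)" "\<lambda>(u,v). length u"]) auto
    finally have "sum ?h {p \<in> ?A \<times> ?B. ?c p = w} = (\<Sum>i\<in>{..length w}. f (take i w) * g (drop i w) * \<Phi> w)" .
    then show ?thesis unfolding ncmul_def by (simp add: sum_distrib_right)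
  qed
  have "lin (ncmul f g) \<Phi> = (\<Sum>w\<in>?W. ncmul f g w * \<Phi> w)"
    by (rule lin_on) (use assms ncmul_supp[of f g] in auto)
  also have "\<dots> = sum ?h (?A \<times> ?B)"
    unfolding pt by (rule sum.group) (use assms in auto)
  also have "\<dots> = (\<Sum>u\<in>?A. \<Sum>v\<in>?B. f u * g v * \<Phi> (u @ v))"
    by (simp add: sum.cartesian_product)
  finally show ?thesis unfolding lin_def by (simp add: sum_distrib_left mult_ac)
qed

abbreviation ctx :: "'e list \<Rightarrow> ('e list \<Rightarrow> 'k::field) \<Rightarrow> 'e list \<Rightarrow> 'e list \<Rightarrow> 'k" where
  "ctx u g v \<equiv> ncmul (ncmul (mono u) g) (mono v)"

lemma fsupp_ctx: "fsupp g \<Longrightarrow> fsupp (ctx u g v)"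
  by (intro fsupp_ncmul fsupp_mono)

lemma lin_ctx: "fsupp g \<Longrightarrow> lin (ctx u g v) \<Phi> = lin g (\<lambda>t. \<Phi> (u @ t @ v))"
  by (simp add: lin_ncmul fsupp_ncmul)

lemma ctx_ctx: "fsupp g \<Longrightarrow> ctx u (ctx u' g v') v = ctx (u @ u') g (v' @ v)"
  by (rule lin_eqI) (auto simp: lin_ctx fsupp_ctx)

lemma ctx_zero: "ctx u (\<lambda>_. 0) v = (\<lambda>_. 0 :: 'k::field)"
  by (rule lin_eqI) (auto simp: lin_ctx fsupp_ctx)

lemma ctx_add: "fsupp f \<Longrightarrow> fsupp g \<Longrightarrow> ctx u (\<lambda>w. f w + g w) v = (\<lambda>w. ctx u f v w + ctx u g v w)"
  by (rule lin_eqI) (auto simp: lin_ctx fsupp_ctx fsupp_add lin_add)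

lemma ctx_smult: "fsupp f \<Longrightarrow> ctx u (\<lambda>w. c * f w) v = (\<lambda>w. c * ctx u f v w)"
  by (rule lin_eqI) (auto simp: lin_ctx fsupp_ctx fsupp_smult lin_smult)

lemma ctx_diff: "fsupp f \<Longrightarrow> fsupp g \<Longrightarrow> ctx u (\<lambda>w. f w - g w) v = (\<lambda>w. ctx u f v w - ctx u g v w)"
  using ctx_add[of f "\<lambda>w. -1 * g w" u v] ctx_smult[of g u "-1" v] fsupp_smult[of g "-1"] by simp

lemma ctx_mono: "ctx u (mono t) v = (mono (u @ t @ v) :: 'e list \<Rightarrow> 'k::field)"
  by (rule lin_eqI) (auto simp: lin_ctx fsupp_ctx)

lemma ctx_supp: "ctx u g v w \<noteq> 0 \<Longrightarrow> \<exists>t. w = u @ t @ v \<and> g t \<noteq> (0::'k::field)"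
  using ncmul_supp[of "ncmul (mono u) g" "mono v"] ncmul_supp[of "mono u" g]
  by (fastforce simp: mono_def split: if_splits)

section \<open>The tensor algebra and its two-sided ideals\<close>

lemma tensor_fsupp: "f \<in> tensor_alg A \<Longrightarrow> fsupp f"
  and tensor_supp: "f \<in> tensor_alg A \<Longrightarrow> f w \<noteq> 0 \<Longrightarrow> set w \<subseteq> A"
  unfolding tensor_alg_def by auto

lemma tensor_zero: "(\<lambda>_. 0) \<in> tensor_alg A"
  unfolding tensor_alg_def by simp

lemma tensor_add: "f \<in> tensor_alg A \<Longrightarrow> g \<in> tensor_alg A \<Longrightarrow> (\<lambda>w. f w + g w) \<in> tensor_alg A"
  unfolding tensor_alg_def mem_Collect_eq by (intro conjI fsupp_add) (metis add_0)+

lemma tensor_smult: "f \<in> tensor_alg A \<Longrightarrow> (\<lambda>w. c * f w) \<in> tensor_alg A"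
  unfolding tensor_alg_def by (auto intro: fsupp_smult)

lemma tensor_diff: "f \<in> tensor_alg A \<Longrightarrow> g \<in> tensor_alg A \<Longrightarrow> (\<lambda>w. f w - g w) \<in> tensor_alg A"
  using tensor_add[OF _ tensor_smult[of g A "-1"], of f] by simp

lemma tensor_sum: "(\<And>a. a \<in> S \<Longrightarrow> F a \<in> tensor_alg A) \<Longrightarrow> (\<lambda>w. \<Sum>a\<in>S. F a w) \<in> tensor_alg A"
  by (induction S rule: infinite_finite_induct) (auto simp: tensor_zero tensor_add)

lemma tensor_mono: "set w \<subseteq> A \<Longrightarrow> mono w \<in> tensor_alg A"
  unfolding tensor_alg_def mem_Collect_eq by (auto simp: mono_def)

lemma tensor_ncmul: assumes "f \<in> tensor_alg A" "g \<in> tensor_alg A" shows "ncmul f g \<in> tensor_alg A"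
  unfolding tensor_alg_def mem_Collect_eq
proof (intro conjI allI impI)
  show "fsupp (ncmul f g)" using assms by (intro fsupp_ncmul tensor_fsupp)
  fix w assume "ncmul f g w \<noteq> 0"
  then show "set w \<subseteq> A" using ncmul_supp[of f g] tensor_supp[OF assms(1)] tensor_supp[OF assms(2)] by fastforce
qed

lemma ideal_tensor: assumes "f \<in> ideal_of A Gs" "Gs \<subseteq> tensor_alg A" shows "f \<in> tensor_alg A"
  using assms(1)
proof induction
  case (gen g u v) then show ?case using assms(2) by (intro tensor_ncmul tensor_mono) auto
qed (auto intro: tensor_zero tensor_add tensor_smult)

lemma ideal_sum: "(\<And>a. a \<in> S \<Longrightarrow> F a \<in> ideal_of A Gs) \<Longrightarrow> (\<lambda>w. \<Sum>a\<in>S. F a w) \<in> ideal_of A Gs"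
  by (induction S rule: infinite_finite_induct) (auto simp: ideal_of.zero ideal_of.add)

lemma ideal_gen: "g \<in> Gs \<Longrightarrow> fsupp g \<Longrightarrow> g \<in> ideal_of A Gs"
proof -
  assume a: "g \<in> Gs" "fsupp g"
  have "ctx [] g [] = g" by (rule lin_eqI) (use a in \<open>auto simp: lin_ctx fsupp_ctx\<close>)
  then show ?thesis using ideal_of.gen[OF a(1), of "[]" A "[]"] by simp
qed

lemma ideal_ctx: assumes "f \<in> ideal_of A Gs" "Gs \<subseteq> tensor_alg A" "set u \<subseteq> A" "set v \<subseteq> A"
  shows "ctx u f v \<in> ideal_of A Gs"
  using assms(1)
proof induction
  case zero then show ?case by (simp add: ctx_zero ideal_of.zero)
next
  case (gen g u' v')
  then show ?case using assms by (subst ctx_ctx) (auto intro!: ideal_of.gen tensor_fsupp)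
next
  case (add f g) then show ?case using assms(2) by (subst ctx_add) (auto intro: ideal_of.add tensor_fsupp ideal_tensor)
next
  case (smult f c) then show ?case using assms(2) by (subst ctx_smult) (auto intro: ideal_of.smult tensor_fsupp ideal_tensor)
qed

text \<open>The means of showing that an element lies outside an ideal: it suffices that a
  functional vanishes on all translates of generators but not on the element. The functionals used
  later come from the representation, from normal forms, and from the relation of sharing covered
  elements.\<close>

lemma ideal_lin_zero:
  assumes "f \<in> ideal_of A Gs" "Gs \<subseteq> tensor_alg A"
    "\<And>g u v. \<lbrakk>g \<in> Gs; set u \<subseteq> A; set v \<subseteq> A\<rbrakk> \<Longrightarrow> lin g (\<lambda>t. \<Phi> (u @ t @ v)) = 0"
  shows "lin f \<Phi> = 0"
  using assms(1)
proof induction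
  case (gen g u v) then show ?case using assms by (subst lin_ctx) (auto intro: tensor_fsupp)
next
  case (add f g) then show ?case using assms(2) by (subst lin_add) (auto intro: tensor_fsupp ideal_tensor)
qed (auto simp: lin_smult)

section \<open>The monoid of normal words\<close>

context rposet begin

text \<open>A normal word (x_1, k_1) ... (x_l, k_l) is stored with its last pair first. The pair (x, k)
  stands for the product of the first k edges of any path starting at x.\<close>
fun step :: "('a \<times> nat) list \<Rightarrow> 'a \<Rightarrow> ('a \<times> nat) list" where
  "step [] x = [(x, 1)]"
| "step ((b, k) # m) x = (if x \<in> Sx b k then (b, Suc k) # m else (x, 1) # (b, k) # m)"

text \<open>The condition that a pair with source x may follow the word m: an edge from x does not
  prolong the last path of m.\<close>

fun adm :: "('a \<times> nat) list \<Rightarrow> 'a \<Rightarrow> bool" where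
  "adm [] x = True"
| "adm ((b, k) # m) x = (x \<notin> Sx b k)"

fun valid :: "('a \<times> nat) list \<Rightarrow> bool" where
  "valid [] = True"
| "valid ((w, k) # m) = (valid m \<and> adm m w \<and> w \<in> V \<and> 0 < k \<and> k \<le> rho w)"

text \<open>The inverse of \<open>step\<close> on words. The letter that was appended is forgotten,
  but its depth below the source of the last pair is still visible as the length of that pair minus
  one.\<close>

fun prevst :: "('a \<times> nat) list \<Rightarrow> ('a \<times> nat) list" where
  "prevst [] = []"
| "prevst ((b, k) # m) = (if k = 1 then m else (b, k - 1) # m)"

text \<open>Only the sources of edges enter, because edges with the same source become equal in
  A'.\<close>

definition NF :: "('a \<times> 'a) list \<Rightarrow> ('a \<times> nat) list" where
  "NF w = foldl step [] (map fst w)"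

lemma NF_Nil [simp]: "NF [] = []"
  and NF_snoc [simp]: "NF (w @ [e]) = step (NF w) (fst e)"
  and NF_append: "NF (u @ v) = foldl step (NF u) (map fst v)"
  unfolding NF_def by simp_all

lemma step_not_Nil [simp]: "step m x \<noteq> []"
  by (cases "(m, x)" rule: step.cases) auto

lemma step_adm: "adm m x \<Longrightarrow> step m x = (x, 1) # m"
  by (cases "(m, x)" rule: step.cases) auto

lemma step_valid: assumes "valid m" "x \<in> V" shows "valid (step m x)"
proof (cases m)
  case Nil then show ?thesis using assms rho_pos[of x] by simp
next
  case (Cons p m')
  obtain b k where p: "p = (b, k)" by (cases p)
  show ?thesis using assms rho_pos[of x] unfolding Cons p by (auto simp: Sx_def)
qed

lemma NF_valid: "set w \<subseteq> E \<Longrightarrow> valid (NF w)"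
proof (induction w rule: rev_induct)
  case (snoc e w) then show ?case using step_valid[of "NF w" "fst e"] E_fst[of e] by simp
qed simp

text \<open>All letters that can end a given normal word end it from the same predecessor;
  \<open>step_eqD\<close> is the converse. The splitting of the Koszul complex rests on
  this.\<close>

lemma prev_valid: assumes "valid ((b, k) # m)" "x \<in> Sx b (k - 1)" "x \<in> V"
  shows "valid (prevst ((b, k) # m))" "step (prevst ((b, k) # m)) x = (b, k) # m"
proof -
  show "valid (prevst ((b, k) # m))" using assms by auto
  show "step (prevst ((b, k) # m)) x = (b, k) # m"
  proof (cases "k = 1")
    case True
    then have "x = b" using assms Sx_0[of b] by auto
    then show ?thesis using True assms by (simp add: step_adm)
  qed (use assms in auto)
qed

lemma step_eqD: assumes "valid m1" "x \<in> V" "step m1 x = (b, k) # m"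
  shows "m1 = prevst ((b, k) # m) \<and> x \<in> Sx b (k - 1)"
proof (cases m1)
  case Nil then show ?thesis using assms by auto
next
  case (Cons p m')
  obtain c l where p: "p = (c, l)" by (cases p)
  show ?thesis using assms unfolding Cons p by (auto split: if_splits)
qed

section \<open>Weight and length of normal words\<close>

definition wtx :: "'a \<Rightarrow> nat \<Rightarrow> nat" where "wtx x k = (\<Sum>i<k. rho x - i)"
definition swt :: "('a \<times> nat) list \<Rightarrow> nat" where "swt m = sum_list (map (\<lambda>(x, k). wtx x k) m)"
definition slen :: "('a \<times> nat) list \<Rightarrow> nat" where "slen m = sum_list (map snd m)"

lemma swt_simps [simp]: "swt [] = 0" "swt ((x, k) # m) = wtx x k + swt m"
  unfolding swt_def by simp_all

lemma wtx_Suc: "wtx x (Suc k) = wtx x k + (rho x - k)"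
  unfolding wtx_def by simp

lemma wtx_0 [simp]: "wtx x 0 = 0" and wtx_1 [simp]: "wtx x (Suc 0) = rho x"
  unfolding wtx_def by simp_all

text \<open>After k edges from b the next edge starts at rank rk b - k, whichever path was taken, so
  the weight of a word is visible on its normal form.\<close>

lemma swt_step: "swt (step m x) = swt m + rho x"
  by (cases "(m, x)" rule: step.cases) (auto simp: wtx_Suc Sx_def)

lemma slen_step: "slen (step m x) = Suc (slen m)"
  by (cases "(m, x)" rule: step.cases) (auto simp: slen_def)

lemma swt_NF: "swt (NF w) = weight G lt z0 w"
  by (induction w rule: rev_induct) (auto simp: swt_step weight_def)

lemma slen_NF: "slen (NF w) = length w"
  by (induction w rule: rev_induct) (auto simp: slen_step slen_def[of "[]"])

section \<open>Edge paths and canonical words\<close>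

fun epath :: "'a \<Rightarrow> ('a \<times> 'a) list \<Rightarrow> bool" where
  "epath x [] = True"
| "epath x (e # es) = (fst e = x \<and> e \<in> E \<and> epath (snd e) es)"

fun pend :: "'a \<Rightarrow> ('a \<times> 'a) list \<Rightarrow> 'a" where
  "pend x [] = x"
| "pend x (e # es) = pend (snd e) es"

lemma epath_append [simp]: "epath x (es @ es') \<longleftrightarrow> epath x es \<and> epath (pend x es) es'"
  by (induction es arbitrary: x) auto

lemma pend_append [simp]: "pend x (es @ es') = pend (pend x es) es'"
  by (induction es arbitrary: x) auto

lemma epath_E: "epath x es \<Longrightarrow> set es \<subseteq> E"
  by (induction es arbitrary: x) auto

lemma E_Sx: "(x, y) \<in> E \<longleftrightarrow> x \<in> G \<and> y \<in> Sx x (Suc 0)"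
  using Sx_1 covD by (auto simp: E_iff)

lemma pend_Sx: "epath x es \<Longrightarrow> x \<in> G \<Longrightarrow> pend x es \<in> Sx x (length es)"
proof (induction es arbitrary: x)
  case (Cons e es)
  obtain y where e: "e = (x, y)" using Cons.prems by (cases e) auto
  have "y \<in> Sx x (Suc 0)" using Cons.prems unfolding e by (simp add: E_Sx)
  moreover have "pend y es \<in> Sx y (length es)" using Cons.prems Cons.IH[of y] \<open>y \<in> Sx x (Suc 0)\<close> unfolding e by (simp add: Sx_G)
  ultimately show ?case using Sx_trans[of y x "Suc 0" "pend y es" "length es"] Cons.prems unfolding e by simp
qed simp

lemma epath_to: "x \<in> G \<Longrightarrow> y \<in> Sx x k \<Longrightarrow> \<exists>es. epath x es \<and> length es = k \<and> pend x es = y"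
proof (induction k arbitrary: x)
  case 0 then show ?case by (intro exI[of _ "[]"]) simp
next
  case (Suc k)
  obtain c where c: "cov x c" "y \<in> Sx c k" using Sx_Suc_elim Suc.prems by metis
  obtain es where "epath c es \<and> length es = k \<and> pend c es = y" using Suc.IH[of c] c covD[of x c] by auto
  then show ?case using c by (intro exI[of _ "(x, c) # es"]) (simp add: E_iff)
qed

lemma epath_exists: assumes "x \<in> G" "k \<le> rho x" shows "\<exists>es. epath x es \<and> length es = k"
proof -
  have "z0 \<in> Sx x (rho x)" using assms z0_least[of x] by (auto simp: Sx_def)
  then obtain es where es: "epath x es" "length es = rho x" using epath_to assms by blast
  have "epath x (take k es @ drop k es)" using es by simp
  then have "epath x (take k es)" unfolding epath_append by simp
  then show ?thesis using es assms by (intro exI[of _ "take k es"]) simp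
qed

definition pth :: "'a \<Rightarrow> nat \<Rightarrow> ('a \<times> 'a) list" where
  "pth x k = (SOME es. epath x es \<and> length es = k)"

lemma pth: "x \<in> G \<Longrightarrow> k \<le> rho x \<Longrightarrow> epath x (pth x k) \<and> length (pth x k) = k"
  unfolding pth_def by (rule someI_ex) (rule epath_exists)

fun canon :: "('a \<times> nat) list \<Rightarrow> ('a \<times> 'a) list" where
  "canon [] = []"
| "canon ((x, k) # m) = canon m @ pth x k"

lemma foldl_epath: "\<lbrakk>epath x es; adm m x; es \<noteq> []; x \<in> G\<rbrakk> \<Longrightarrow> foldl step m (map fst es) = (x, length es) # m"
proof (induction es rule: rev_induct)
  case (snoc e es)
  show ?case
  proof (cases "es = []")
    case True then show ?thesis using snoc.prems by (simp add: step_adm)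
  next
    case False
    have "pend x es \<in> Sx x (length es)" using snoc.prems by (intro pend_Sx) auto
    then show ?thesis using snoc False by auto
  qed
qed simp

lemma canon_E: "valid m \<Longrightarrow> set (canon m) \<subseteq> E"
  by (induction m rule: canon.induct) (auto dest!: pth epath_E)

lemma NF_canon: "valid m \<Longrightarrow> NF (canon m) = m"
proof (induction m rule: canon.induct)
  case (2 x k m)
  have p: "epath x (pth x k)" "length (pth x k) = k" using pth[of x k] 2 by auto
  have "pth x k \<noteq> []" using p(2) 2 by auto
  then show ?case using 2 foldl_epath[OF p(1), of m] p(2) by (simp add: NF_append)
qed simp

text \<open>Equal normal forms arise only by exchanging paths with the same source and length: every
  word can be moved in this way to the canonical word of its normal form. The relation R is later
  equality in A', equality of normal forms after left multiplication, and congruence modulo the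
  relations of degree at most two.\<close>

lemma NF_congruence:
  assumes tr: "\<And>a b c. R a b \<Longrightarrow> R b c \<Longrightarrow> R a c"
    and sy: "\<And>a b. R a b \<Longrightarrow> R b a"
    and ct: "\<And>a b u v. \<lbrakk>R a b; set u \<subseteq> E; set v \<subseteq> E\<rbrakk> \<Longrightarrow> R (u @ a @ v) (u @ b @ v)"
    and pa: "\<And>x es es'. \<lbrakk>x \<in> G; epath x es; epath x es'; length es = length es'\<rbrakk> \<Longrightarrow> R es es'"
    and w: "set w \<subseteq> E" "set w' \<subseteq> E" "NF w = NF w'"
  shows "R w w'"
proof -
  have ct1: "R (a @ v) (b @ v)" if "R a b" "set v \<subseteq> E" for a b v using ct[OF that(1), of "[]" v] that by simp
  have ct2: "R (u @ a) (u @ b)" if "R a b" "set u \<subseteq> E" for a b u using ct[OF that(1), of u "[]"] that by simp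
  have can: "R w (canon (NF w))" if "set w \<subseteq> E" for w
    using that
  proof (induction w rule: rev_induct)
    case Nil
    show ?case using pa[OF z0_in, of "[]" "[]"] by simp
  next
    case (snoc e w)
    define m where "m = NF w"
    obtain y z where e: "e = (y, z)" by (cases e)
    have yz: "(y, z) \<in> E" "y \<in> V" using snoc.prems E_fst[of e] unfolding e by auto
    have vm: "valid m" unfolding m_def using snoc.prems by (intro NF_valid) simp
    have "R (w @ [e]) (canon m @ [e])" using snoc unfolding m_def by (intro ct1) auto
    moreover have "R (canon m @ [e]) (canon (step m y))"
    proof (cases "adm m y")
      case True
      have "R [e] (pth y 1)" using pth[of y 1] rho_pos[of y] yz unfolding e by (intro pa[of y]) auto
      then show ?thesis using True vm by (simp add: step_adm ct2 canon_E)
    next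
      case False
      then obtain b k m' where m: "m = (b, k) # m'" and y: "y \<in> Sx b k" by (cases m rule: canon.cases) auto
      have b: "b \<in> G" "valid m'" "k \<le> rho b" "Suc k \<le> rho b" using vm y rho_pos[OF yz(2)] unfolding m by (auto simp: Sx_def)
      \<comment> \<open>The chosen path \<open>pth b k\<close> need not end at the source y of e, so
        it is first exchanged for one that does; then \<open>p @ [e]\<close> is again a
        path.\<close>
      obtain p where p: "epath b p" "length p = k" "pend b p = y" using epath_to b y by blast
      have pk: "epath b (pth b k)" "length (pth b k) = k" using pth b by auto
      have pk': "epath b (pth b (Suc k))" "length (pth b (Suc k)) = Suc k" using pth b by auto
      have "R (pth b k @ [e]) (p @ [e])" by (rule ct1, rule pa[of b]) (use b p pk yz e in auto)
      moreover have "R (p @ [e]) (pth b (Suc k))" by (rule pa[of b]) (use b p pk' yz e in auto)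
      ultimately have "R (pth b k @ [e]) (pth b (Suc k))" by (rule tr)
      then have "R (canon m' @ pth b k @ [e]) (canon m' @ pth b (Suc k))" using canon_E[OF b(2)] by (rule ct2)
      then show ?thesis using y unfolding m by simp
    qed
    ultimately show ?case using tr unfolding m_def e by auto
  qed
  show ?thesis using tr[OF can[OF w(1)]] sy[OF can[OF w(2)]] w(3) by simp
qed

section \<open>Coefficients in the monoid algebra, and the kernel of the map onto it\<close>

definition cls :: "(('a \<times> 'a) list \<Rightarrow> 'k::field) \<Rightarrow> ('a \<times> nat) list \<Rightarrow> 'k" where
  "cls f m = lin f (\<lambda>w. if NF w = m then 1 else 0)"

definition class_ker :: "(('a \<times> 'a) list \<Rightarrow> 'k::field) set" where
  "class_ker = {f \<in> tensor_alg E. \<forall>m. cls f m = 0}"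

lemma cls_diff: "\<lbrakk>fsupp f; fsupp g\<rbrakk> \<Longrightarrow> cls (\<lambda>w. f w - g w) m = cls f m - cls g m"
  and cls_smult: "cls (\<lambda>w. c * f w) m = c * cls f m"
  and cls_mono: "cls (mono w) m = (if NF w = m then 1 else 0)"
  and cls_zero: "cls (\<lambda>_. 0) m = 0"
  unfolding cls_def by (simp_all add: lin_diff lin_smult)

lemma cls_sum: "\<lbrakk>finite A; \<And>a. a \<in> A \<Longrightarrow> fsupp (F a)\<rbrakk> \<Longrightarrow> cls (\<lambda>w. \<Sum>a\<in>A. F a w) m = (\<Sum>a\<in>A. cls (F a) m)"
  unfolding cls_def by (rule lin_sum)

lemma cls_nonzero: "cls f m \<noteq> 0 \<Longrightarrow> \<exists>w. f w \<noteq> 0 \<and> NF w = m"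
proof (rule ccontr)
  assume a: "cls f m \<noteq> 0" "\<not> (\<exists>w. f w \<noteq> 0 \<and> NF w = m)"
  have "cls f m = 0" unfolding cls_def lin_def by (rule sum.neutral) (use a(2) in auto)
  then show False using a(1) by simp
qed

lemma lin_NF: assumes "fsupp f" shows "lin f (\<lambda>w. \<Phi> (NF w)) = (\<Sum>m \<in> NF ` {w. f w \<noteq> 0}. cls f m * \<Phi> m)"
proof -
  have "lin f (\<lambda>w. \<Phi> (NF w)) = (\<Sum>m \<in> NF ` {w. f w \<noteq> 0}. \<Sum>w \<in> {w \<in> {w. f w \<noteq> 0}. NF w = m}. f w * \<Phi> (NF w))"
    unfolding lin_def by (rule sum.group[symmetric]) (use assms in auto)
  also have "\<dots> = (\<Sum>m \<in> NF ` {w. f w \<noteq> 0}. cls f m * \<Phi> m)"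
  proof (rule sum.cong[OF refl])
    fix m
    have "cls f m = (\<Sum>w \<in> {w \<in> {w. f w \<noteq> 0}. NF w = m}. f w * 1)" unfolding cls_def lin_def
      by (rule sum.mono_neutral_cong_right) (use assms in auto)
    then show "(\<Sum>w \<in> {w \<in> {w. f w \<noteq> 0}. NF w = m}. f w * \<Phi> (NF w)) = cls f m * \<Phi> m"
      by (simp add: sum_distrib_right)
  qed
  finally show ?thesis .
qed

lemma class_ker_lin_NF: "f \<in> class_ker \<Longrightarrow> lin f (\<lambda>w. \<Phi> (NF w)) = 0"
  by (subst lin_NF) (auto simp: class_ker_def dest: tensor_fsupp)

end

section \<open>Leading terms of the splitting relations\<close>

lemma esym_0 [simp]: "esym es 0 w = (if w = [] then 1 else 0 :: 'k::field)"
proof -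
  have "{S. S \<subseteq> {..<length es} \<and> card S = 0 \<and> nths es S = w} = (if w = [] then {{}} else {})"
    using finite_subset[of _ "{..<length es}"] by auto
  then show ?thesis unfolding esym_def by simp
qed

lemma esym_Nil [simp]: fixes w :: "'e list" shows "esym [] (Suc j) w = (0 :: 'k::field)"
proof -
  have "{S. S \<subseteq> {..<length ([]::'e list)} \<and> card S = Suc j \<and> nths ([]::'e list) S = w} = {}" by auto
  then show ?thesis unfolding esym_def by (metis card.empty mult_zero_right of_nat_0)
qed

text \<open>Multiplication by the factor s - e of the first edge: a set of positions either avoids 0
  or contains it, and the remaining positions are shifted by one.\<close>

lemma esym_Cons: "esym (e # es) (Suc j) w =
  esym es (Suc j) w - (case w of [] \<Rightarrow> 0 | f # w' \<Rightarrow> if f = e then esym es j w' else (0 :: 'k::field))"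
proof -
  let ?A = "\<lambda>es j w. {S. S \<subseteq> {..<length es} \<and> card S = j \<and> nths es S = w}"
  have fin: "finite (?A es j w)" for es :: "'e list" and j w
    by (rule finite_subset[of _ "Pow {..<length es}"]) auto
  have sT: "{j. Suc j \<in> Suc ` T} = T" "{j. Suc j \<in> insert 0 (Suc ` T)} = T" for T by auto
  have cI: "card (Suc ` S) = card S" for S by (rule card_image) simp
  have pre: "S = Suc ` {j. Suc j \<in> S}" if "0 \<notin> S" for S
  proof -
    have "x \<in> Suc ` {j. Suc j \<in> S}" if "x \<in> S" for x using that \<open>0 \<notin> S\<close> by (cases x) auto
    then show ?thesis by auto
  qed
  have pre0: "S = insert 0 (Suc ` {j. Suc j \<in> S})" if "0 \<in> S" for S
  proof -
    have "x \<in> insert 0 (Suc ` {j. Suc j \<in> S})" if "x \<in> S" for x using that by (cases x) auto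
    then show ?thesis using that by auto
  qed
  define B where "B = {S. S \<subseteq> {..<length es} \<and> card S = j \<and> e # nths es S = w}"
  have finB: "finite B" unfolding B_def by (rule finite_subset[of _ "Pow {..<length es}"]) auto
  have split: "?A (e # es) (Suc j) w = image Suc ` ?A es (Suc j) w \<union> (\<lambda>S. insert 0 (Suc ` S)) ` B"
  proof (intro equalityI subsetI)
    fix S assume S: "S \<in> ?A (e # es) (Suc j) w"
    let ?T = "{j. Suc j \<in> S}"
    have fS: "finite S" using S finite_subset by auto
    have T: "?T \<subseteq> {..<length es}" using S by auto
    show "S \<in> image Suc ` ?A es (Suc j) w \<union> (\<lambda>S. insert 0 (Suc ` S)) ` B"
    proof (cases "0 \<in> S")
      case True
      have "card S = Suc (card ?T)" using pre0[OF True] cI[of ?T] finite_subset[OF T] by (metis card_insert_disjoint finite_imageI finite_lessThan imageE nat.distinct(1))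
      then have "?T \<in> B" using S T True by (auto simp: B_def nths_Cons)
      then show ?thesis using pre0[OF True] by blast
    next
      case False
      have "card S = card ?T" using pre[OF False] cI[of ?T] by simp
      then have "?T \<in> ?A es (Suc j) w" using S T False by (auto simp: nths_Cons)
      then show ?thesis using pre[OF False] by blast
    qed
  next
    fix S assume "S \<in> image Suc ` ?A es (Suc j) w \<union> (\<lambda>S. insert 0 (Suc ` S)) ` B"
    then consider T where "T \<in> ?A es (Suc j) w" "S = Suc ` T" | T where "T \<in> B" "S = insert 0 (Suc ` T)" by blast
    then show "S \<in> ?A (e # es) (Suc j) w"
    proof cases
      case 1 then show ?thesis using cI[of T] sT(1)[of T] by (auto simp: nths_Cons)
    next
      case 2
      have "finite T" using 2 finite_subset unfolding B_def by auto
      then show ?thesis using 2 cI[of T] sT(2)[of T] by (auto simp: nths_Cons B_def)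
    qed
  qed
  have "card (?A (e # es) (Suc j) w) = card (image Suc ` ?A es (Suc j) w) + card ((\<lambda>S. insert 0 (Suc ` S)) ` B)"
    unfolding split by (rule card_Un_disjoint) (use fin finB in auto)
  also have "card (image Suc ` ?A es (Suc j) w) = card (?A es (Suc j) w)"
    by (rule card_image) (auto simp: inj_on_def inj_image_eq_iff)
  also have "card ((\<lambda>S. insert 0 (Suc ` S)) ` B) = card B"
  proof (rule card_image, rule inj_onI)
    fix S T assume "insert 0 (Suc ` S) = insert 0 (Suc ` T)"
    then have "insert 0 (Suc ` S) - {0} = insert 0 (Suc ` T) - {0}" by simp
    moreover have "insert 0 (Suc ` S) - {0} = Suc ` S" for S by auto
    ultimately show "S = T" by (simp add: inj_image_eq_iff)
  qed
  finally have c: "card (?A (e # es) (Suc j) w) = card (?A es (Suc j) w) + card B" .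
  have "(-1) ^ j * of_nat (card B) = (case w of [] \<Rightarrow> 0 | f # w' \<Rightarrow> if f = e then esym es j w' else (0 :: 'k))"
    unfolding B_def esym_def by (auto split: list.splits)
  then show ?thesis unfolding esym_def c by (simp add: algebra_simps)
qed

lemma esym_supp: "esym es j w \<noteq> (0 :: 'k::field) \<Longrightarrow> set w \<subseteq> set es \<and> length w = j \<and> j \<le> length es"
proof (induction es arbitrary: j w)
  case Nil then show ?case by (cases j) (auto split: if_splits)
next
  case (Cons e es)
  show ?case
  proof (cases j)
    case 0 then show ?thesis using Cons.prems by (auto split: if_splits)
  next
    case (Suc i)
    then have "esym es (Suc i) w \<noteq> (0::'k) \<or> (\<exists>w'. w = e # w' \<and> esym es i w' \<noteq> (0::'k))"
      using Cons.prems by (auto simp: esym_Cons split: list.splits if_splits)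
    then show ?thesis using Cons.IH Suc by fastforce
  qed
qed

lemma esym_tensor: assumes "set es \<subseteq> A" shows "(esym es j :: _ \<Rightarrow> 'k::field) \<in> tensor_alg A"
  unfolding tensor_alg_def mem_Collect_eq
proof (intro conjI allI impI)
  show "fsupp (esym es j :: _ \<Rightarrow> 'k)"
    by (rule finite_subset[OF _ finite_lists_length_eq[of "set es" j]]) (auto dest: esym_supp)
qed (use assms in \<open>auto dest!: esym_supp\<close>)

context rposet begin

section \<open>The splitting relations modulo lower weight\<close>

abbreviation I :: "(('a \<times> 'a) list \<Rightarrow> 'k::field) set" where "I \<equiv> split_ideal G lt z0"
abbreviation J :: "(('a \<times> 'a) list \<Rightarrow> 'k::field) set" where "J \<equiv> assoc_graded_ker G lt z0"
abbreviation weightE :: "('a \<times> 'a) list \<Rightarrow> nat" where "weightE \<equiv> weight G lt z0"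

lemma weight_simps [simp]: "weightE [] = 0" "weightE (e # w) = rho (fst e) + weightE w" "weightE (u @ v) = weightE u + weightE v"
  unfolding weight_def by simp_all

lemma path_edges_epath: assumes "epath x es"
  shows "path_edges (x # map snd es) = es" "is_path G lt z0 x (pend x es) (x # map snd es)"
proof -
  show "path_edges (x # map snd es) = es" using assms unfolding path_edges_def
  proof (induction es arbitrary: x)
    case (Cons e es) then show ?case by (cases e) auto
  qed simp
  have l: "last (x # map snd es) = pend x es" for x es by (induction es arbitrary: x) auto
  have c: "\<forall>i. Suc i < length (x # map snd es) \<longrightarrow> cov ((x # map snd es) ! i) ((x # map snd es) ! Suc i)" using assms
  proof (induction es arbitrary: x)
    case (Cons e es)
    show ?case
    proof (intro allI impI)
      fix i assume i: "Suc i < length (x # map snd (e # es))"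
      show "cov ((x # map snd (e # es)) ! i) ((x # map snd (e # es)) ! Suc i)"
      proof (cases i)
        case 0 then show ?thesis using Cons.prems E_iff[of "fst e" "snd e"] by auto
      next
        case (Suc j) then show ?thesis using Cons i by auto
      qed
    qed
  qed simp
  show "is_path G lt z0 x (pend x es) (x # map snd es)"
    unfolding is_path_def using l[of x es] c by auto
qed

lemma is_path_epath: assumes "is_path G lt z0 b a cs"
  shows "epath b (path_edges cs) \<and> pend b (path_edges cs) = a"
proof -
  obtain cs' where cs: "cs = b # cs'" using assms unfolding is_path_def by (cases cs) auto
  have "(\<forall>i. Suc i < length (b # cs') \<longrightarrow> cov ((b # cs') ! i) ((b # cs') ! Suc i)) \<Longrightarrow>
    epath b (path_edges (b # cs')) \<and> pend b (path_edges (b # cs')) = last (b # cs')"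
  proof (induction cs' arbitrary: b)
    case (Cons c cs')
    have "epath c (path_edges (c # cs')) \<and> pend c (path_edges (c # cs')) = last (c # cs')"
      by (rule Cons.IH) (use Cons.prems in fastforce)
    moreover have "cov b c" using Cons.prems[rule_format, of 0] by simp
    ultimately show ?case by (auto simp: path_edges_def E_iff)
  qed (simp add: path_edges_def)
  then show ?thesis using assms unfolding is_path_def cs by auto
qed

lemma split_gens_tensor: "split_gens G lt z0 \<subseteq> tensor_alg E"
proof
  fix f :: "('a \<times> 'a) list \<Rightarrow> 'k::field" assume "f \<in> split_gens G lt z0"
  then obtain a b cs cs' j where f: "f = (\<lambda>w. esym (path_edges cs) j w - esym (path_edges cs') j w)"
    "is_path G lt z0 b a cs" "is_path G lt z0 b a cs'"
    unfolding split_gens_def by auto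
  show "f \<in> tensor_alg E" unfolding f(1)
    by (intro tensor_diff esym_tensor epath_E[of b]) (use is_path_epath f in auto)
qed

lemma I_tensor: "f \<in> I \<Longrightarrow> f \<in> tensor_alg E"
  unfolding split_ideal_def using ideal_tensor split_gens_tensor by blast

lemma low_add: "f \<in> low_fil G lt z0 n \<Longrightarrow> g \<in> low_fil G lt z0 n \<Longrightarrow> (\<lambda>w. f w + g w) \<in> low_fil G lt z0 n"
  unfolding low_fil_def mem_Collect_eq by (intro conjI tensor_add) (metis add_0)+

lemma low_smult: "f \<in> low_fil G lt z0 n \<Longrightarrow> (\<lambda>w. c * f w) \<in> low_fil G lt z0 n"
  unfolding low_fil_def by (auto intro: tensor_smult)

lemma low_zero: "(\<lambda>w. 0) \<in> low_fil G lt z0 n"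
  unfolding low_fil_def by (auto intro: tensor_zero)

lemma low_sum: "(\<And>a. a \<in> S \<Longrightarrow> F a \<in> low_fil G lt z0 n) \<Longrightarrow> (\<lambda>w. \<Sum>a\<in>S. F a w) \<in> low_fil G lt z0 n"
  by (induction S rule: infinite_finite_induct) (auto simp: low_zero low_add)

lemma low_ctx: assumes "h \<in> low_fil G lt z0 n" "set u \<subseteq> E" "set v \<subseteq> E"
  shows "ctx u h v \<in> low_fil G lt z0 (weightE u + n + weightE v)"
  unfolding low_fil_def mem_Collect_eq
proof (intro conjI allI impI)
  have h: "h \<in> tensor_alg E" "\<And>w. h w \<noteq> 0 \<Longrightarrow> weightE w < n" using assms(1) unfolding low_fil_def by auto
  show "ctx u h v \<in> tensor_alg E" using h assms by (intro tensor_ncmul tensor_mono)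
  fix w assume "ctx u h v w \<noteq> 0"
  then obtain t where "w = u @ t @ v" "h t \<noteq> 0" using ctx_supp by blast
  then show "weightE w < weightE u + n + weightE v" using h(2) by auto
qed

lemma wtx_cov: assumes "cov x y" shows "wtx x (Suc j) = rho x + wtx y j" "wtx y (Suc j) < wtx x (Suc j)"
proof -
  have r: "rho x = Suc (rho y)" using covD assms by simp
  show 1: "wtx x (Suc j) = rho x + wtx y j"
    unfolding wtx_def by (subst sum.lessThan_Suc_shift) (simp add: r)
  show "wtx y (Suc j) < wtx x (Suc j)" using 1 wtx_Suc[of y j] r by arith
qed

text \<open>Ranks drop along a path, so the initial subword of length k is strictly the heaviest. In
  the induction, subwords avoiding the first edge weigh at most \<open>wtx y k\<close> for the next
  vertex y, which is less than \<open>wtx x k\<close>.\<close>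

lemma esym_leading: "epath x es \<Longrightarrow> x \<in> G \<Longrightarrow> k \<le> length es \<Longrightarrow>
   esym es k (take k es) = ((-1) ^ k :: 'k::field) \<and>
   weightE (take k es) = wtx x k \<and>
   (\<forall>w. esym es k w \<noteq> (0 :: 'k) \<longrightarrow> w = take k es \<or> weightE w < wtx x k)"
proof (induction es arbitrary: x k)
  case (Cons e es)
  obtain y where e: "e = (x, y)" and E: "(x, y) \<in> E" "cov x y" "epath y es" using Cons.prems by (cases e) (auto simp: E_iff)
  have yG: "y \<in> G" using covD E by blast
  show ?case
  proof (cases k)
    case (Suc j)
    have IH: "esym es j (take j es) = ((-1) ^ j :: 'k)" "weightE (take j es) = wtx y j"
       "\<And>w. esym es j w \<noteq> (0 :: 'k) \<Longrightarrow> w = take j es \<or> weightE w < wtx y j"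
      using Cons.IH[OF E(3) yG, of j] Cons.prems Suc by auto
    have low: "weightE w < wtx x (Suc j)" if "esym es (Suc j) w \<noteq> (0::'k)" for w
    proof -
      have "Suc j \<le> length es" using esym_supp[OF that] by simp
      then have "weightE w \<le> wtx y (Suc j)" using Cons.IH[OF E(3) yG, of "Suc j"] that by fastforce
      then show ?thesis using wtx_cov[OF E(2), of j] by simp
    qed
    have wt: "weightE (take k (e # es)) = wtx x k" using IH(2) Suc wtx_cov[OF E(2), of j] e by simp
    \<comment> \<open>The leading word might also occur as a subword of the tail \<open>es\<close>;
      its weight excludes this.\<close>
    have z: "esym es (Suc j) (e # take j es) = (0::'k)" using low[of "e # take j es"] wt Suc by auto
    have "esym (e # es) k (take k (e # es)) = ((-1) ^ k :: 'k)" using z IH(1) Suc by (simp add: esym_Cons)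
    moreover have "w = take k (e # es) \<or> weightE w < wtx x k" if "esym (e # es) k w \<noteq> (0::'k)" for w
    proof -
      have "esym es (Suc j) w \<noteq> (0::'k) \<or> (\<exists>w'. w = e # w' \<and> esym es j w' \<noteq> (0::'k))"
        using that Suc by (auto simp: esym_Cons split: list.splits if_splits)
      then show ?thesis
      proof
        assume "\<exists>w'. w = e # w' \<and> esym es j w' \<noteq> (0::'k)"
        then obtain w' where "w = e # w'" "esym es j w' \<noteq> (0::'k)" by blast
        then show ?thesis using IH(3)[of w'] Suc wtx_cov(1)[OF E(2), of j] e by auto
      qed (use low Suc in auto)
    qed
    ultimately show ?thesis using wt by blast
  qed auto
qed auto

text \<open>Equality of the images of two words of the same weight in A'.\<close>

definition weq :: "'k::field itself \<Rightarrow> ('a \<times> 'a) list \<Rightarrow> ('a \<times> 'a) list \<Rightarrow> bool" where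
  "weq K a b \<longleftrightarrow> weightE a = weightE b \<and>
     (\<exists>g\<in>I. \<exists>h\<in>low_fil G lt z0 (weightE a). \<forall>v. mono a v - mono b v = (g v + h v :: 'k))"

lemma I_ops: "f \<in> I \<Longrightarrow> g \<in> I \<Longrightarrow> (\<lambda>w. f w + g w) \<in> I" "f \<in> I \<Longrightarrow> (\<lambda>w. c * f w) \<in> I"
  "(\<And>a. a \<in> S \<Longrightarrow> F a \<in> I) \<Longrightarrow> (\<lambda>w. \<Sum>a\<in>S. F a w) \<in> I"
  unfolding split_ideal_def by (auto intro: ideal_of.add ideal_of.smult ideal_sum)

lemma weq_trans: assumes "weq K a b" "weq K b c" shows "weq (K :: 'k::field itself) a c"
proof -
  obtain g h g' h' where *: "g \<in> I" "h \<in> low_fil G lt z0 (weightE a)" "\<forall>v. mono a v - mono b v = (g v + h v :: 'k)"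
    "g' \<in> I" "h' \<in> low_fil G lt z0 (weightE b)" "\<forall>v. mono b v - mono c v = (g' v + h' v :: 'k)"
    using assms unfolding weq_def by auto
  have w: "weightE a = weightE b" "weightE b = weightE c" using assms unfolding weq_def by auto
  have "mono a v - mono c v = ((g v + g' v) + (h v + h' v) :: 'k)" for v
  proof -
    have "mono a v - mono c v = (mono a v - mono b v) + (mono b v - mono c v :: 'k)" by simp
    then show ?thesis using *(3,6) by (simp add: algebra_simps)
  qed
  moreover have "(\<lambda>w. h w + h' w) \<in> low_fil G lt z0 (weightE a)" using * w by (intro low_add) auto
  moreover have "(\<lambda>w. g w + g' w) \<in> I" using * by (intro I_ops)
  ultimately show ?thesis using w unfolding weq_def by auto
qed

lemma weq_sym: assumes "weq K a b" shows "weq (K :: 'k::field itself) b a"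
proof -
  obtain g h where "g \<in> I" "h \<in> low_fil G lt z0 (weightE a)" "\<forall>v. mono a v - mono b v = (g v + h v :: 'k)"
    using assms unfolding weq_def by auto
  then show ?thesis using assms unfolding weq_def
    by (intro conjI bexI[of _ "\<lambda>w. -1 * g w"] bexI[of _ "\<lambda>w. -1 * h w"] I_ops low_smult allI)
       (auto simp: algebra_simps)
qed

lemma weq_ctx: assumes "weq K a b" "set u \<subseteq> E" "set v \<subseteq> E" shows "weq (K :: 'k::field itself) (u @ a @ v) (u @ b @ v)"
proof -
  obtain g h where gh: "g \<in> I" "h \<in> low_fil G lt z0 (weightE a)" "\<forall>w. mono a w - mono b w = (g w + h w :: 'k)"
    using assms unfolding weq_def by auto
  have f: "fsupp g" "fsupp h" using gh I_tensor tensor_fsupp unfolding low_fil_def by blast+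
  have "(\<lambda>w. mono a w - mono b w) = (\<lambda>w. g w + h w)" using gh(3) by auto
  then have "ctx u (\<lambda>w. mono a w - mono b w) v = ctx u (\<lambda>w. g w + h w) v" by simp
  then have "(\<lambda>w. mono (u @ a @ v) w - mono (u @ b @ v) w) = (\<lambda>w. ctx u g v w + ctx u h v w)"
    by (simp add: ctx_diff ctx_add f ctx_mono)
  then have "\<forall>w. mono (u @ a @ v) w - mono (u @ b @ v) w = ctx u g v w + ctx u h v w" by meson
  moreover have "ctx u g v \<in> I" using gh(1) assms split_gens_tensor unfolding split_ideal_def by (intro ideal_ctx)
  moreover have "ctx u h v \<in> low_fil G lt z0 (weightE (u @ a @ v))" using low_ctx[OF gh(2) assms(2,3)] by (simp add: add.assoc)
  ultimately show ?thesis using assms(1) unfolding weq_def by auto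
qed

text \<open>The two paths are the leading words of the elements e(\<pi>, k) and e(\<pi>', k) of two
  prolonged paths, and the difference of these elements is a splitting relation.\<close>

lemma weq_path: assumes "x \<in> G" "epath x es" "epath x es'" "length es = length es'"
  shows "weq (K :: 'k::field itself) es es'"
proof -
  define k where "k = length es"
  \<comment> \<open>Splitting relations compare paths with a common end point, while the given paths
    may end differently. Prolonging both down to z0 makes them comparable.\<close>
  have ext: "\<exists>p. epath x (es @ p) \<and> pend x (es @ p) = z0" if "epath x es" for es
  proof -
    have y: "pend x es \<in> G" using pend_Sx[OF that assms(1)] Sx_G by blast
    then have "z0 \<in> Sx (pend x es) (rho (pend x es))" using z0_least by (auto simp: Sx_def)
    from epath_to[OF y this] show ?thesis using that by auto
  qed
  obtain p where p: "epath x (es @ p)" "pend x (es @ p) = z0" using ext assms by blast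
  obtain p' where p': "epath x (es' @ p')" "pend x (es' @ p') = z0" using ext assms by blast
  have "z0 \<in> Sx x (length (es @ p))" using pend_Sx[OF p(1) assms(1)] p(2) by simp
  then have kr: "k \<le> rho x" unfolding Sx_def k_def by auto
  define D where "D = (\<lambda>w. esym (es @ p) k w - esym (es' @ p') k w :: 'k)"
  \<comment> \<open>The sign turns the leading coefficient (-1)^k into 1, so that only terms of
    smaller weight are left for \<open>h\<close>.\<close>
  define g where "g = (\<lambda>w. (-1)^k * D w)"
  define h where "h = (\<lambda>w. mono es w - mono es' w - g w)"
  have DI: "D \<in> I"
  proof (cases "x = z0")
    case True
    then have "k = 0" using kr by simp
    then have "D = (\<lambda>_. 0)" unfolding D_def by auto
    then show ?thesis unfolding split_ideal_def by (simp add: ideal_of.zero)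
  next
    case False
    have "D \<in> split_gens G lt z0" unfolding split_gens_def mem_Collect_eq
      apply (rule exI[of _ z0], rule exI[of _ x], rule exI[of _ "x # map snd (es @ p)"], rule exI[of _ "x # map snd (es' @ p')"], rule exI[of _ k])
      using path_edges_epath[OF p(1)] path_edges_epath[OF p'(1)] p(2) p'(2) z0_least[OF assms(1) False] kr assms(1)
      unfolding D_def by simp
    then show ?thesis unfolding split_ideal_def by (rule ideal_gen) (use split_gens_tensor \<open>D \<in> split_gens G lt z0\<close> in \<open>blast intro: tensor_fsupp\<close>)
  qed
  then have gI: "g \<in> I" unfolding g_def by (rule I_ops)
  have L: "esym (es @ p) k es = ((-1) ^ k :: 'k)" "weightE es = wtx x k"
      "\<And>w. esym (es @ p) k w \<noteq> (0::'k) \<Longrightarrow> w = es \<or> weightE w < wtx x k"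
    using esym_leading[OF p(1) assms(1), of k] unfolding k_def by auto
  have L': "esym (es' @ p') k es' = ((-1) ^ k :: 'k)" "weightE es' = wtx x k"
      "\<And>w. esym (es' @ p') k w \<noteq> (0::'k) \<Longrightarrow> w = es' \<or> weightE w < wtx x k"
    using esym_leading[OF p'(1) assms(1), of k] unfolding k_def assms(4) by auto
  have sq: "(-1)^k * ((-1)^k :: 'k) = 1" by (simp flip: power_mult_distrib)
  have A: "mono es w = (-1)^k * (esym (es @ p) k w :: 'k)" if "\<not> weightE w < wtx x k" for w
    using L(1,2) L(3)[of w] that sq by (cases "w = es") (auto simp: mono_def)
  have A': "mono es' w = (-1)^k * (esym (es' @ p') k w :: 'k)" if "\<not> weightE w < wtx x k" for w
    using L'(1,2) L'(3)[of w] that sq by (cases "w = es'") (auto simp: mono_def)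
  have "h \<in> low_fil G lt z0 (weightE es)" unfolding low_fil_def mem_Collect_eq
  proof (intro conjI allI impI)
    show "h \<in> tensor_alg E" unfolding h_def using assms epath_E gI I_tensor by (intro tensor_diff tensor_mono) blast+
    fix w assume hw: "h w \<noteq> 0"
    have "h w = 0" if "\<not> weightE w < wtx x k"
      unfolding h_def g_def D_def A[OF that] A'[OF that] by (simp add: algebra_simps)
    then show "weightE w < weightE es" unfolding L(2) using hw by blast
  qed
  then show ?thesis unfolding weq_def using gI L(2) L'(2)
    by (intro conjI bexI[of _ g] bexI[of _ h]) (auto simp: h_def)
qed

lemma weq_NF: assumes "set w \<subseteq> E" "set w' \<subseteq> E" "NF w = NF w'" shows "weq (K :: 'k::field itself) w w'"
  using weq_trans weq_sym weq_ctx weq_path assms by (rule NF_congruence)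

text \<open>Each word equals the canonical word of its normal form in A'. After this replacement the
  coefficient of the canonical word of m is \<open>cls f m\<close>, which is 0.\<close>

lemma class_ker_subset_J: "(class_ker :: (('a \<times> 'a) list \<Rightarrow> 'k::field) set) \<subseteq> J"
proof
  fix f :: "('a \<times> 'a) list \<Rightarrow> 'k" assume f: "f \<in> class_ker"
  then have fT: "f \<in> tensor_alg E" and fs: "fsupp f" unfolding class_ker_def by (auto dest: tensor_fsupp)
  show "f \<in> J" unfolding assoc_graded_ker_def mem_Collect_eq
  proof (intro conjI fT allI)
    fix n
    let ?S = "{w. f w \<noteq> 0 \<and> weightE w = n}"
    let ?c = "\<lambda>w. canon (NF w)"
    have fin: "finite ?S" by (rule finite_subset[OF _ fs]) auto
    have "\<exists>g h. g \<in> I \<and> h \<in> low_fil G lt z0 n \<and> (\<forall>v. mono w v - mono (?c w) v = (g v + h v :: 'k))" if "w \<in> ?S" for w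
    proof -
      have w: "set w \<subseteq> E" using that tensor_supp[OF fT] by auto
      have "weq TYPE('k) w (?c w)" by (rule weq_NF) (use w NF_valid in \<open>simp_all add: canon_E NF_canon\<close>)
      then show ?thesis using that unfolding weq_def by auto
    qed
    then have "\<forall>w\<in>?S. \<exists>p. fst p \<in> I \<and> snd p \<in> low_fil G lt z0 n \<and> (\<forall>v. mono w v - mono (?c w) v = (fst p v + snd p v :: 'k))"
      by fastforce
    then obtain P where P: "\<forall>w\<in>?S. fst (P w) \<in> I \<and> snd (P w) \<in> low_fil G lt z0 n \<and> (\<forall>v. mono w v - mono (?c w) v = (fst (P w) v + snd (P w) v :: 'k))"
      by (rule bchoice[THEN exE])
    define g where "g = (\<lambda>w. fst (P w))"
    define h where "h = (\<lambda>w. snd (P w))"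
    have gh: "\<And>w. w \<in> ?S \<Longrightarrow> g w \<in> I" "\<And>w. w \<in> ?S \<Longrightarrow> h w \<in> low_fil G lt z0 n"
       "\<And>w v. w \<in> ?S \<Longrightarrow> mono w v - mono (?c w) v = (g w v + h w v :: 'k)"
      using P unfolding g_def h_def by blast+
    define gg where "gg = (\<lambda>v. \<Sum>w\<in>?S. f w * g w v)"
    define hh where "hh = (\<lambda>v. \<Sum>w\<in>?S. f w * h w v)"
    have "gg \<in> I" unfolding gg_def using gh(1) by (intro I_ops)
    moreover have "hh \<in> low_fil G lt z0 n" unfolding hh_def using gh(2) by (intro low_sum low_smult)
    moreover have "wpart G lt z0 n f v = gg v + hh v" for v
    proof -
      have "gg v + hh v = (\<Sum>w\<in>?S. f w * (mono w v - mono (?c w) v))"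
        unfolding gg_def hh_def by (simp add: gh(3) sum.distrib[symmetric] distrib_left)
      also have "\<dots> = (\<Sum>w\<in>?S. f w * mono w v) - (\<Sum>w\<in>?S. f w * mono (?c w) v)"
        by (simp add: right_diff_distrib sum_subtractf)
      also have "(\<Sum>w\<in>?S. f w * mono w v) = wpart G lt z0 n f v"
      proof -
        have "(\<Sum>w\<in>?S. f w * mono w v) = (\<Sum>w\<in>?S. if w = v then f w else 0)"
          by (rule sum.cong) (auto simp: mono_def)
        then show ?thesis using fin by (simp add: wpart_def)
      qed
      also have "(\<Sum>w\<in>?S. f w * mono (?c w) v) = 0"
      proof -
        \<comment> \<open>Membership in weight n is a condition on the normal form, so
          \<open>class_ker_lin_NF\<close> applies to one weight at a time.\<close>
        have "(\<Sum>w\<in>?S. f w * mono (?c w) v) = (\<Sum>w | f w \<noteq> 0. f w * (if swt (NF w) = n then mono (?c w) v else 0))"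
          by (rule sum.mono_neutral_cong_left) (use fs in \<open>auto simp: swt_NF\<close>)
        also have "\<dots> = 0"
          using class_ker_lin_NF[OF f, of "\<lambda>m. if swt m = n then mono (canon m) v else 0"] unfolding lin_def .
        finally show ?thesis .
      qed
      finally show ?thesis by simp
    qed
    ultimately show "\<exists>g\<in>I. \<exists>h\<in>low_fil G lt z0 n. \<forall>w. wpart G lt z0 n f w = g w + h w" by blast
  qed
qed

section \<open>A filtered representation of the splitting algebra\<close>

text \<open>Pairs of length 0 do not occur in valid words; dropping them here makes the leading
  coefficient of the recurrence an instance of the general term.\<close>

definition app :: "('a \<times> nat) list \<Rightarrow> 'a \<Rightarrow> nat \<Rightarrow> ('a \<times> nat) list" where
  "app m w k = (if k = 0 then m else (w, k) # m)"

definition valid_supp :: "(('a \<times> nat) list \<Rightarrow> 'k::field) \<Rightarrow> bool" where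
  "valid_supp \<phi> \<longleftrightarrow> (\<forall>u. \<not> valid u \<longrightarrow> \<phi> u = 0)"

text \<open>The sequences a in Sol x satisfy the recurrence of the product of the factors (s - e) along a
  path from x to z0, transposed to functions on normal words. The sum over k is the value of that
  polynomial on the normal word m; the equations for all w above x are imposed as well, which makes
  Sol y a subspace of Sol x for y below x.\<close>
definition Sol :: "'a \<Rightarrow> (nat \<Rightarrow> ('a \<times> nat) list \<Rightarrow> 'k::field) \<Rightarrow> bool" where
  "Sol x a \<longleftrightarrow> (\<forall>j. valid_supp (a j)) \<and>
     (\<forall>w\<in>G. w = x \<or> lt x w \<longrightarrow> (\<forall>m i. valid m \<longrightarrow> adm m w \<longrightarrow>
        (\<Sum>k\<le>rho w. (-1) ^ k * a (rho w - k + i) (app m w k)) = 0))"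

lemma Sol_valid_supp: "Sol x a \<Longrightarrow> valid_supp (a j)"
  unfolding Sol_def by blast

lemma Sol_eq: "\<lbrakk>Sol x a; w \<in> G; w = x \<or> lt x w; valid m; adm m w\<rbrakk>
  \<Longrightarrow> (\<Sum>k\<le>rho w. (-1) ^ k * a (rho w - k + i) (app m w k)) = 0"
  unfolding Sol_def by blast

lemma Sol_mono: "\<lbrakk>Sol y a; lt y x; x \<in> G; y \<in> G\<rbrakk> \<Longrightarrow> Sol x a"
  unfolding Sol_def using lt_trans[of y x] by blast

lemma Sol_shift: assumes "Sol x a" shows "Sol x (\<lambda>j. a (j + s))"
  unfolding Sol_def
proof (intro conjI allI ballI impI)
  show "valid_supp (a (j + s))" for j using assms by (rule Sol_valid_supp)
  fix w m i assume "w \<in> G" "w = x \<or> lt x w" "valid m" "adm m w"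
  from Sol_eq[OF assms this, of "i + s"]
  show "(\<Sum>k\<le>rho w. (-1) ^ k * a (rho w - k + i + s) (app m w k)) = 0" by (simp add: add.assoc)
qed

lemma Sol_lin: assumes "Sol x a" "Sol x b" shows "Sol x (\<lambda>j u. \<alpha> * a j u + \<beta> * b j u)"
  unfolding Sol_def
proof (intro conjI allI ballI impI)
  show "valid_supp (\<lambda>u. \<alpha> * a j u + \<beta> * b j u)" for j using Sol_valid_supp[OF assms(1), of j] Sol_valid_supp[OF assms(2), of j] unfolding valid_supp_def by simp
  fix w m i assume w: "w \<in> G" "w = x \<or> lt x w" "valid m" "adm m w"
  have "(\<Sum>k\<le>rho w. (-1) ^ k * (\<alpha> * a (rho w - k + i) (app m w k) + \<beta> * b (rho w - k + i) (app m w k))) =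
     \<alpha> * (\<Sum>k\<le>rho w. (-1) ^ k * a (rho w - k + i) (app m w k)) + \<beta> * (\<Sum>k\<le>rho w. (-1) ^ k * b (rho w - k + i) (app m w k))"
    by (simp add: sum_distrib_left sum.distrib algebra_simps)
  then show "(\<Sum>k\<le>rho w. (-1) ^ k * (\<alpha> * a (rho w - k + i) (app m w k) + \<beta> * b (rho w - k + i) (app m w k))) = 0"
    using Sol_eq[OF assms(1) w] Sol_eq[OF assms(2) w] by simp
qed

lemma Sol_diff: "Sol x a \<Longrightarrow> Sol x b \<Longrightarrow> Sol x (\<lambda>j u. a j u - b j u)"
  using Sol_lin[of x a b 1 "-1"] by simp

lemma not_Sx_self: "0 < k \<Longrightarrow> x \<notin> Sx x k"
  unfolding Sx_def by simp

lemma Sx_unique: "x \<in> Sx w l \<Longrightarrow> x \<in> Sx w k \<Longrightarrow> k = l"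
  unfolding Sx_def by simp

lemma valid_app: "\<lbrakk>valid m; adm m w; w \<in> G; k \<le> rho w\<rbrakk> \<Longrightarrow> valid (app m w k)"
  unfolding app_def by (cases "w = z0") auto

lemma not_adm_cases: assumes "\<not> adm u x" "valid u"
  obtains w l m where "u = (w, l) # m" "x \<in> Sx w l" "w \<in> G" "lt x w" "0 < l" "rho w = rho x + l" "valid m" "adm m w"
proof (cases u rule: valid.cases)
  case (2 w l m)
  then have "x \<in> Sx w l" "valid m" "adm m w" "w \<in> V" "0 < l" using assms by auto
  moreover then have "lt x w" "rho w = rho x + l" by (auto simp: Sx_def)
  ultimately show ?thesis using that[OF 2] by simp
qed (use assms in simp)

fun thetn :: "nat \<Rightarrow> nat" where "thetn 0 = 0" | "thetn (Suc j) = thetn j + Suc j"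

text \<open>The entry \<open>a j u\<close> of a sequence at x receives the weight
  \<open>swt u + Th (rho x) j\<close>. The inequalities \<open>wtx_Th\<close> and
  \<open>wtx_Th_cov\<close> tell which term of an equation is then the heaviest.\<close>

definition Th :: "nat \<Rightarrow> nat \<Rightarrow> nat" where
  "Th n j = (if j \<le> n then thetn j else thetn n + (j - n) * n)"

lemma Th_Suc: "Th n (Suc j) = Th n j + (if j < n then Suc j else n)"
  unfolding Th_def by (cases "j = n") (auto simp: Suc_diff_le not_less le_Suc_eq)

lemma Th_add: "Th n (n + i + d) = Th n (n + i) + d * n"
  by (induction d) (auto simp: Th_Suc)

text \<open>In the equation at x itself no term outweighs k = 0: passing from k to k + 1 adds
  \<open>rho x - k\<close> to the weight of the word and gives up an increment of \<open>Th\<close>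
  at least as large.\<close>

lemma wtx_Th: "k \<le> rho x \<Longrightarrow> wtx x k + Th (rho x) (rho x + i - k) \<le> Th (rho x) (rho x + i)"
proof (induction k)
  case (Suc k)
  define j where "j = rho x + i - Suc k"
  have j: "rho x + i - k = Suc j" using Suc.prems unfolding j_def by simp
  have "Th (rho x) (Suc j) \<ge> Th (rho x) j + (rho x - k)" unfolding Th_Suc using Suc.prems by (auto simp: j_def)
  then show ?case using Suc.IH Suc.prems unfolding wtx_Suc j j_def[symmetric] by simp
qed simp

lemma wtx_shift: "x \<in> Sx w l \<Longrightarrow> wtx w (l + d) = wtx w l + wtx x d"
  by (induction d) (auto simp: wtx_Suc Sx_def)

lemma wtx_lower: "x \<in> Sx w l \<Longrightarrow> d \<le> l \<Longrightarrow> wtx w l \<ge> wtx w (l - d) + d * Suc (rho x)"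
proof (induction d)
  case (Suc d)
  have "wtx w (l - d) = wtx w (l - Suc d) + (rho w - (l - Suc d))" using wtx_Suc[of w "l - Suc d"] Suc.prems by (simp add: Suc_diff_Suc)
  moreover have "rho w - (l - Suc d) \<ge> Suc (rho x)" using Suc.prems by (auto simp: Sx_def)
  ultimately show ?case using Suc by simp
qed simp

text \<open>In the equation at an element w above x the term k = l dominates, where l is the depth
  of x below w. Before l each step adds a rank larger than \<open>rho x\<close>, the increment of
  \<open>Th\<close> in that range; from l on \<open>wtx_Th\<close> applies.\<close>

lemma wtx_Th_cov: assumes "x \<in> Sx w l" "k \<le> rho w"
  shows "wtx w k + Th (rho x) (rho w - k + i) \<le> wtx w l + Th (rho x) (rho x + i)"
    and "k < l \<Longrightarrow> wtx w k + Th (rho x) (rho w - k + i) < wtx w l + Th (rho x) (rho x + i)"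
proof -
  have rw: "rho w = rho x + l" using assms(1) by (simp add: Sx_def)
  show 1: "wtx w k + Th (rho x) (rho w - k + i) < wtx w l + Th (rho x) (rho x + i)" if "k < l"
  proof -
    define d where "d = l - k"
    have k: "k = l - d" "d \<le> l" "0 < d" "rho w - k + i = rho x + i + d" using that rw unfolding d_def by auto
    show ?thesis using wtx_lower[OF assms(1) k(2)] k(3) unfolding k(4) Th_add k(1)[symmetric] by simp
  qed
  show "wtx w k + Th (rho x) (rho w - k + i) \<le> wtx w l + Th (rho x) (rho x + i)"
  proof (cases "k < l")
    case False
    define d where "d = k - l"
    have k: "k = l + d" "d \<le> rho x" "rho w - k + i = rho x + i - d" using False rw assms(2) unfolding d_def by auto
    have "wtx w k = wtx w l + wtx x d" unfolding k(1) by (rule wtx_shift[OF assms(1)])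
    then show ?thesis using wtx_Th[OF k(2), of i] k(3) by simp
  qed (use 1 in simp)
qed

lemma swt_app: "swt (app m w k) = swt m + wtx w k"
  unfolding app_def by simp

text \<open>The increments of Th are 1, 2, ..., n, n, n, ...; this makes each defining equation
  of Sol filtered, with its top term attained only by longer words.\<close>
lemma Sol_weight:
  assumes S: "Sol x a" and x: "x \<in> G"
    and init: "\<And>j u. j < rho x \<Longrightarrow> c + swt u + thetn j < N \<Longrightarrow> a j u = 0"
  shows "c + swt u + Th (rho x) j < N \<Longrightarrow> a j u = 0"
proof -
  \<comment> \<open>First the words that x may follow: the equation at x is solved for k = 0, and
    its other words end in (x, k) and may again be followed by x.\<close>
  have A: "a j u = 0" if "adm u x" "valid u" "c + swt u + Th (rho x) j < N" for j u
    using that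
  proof (induction j arbitrary: u rule: less_induct)
    case (less j)
    show ?case
    proof (cases "j < rho x")
      case True then show ?thesis using init[OF True, of u] less.prems by (simp add: Th_def)
    next
      case False
      define i where "i = j - rho x"
      have j: "j = rho x + i" using False unfolding i_def by simp
      have z: "a (rho x - k + i) (app u x k) = 0" if "k \<le> rho x" "k \<noteq> 0" for k
      proof (rule less.IH)
        show "rho x - k + i < j" using that j by simp
        show "adm (app u x k) x" using that not_Sx_self unfolding app_def by simp
        show "valid (app u x k)" using less.prems that x by (intro valid_app)
        show "c + swt (app u x k) + Th (rho x) (rho x - k + i) < N"
          using wtx_Th[OF that(1), of i] less.prems(3) that(1) unfolding swt_app j by simp
      qed
      have "(\<Sum>k\<le>rho x. (-1) ^ k * a (rho x - k + i) (app u x k)) = (\<Sum>k\<in>{0}. (-1) ^ k * a (rho x - k + i) (app u x k))"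
        by (rule sum.mono_neutral_right) (use z in auto)
      then show ?thesis using Sol_eq[OF S x _ less.prems(2,1), of i] unfolding j by (simp add: app_def)
    qed
  qed
  \<comment> \<open>For a remaining word (w, l) # m the equation at w is solved for k = l. It refers
    to m at a later index, so the induction is on the word, for all j at once.\<close>
  have "\<forall>j. c + swt u + Th (rho x) j < N \<longrightarrow> a j u = 0"
  proof (induction u)
    case Nil then show ?case using A[of "[]"] by simp
  next
    case (Cons p m)
    show ?case
    proof (intro allI impI)
      fix j assume less: "c + swt (p # m) + Th (rho x) j < N"
      show "a j (p # m) = 0"
      proof (cases "valid (p # m) \<and> \<not> adm (p # m) x \<and> \<not> j < rho x")
        case False
        then show ?thesis using A[of "p # m" j] less Sol_valid_supp[OF S, of j] init[of j "p # m"] unfolding valid_supp_def Th_def by auto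
      next
        case True
        then obtain w l where p: "p = (w, l)" and c: "x \<in> Sx w l" "w \<in> G" "lt x w" "0 < l" "rho w = rho x + l" "valid m" "adm m w"
          using not_adm_cases[of "p # m" x] by auto
        define i where "i = j - rho x"
        have j: "j = rho x + i" using True unfolding i_def by simp
        have z: "a (rho w - k + i) (app m w k) = 0" if "k \<le> rho w" "k \<noteq> l" for k
        proof -
          have b: "c + swt (app m w k) + Th (rho x) (rho w - k + i) < N"
            using wtx_Th_cov(1)[OF c(1) that(1), of i] less unfolding swt_app j p by simp
          show ?thesis
          proof (cases "k = 0")
            case True then show ?thesis using Cons.IH b by (simp add: app_def)
          next
            case False
            then have "adm (app m w k) x" using Sx_unique[OF c(1), of k] that by (auto simp: app_def)
            then show ?thesis using A b valid_app c that by blast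
          qed
        qed
        have "(\<Sum>k\<le>rho w. (-1) ^ k * a (rho w - k + i) (app m w k)) = (\<Sum>k\<in>{l}. (-1) ^ k * a (rho w - k + i) (app m w k))"
          by (rule sum.mono_neutral_right) (use z c in auto)
        then show ?thesis using Sol_eq[OF S c(2) _ c(6,7), of i] c unfolding j p by (simp add: app_def)
      qed
    qed
  qed
  then show "c + swt u + Th (rho x) j < N \<Longrightarrow> a j u = 0" by blast
qed

text \<open>With vanishing initial entries the bound N in \<open>Sol_weight\<close> may be taken as
  large as desired.\<close>

lemma Sol_zero: assumes "Sol x a" "x \<in> G" "\<And>j. j < rho x \<Longrightarrow> a j = (\<lambda>_. 0)" shows "a j u = 0"
  by (rule Sol_weight[OF assms(1,2), where N = "Suc (swt u + Th (rho x) j)" and c = 0]) (use assms(3) in auto)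

lemma Sol_unique: assumes "Sol x a" "Sol x b" "x \<in> G" "\<And>j. j < rho x \<Longrightarrow> a j = b j" shows "a = b"
proof (intro ext)
  fix j u
  have "a j u - b j u = 0" using Sol_zero[OF Sol_diff[OF assms(1,2)] assms(3), of j u] assms(4) by simp
  then show "a j u = b j u" by simp
qed

text \<open>The equation at x solved for its term k = 0. The words on the right end in (x, t) and
  may be followed by x again, so recursion on the index is enough.\<close>

function sol_adm :: "'a \<Rightarrow> (nat \<Rightarrow> ('a \<times> nat) list \<Rightarrow> 'k::field) \<Rightarrow> nat \<Rightarrow> ('a \<times> nat) list \<Rightarrow> 'k" where
  "sol_adm x a j u = (if j < rho x then a j u else if \<not> valid u then 0
     else - (\<Sum>t\<in>{1..rho x}. (-1) ^ t * sol_adm x a (j - t) ((x, t) # u)))"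
  by auto
termination by (relation "measure (\<lambda>(x, a, j, u). j)") auto

declare sol_adm.simps [simp del]

text \<open>On a word ending in (w, l) that x prolongs, the equation at w is solved for k = l. Its
  term k = 0 refers to the shorter word at the later index j + l; therefore the recursion runs over
  words and the index comes last. \<open>extn\<close> restores the order of arguments.\<close>

primrec sol :: "'a \<Rightarrow> (nat \<Rightarrow> ('a \<times> nat) list \<Rightarrow> 'k::field) \<Rightarrow> ('a \<times> nat) list \<Rightarrow> nat \<Rightarrow> 'k" where
  "sol x a [] j = sol_adm x a j []"
| "sol x a (p # m) j = (if j < rho x \<or> \<not> valid (p # m) \<or> adm (p # m) x then sol_adm x a j (p # m)
     else - ((-1) ^ snd p * (sol x a m (j + snd p) +
        (\<Sum>k\<in>{1..rho (fst p)} - {snd p}. (-1) ^ k * sol_adm x a (j + snd p - k) ((fst p, k) # m)))))"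

definition extn :: "'a \<Rightarrow> (nat \<Rightarrow> ('a \<times> nat) list \<Rightarrow> 'k::field) \<Rightarrow> nat \<Rightarrow> ('a \<times> nat) list \<Rightarrow> 'k" where
  "extn x a j u = sol x a u j"

lemma extn_sol_adm: "j < rho x \<or> \<not> valid u \<or> adm u x \<Longrightarrow> extn x a j u = sol_adm x a j u"
  unfolding extn_def by (cases u) auto

lemma extn_init: "j < rho x \<Longrightarrow> extn x a j = a j"
  by (rule ext) (simp add: extn_sol_adm sol_adm.simps)

text \<open>Different equations determine different values: the equation at x for m fixes the value
  at m, the one at w above x for m fixes the value at (w, l) # m. Hence the initial entries can be
  prescribed freely.\<close>

lemma Sol_extn: assumes x: "x \<in> G" and init: "\<And>j. j < rho x \<Longrightarrow> valid_supp (a j)" shows "Sol x (extn x a)"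
  unfolding Sol_def
proof (intro conjI allI ballI impI)
  show "valid_supp (extn x a j)" for j using init[of j] unfolding valid_supp_def by (auto simp: extn_sol_adm sol_adm.simps)
  fix w m i assume w: "w \<in> G" "w = x \<or> lt x w" and m: "valid m" "adm m w"
  let ?T = "\<lambda>k. (-1) ^ k * extn x a (rho w - k + i) (app m w k)"
  show "(\<Sum>k\<le>rho w. ?T k) = 0"
  proof (cases "w = x")
    case True
    have "extn x a (rho w - k + i) (app m w k) = sol_adm x a (rho x + i - k) ((x, k) # m)" if "k \<in> {1..rho x}" for k
    proof -
      have "adm (app m w k) x" using that not_Sx_self[of k x] True unfolding app_def by auto
      then show ?thesis using that True by (simp add: extn_sol_adm app_def)
    qed
    moreover have "?T 0 = - (\<Sum>t\<in>{1..rho x}. (-1) ^ t * sol_adm x a (rho x + i - t) ((x, t) # m))"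
      using m True by (simp add: app_def extn_sol_adm sol_adm.simps[of x a "rho x + i"])
    moreover have "(\<Sum>k\<le>rho w. ?T k) = ?T 0 + (\<Sum>k\<in>{1..rho x}. ?T k)"
      unfolding True by (simp add: atMost_atLeast0 sum.atLeast_Suc_atMost)
    ultimately show ?thesis by simp
  next
    case False
    then have lx: "lt x w" using w by simp
    define l where "l = rho w - rho x"
    have l: "0 < l" "rho w = rho x + l" "l \<le> rho w" using rho_less[OF w(1) x lx] unfolding l_def by auto
    have xS: "x \<in> Sx w l" using x lx l by (simp add: Sx_def)
    have wV: "w \<in> V" using w lx x by auto
    have A: "extn x a (rho w - k + i) (app m w k) = sol_adm x a (rho x + i + l - k) ((w, k) # m)" if "k \<in> {1..rho w} - {l}" for k
    proof -
      have "adm (app m w k) x" using that Sx_unique[OF xS, of k] unfolding app_def by auto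
      then show ?thesis using that l by (simp add: extn_sol_adm app_def add_ac)
    qed
    have B: "extn x a (rho w - l + i) (app m w l) = - ((-1) ^ l * (extn x a (rho x + i + l) m +
        (\<Sum>k\<in>{1..rho w} - {l}. (-1) ^ k * sol_adm x a (rho x + i + l - k) ((w, k) # m))))"
      using m l xS wV unfolding extn_def by (simp add: app_def)
    have "(\<Sum>k\<le>rho w. ?T k) = ?T 0 + (\<Sum>k\<in>{1..rho w}. ?T k)"
      by (simp add: atMost_atLeast0 sum.atLeast_Suc_atMost)
    also have "(\<Sum>k\<in>{1..rho w}. ?T k) = ?T l + (\<Sum>k\<in>{1..rho w} - {l}. ?T k)"
      by (rule sum.remove) (use l in auto)
    also have "(\<Sum>k\<in>{1..rho w} - {l}. ?T k) = (\<Sum>k\<in>{1..rho w} - {l}. (-1) ^ k * sol_adm x a (rho x + i + l - k) ((w, k) # m))"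
      by (rule sum.cong[OF refl], simp only: A)
    also have "?T l = - (extn x a (rho x + i + l) m + (\<Sum>k\<in>{1..rho w} - {l}. (-1) ^ k * sol_adm x a (rho x + i + l - k) ((w, k) # m)))"
      unfolding B by (simp flip: mult.assoc power_mult_distrib)
    also have "?T 0 = extn x a (rho x + i + l) m" using l by (simp add: app_def add_ac)
    finally show ?thesis by simp
  qed
qed

lemma extn_eqI: assumes "x \<in> G" "Sol x b" "\<And>j. j < rho x \<Longrightarrow> b j = a j" shows "extn x a = b"
proof (rule Sol_unique[OF _ assms(2,1)])
  show "Sol x (extn x a)" using Sol_valid_supp[OF assms(2)] assms(3) by (intro Sol_extn[OF assms(1)]) (metis)
qed (use assms(3) in \<open>simp add: extn_init\<close>)

lemma extn_cong: assumes "x \<in> G" "\<And>j. j < rho x \<Longrightarrow> valid_supp (a j)" "\<And>j. j < rho x \<Longrightarrow> a j = b j" shows "extn x a = extn x b"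
  by (rule extn_eqI[OF assms(1), symmetric, rotated 1, THEN sym]) (use assms in \<open>auto intro!: Sol_extn simp: extn_init\<close>)

lemma extn_zero: assumes "x \<in> G" "\<And>j. j < rho x \<Longrightarrow> a j = (\<lambda>_. 0)" shows "extn x a j u = 0"
  by (rule Sol_zero[OF Sol_extn]) (use assms in \<open>auto simp: extn_init valid_supp_def\<close>)

lemma valid_supp_lin: "valid_supp a \<Longrightarrow> valid_supp b \<Longrightarrow> valid_supp (\<lambda>u. \<alpha> * a u + \<beta> * b u)"
  unfolding valid_supp_def by simp

lemma extn_lin: assumes "x \<in> G" "\<And>j. valid_supp (a j)" "\<And>j. valid_supp (b j)"
  shows "extn x (\<lambda>j u. \<alpha> * a j u + \<beta> * b j u) = (\<lambda>j u. \<alpha> * extn x a j u + \<beta> * extn x b j u)"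
  by (rule extn_eqI[OF assms(1)]) (use assms in \<open>auto intro!: Sol_lin Sol_extn simp: extn_init\<close>)

text \<open>The operator of the product of the factors (s - e) along a path from x to z0, where s is the shift:
  the defect of a sequence with respect to the recurrence Sol x.\<close>
definition recur_op :: "'a \<Rightarrow> (nat \<Rightarrow> ('a \<times> nat) list \<Rightarrow> 'k::field) \<Rightarrow> nat \<Rightarrow> ('a \<times> nat) list \<Rightarrow> 'k" where
  "recur_op x a i = (\<lambda>u. a (rho x + i) u - extn x (\<lambda>j. a (j + i)) (rho x) u)"

lemma recur_op_shift: "recur_op x (\<lambda>j. a (j + s)) i = recur_op x a (i + s)"
  unfolding recur_op_def by (simp add: add_ac)

lemma recur_op_Sol: assumes "x \<in> G" "Sol x a" shows "recur_op x a i = (\<lambda>_. 0)"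
proof -
  have "extn x (\<lambda>j. a (j + i)) = (\<lambda>j. a (j + i))" by (rule extn_eqI) (use assms Sol_shift in auto)
  then show ?thesis unfolding recur_op_def by simp
qed

lemma recur_op_lin: assumes "x \<in> G" "\<And>j. valid_supp (a j)" "\<And>j. valid_supp (b j)"
  shows "recur_op x (\<lambda>j u. \<alpha> * a j u + \<beta> * b j u) i = (\<lambda>u. \<alpha> * recur_op x a i u + \<beta> * recur_op x b i u)"
  unfolding recur_op_def using extn_lin[OF assms(1), of "\<lambda>j. a (j + i)" "\<lambda>j. b (j + i)"] assms(2,3) by (auto simp: algebra_simps)

lemma recur_op_valid_supp: assumes "x \<in> G" "\<And>j. valid_supp (a j)" shows "valid_supp (recur_op x a i)"
proof -
  have "valid_supp (extn x (\<lambda>j. a (j + i)) (rho x))" using assms by (intro Sol_valid_supp[OF Sol_extn])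
  then show ?thesis using assms(2)[of "rho x + i"] unfolding recur_op_def valid_supp_def by simp
qed

definition conc :: "nat \<Rightarrow> (('a \<times> nat) list \<Rightarrow> 'k::field) \<Rightarrow> nat \<Rightarrow> ('a \<times> nat) list \<Rightarrow> 'k" where
  "conc n \<phi> j = (if j = n then \<phi> else (\<lambda>_. 0))"

lemma conc_valid_supp: "valid_supp \<phi> \<Longrightarrow> valid_supp (conc n \<phi> j)"
  unfolding conc_def valid_supp_def by simp

text \<open>For an edge (x, y), sending a in \<open>Sol x\<close> to \<open>recur_op y a 0\<close>
  identifies \<open>Sol x\<close> modulo \<open>Sol y\<close> with the functions supported on valid
  words, and this operator is the shift transported there. The function \<phi> is lifted to the
  solution with initial entries 0, ..., 0, \<phi>, and the defect is read one index later.\<close>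

definition edge_op :: "'a \<times> 'a \<Rightarrow> (('a \<times> nat) list \<Rightarrow> 'k::field) \<Rightarrow> ('a \<times> nat) list \<Rightarrow> 'k" where
  "edge_op e \<phi> = recur_op (snd e) (extn (fst e) (conc (rho (fst e) - 1) \<phi>)) 1"

lemma edge_op_lin: assumes "e \<in> E" "valid_supp \<phi>" "valid_supp \<psi>"
  shows "edge_op e (\<lambda>u. \<alpha> * \<phi> u + \<beta> * \<psi> u) = (\<lambda>u. \<alpha> * edge_op e \<phi> u + \<beta> * edge_op e \<psi> u)"
proof -
  obtain x y where e: "e = (x, y)" by (cases e)
  have xy: "x \<in> G" "y \<in> G" using assms(1) covD[of x y] unfolding e by (auto simp: E_iff)
  have "conc n (\<lambda>u. \<alpha> * \<phi> u + \<beta> * \<psi> u) = (\<lambda>j u. \<alpha> * conc n \<phi> j u + \<beta> * conc n \<psi> j u)" for n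
    unfolding conc_def by auto
  then show ?thesis unfolding edge_op_def e using xy assms
    by (simp add: extn_lin conc_valid_supp) (intro recur_op_lin; auto intro!: Sol_valid_supp[OF Sol_extn] conc_valid_supp)
qed

lemma edge_op_valid_supp: assumes "e \<in> E" "valid_supp \<phi>" shows "valid_supp (edge_op e \<phi>)"
proof -
  obtain x y where e: "e = (x, y)" by (cases e)
  have xy: "x \<in> G" "y \<in> G" using assms(1) covD[of x y] unfolding e by (auto simp: E_iff)
  show ?thesis unfolding edge_op_def e using xy assms by (auto intro!: recur_op_valid_supp Sol_valid_supp[OF Sol_extn] conc_valid_supp)
qed

text \<open>The factorisation P_x = (s - e) P_y, with P_x for \<open>recur_op x\<close>. A sequence
  is the sum of one that vanishes on the first \<open>rho x\<close> indices, where the defects are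
  plain values, and a solution at x, where P_x is 0 and the shift acts as
  \<open>edge_op\<close>.\<close>

lemma recur_op_edge: assumes e: "(x, y) \<in> E" and F: "\<And>j. valid_supp (a j)"
  shows "recur_op x a i = (\<lambda>u. recur_op y a (Suc i) u - edge_op (x, y) (recur_op y a i) u)"
proof -
  have xy: "x \<in> G" "y \<in> G" "lt y x" "rho x = Suc (rho y)" using e covD[of x y] by (auto simp: E_iff)
  define n where "n = rho y"
  have key: "recur_op x a 0 = (\<lambda>u. recur_op y a 1 u - edge_op (x, y) (recur_op y a 0) u)" if F: "\<And>j. valid_supp (a j)" for a
  proof -
    define a' where "a' = extn x a"
    have a': "Sol x a'" "\<And>j. j \<le> n \<Longrightarrow> a' j = a j" unfolding a'_def using xy F n_def by (auto intro!: Sol_extn simp: extn_init)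
    have Fa': "\<And>j. valid_supp (a' j)" using Sol_valid_supp a' by blast
    define d where "d = (\<lambda>j u. 1 * a j u + (-1) * a' j u)"
    have dz: "d j = (\<lambda>_. 0)" if "j \<le> n" for j using a'(2)[OF that] unfolding d_def by simp
    have d0: "recur_op y d 0 = (\<lambda>_. 0)" unfolding recur_op_def n_def[symmetric]
      by (rule ext) (use xy dz n_def in \<open>simp add: extn_zero\<close>)
    have d1: "recur_op y d 1 = recur_op x a 0"
    proof
      fix u
      have "extn y (\<lambda>j. d (j + 1)) (rho y) u = 0" by (rule extn_zero) (use xy dz n_def in auto)
      then show "recur_op y d 1 u = recur_op x a 0 u" unfolding recur_op_def d_def a'_def using xy by simp
    qed
    have D: "recur_op y d i = (\<lambda>u. recur_op y a i u - recur_op y a' i u)" for i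
      unfolding d_def using recur_op_lin[OF xy(2) F Fa', where \<alpha> = 1 and \<beta> = "-1" and i = i] by simp
    define b where "b = extn y a'"
    have b: "Sol y b" "\<And>j. j < n \<Longrightarrow> b j = a' j" unfolding b_def using xy Fa' n_def by (auto intro!: Sol_extn simp: extn_init)
    have bx: "Sol x b" using Sol_mono b xy by blast
    have Fb: "\<And>j. valid_supp (b j)" using Sol_valid_supp b by blast
    \<comment> \<open>Subtracting a solution at y with the same first \<open>rho y\<close> entries
      leaves exactly the lift used in \<open>edge_op\<close>.\<close>
    define c where "c = (\<lambda>j u. 1 * a' j u + (-1) * b j u)"
    have cS: "Sol x c" unfolding c_def by (rule Sol_lin[OF a'(1) bx])
    have "c j = conc n (recur_op y a' 0) j" if "j < rho x" for j
    proof (cases "j = n")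
      case True then show ?thesis unfolding c_def conc_def recur_op_def b_def n_def by auto
    next
      case False then show ?thesis using that xy b(2)[of j] unfolding c_def conc_def n_def by auto
    qed
    then have "extn x (conc n (recur_op y a' 0)) = c" by (intro extn_eqI[OF xy(1) cS]) auto
    then have E: "edge_op (x, y) (recur_op y a' 0) = recur_op y c 1" unfolding edge_op_def using xy n_def by simp
    have "recur_op y c 1 = recur_op y a' 1"
      unfolding c_def recur_op_lin[OF xy(2) Fa' Fb] using recur_op_Sol[OF xy(2) b(1)] by simp
    moreover have "recur_op y a' 0 = recur_op y a 0" using D[of 0] d0 by (metis (no_types, lifting) ext eq_iff_diff_eq_0)
    ultimately have "edge_op (x, y) (recur_op y a 0) = recur_op y a' 1" using E by simp
    then show ?thesis using D[of 1] d1 by simp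
  qed
  have "valid_supp (a (j + i))" for j by (rule F)
  from key[of "\<lambda>j. a (j + i)", OF this] show ?thesis unfolding recur_op_shift by simp
qed

end

section \<open>Products of the factors along a path\<close>

lemma ncmul_letter: "ncmul (mono [e]) g w = (case w of [] \<Rightarrow> 0 | f # w' \<Rightarrow> if f = e then g w' else (0 :: 'k::field))"
proof (cases w)
  case Nil then show ?thesis by (simp add: ncmul_def mono_def)
next
  case (Cons f w')
  have "ncmul (mono [e]) g w = (\<Sum>i\<le>length w. if i = 1 then (if f = e then g w' else 0) else 0)"
    unfolding ncmul_def
  proof (rule sum.cong[OF refl])
    fix i assume "i \<in> {..length w}"
    show "mono [e] (take i w) * g (drop i w) = (if i = 1 then if f = e then g w' else 0 else 0)"
    proof (cases "i = 1")
      case False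
      then have "take i w \<noteq> [e]" using \<open>i \<in> {..length w}\<close> by (metis atMost_iff length_Cons length_take list.size(3) min.absorb2 One_nat_def)
      then show ?thesis using False by (simp add: mono_def)
    qed (simp add: Cons mono_def)
  qed
  also have "\<dots> = (if f = e then g w' else 0)" using Cons by (simp del: sum.atMost_Suc)
  finally show ?thesis using Cons by simp
qed

lemma lin_esym_Cons: "lin (esym (e # es) (Suc j)) \<Phi> = lin (esym es (Suc j)) \<Phi> - lin (esym es j) (\<lambda>w. \<Phi> (e # w) :: 'k::field)"
proof -
  have f: "fsupp (esym es j :: _ \<Rightarrow> 'k)" for j using esym_tensor[of es UNIV j] by (intro tensor_fsupp) simp
  have "(esym (e # es) (Suc j) :: _ \<Rightarrow> 'k) = (\<lambda>w. esym es (Suc j) w - ncmul (mono [e]) (esym es j) w)"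
    unfolding esym_Cons ncmul_letter ..
  then have "lin (esym (e # es) (Suc j)) \<Phi> = lin (esym es (Suc j)) \<Phi> - lin (ncmul (mono [e]) (esym es j)) \<Phi>"
    using f by (simp add: lin_diff fsupp_ncmul)
  then show ?thesis using f by (simp add: lin_ncmul)
qed

lemma lin_esym_0: "lin (esym es 0) \<Phi> = (\<Phi> [] :: 'k::field)"
proof -
  have "esym es 0 = (mono [] :: _ \<Rightarrow> 'k)" by (rule ext) (simp add: mono_def)
  then show ?thesis by simp
qed

lemma lin_esym_big: "length es < j \<Longrightarrow> lin (esym es j) \<Phi> = (0 :: 'k::field)"
proof -
  assume a: "length es < j"
  have "esym es j = (\<lambda>_. 0 :: 'k)" using esym_supp[of es j] a by fastforce
  then show ?thesis by simp
qed

context rposet begin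

fun ppoly :: "('a \<times> 'a) list \<Rightarrow> (nat \<Rightarrow> ('a \<times> nat) list \<Rightarrow> 'k::field) \<Rightarrow> nat \<Rightarrow> ('a \<times> nat) list \<Rightarrow> 'k" where
  "ppoly [] c = c"
| "ppoly (e # es) c = (\<lambda>i u. ppoly es c (Suc i) u - edge_op e (ppoly es c i) u)"

lemma recur_op_path: assumes F: "\<And>j. valid_supp (a j)"
  shows "epath x es \<Longrightarrow> x \<in> G \<Longrightarrow> recur_op x a = ppoly es (recur_op (pend x es) a)"
proof (induction es arbitrary: x)
  case (Cons e es)
  obtain y where e: "e = (x, y)" using Cons.prems by (cases e) auto
  have y: "(x, y) \<in> E" "epath y es" "y \<in> G" using Cons.prems covD[of x y] unfolding e by (auto simp: E_iff)
  have "recur_op x a i = ppoly (e # es) (recur_op (pend x (e # es)) a) i" for i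
    using recur_op_edge[OF y(1) F, where i = i] Cons.IH[OF y(2,3)] unfolding e by simp
  then show ?case by blast
qed simp

text \<open>Stage N fixes the entries with index below \<open>rho y + N\<close>; the entry added
  next is chosen to make the defect at index N equal to c N.\<close>

primrec lift_seq :: "'a \<Rightarrow> (nat \<Rightarrow> ('a \<times> nat) list \<Rightarrow> 'k::field) \<Rightarrow> nat \<Rightarrow> nat \<Rightarrow> ('a \<times> nat) list \<Rightarrow> 'k" where
  "lift_seq y c 0 = (\<lambda>_ _. 0)"
| "lift_seq y c (Suc N) = (lift_seq y c N)(rho y + N := (\<lambda>u. c N u + extn y (\<lambda>k. lift_seq y c N (k + N)) (rho y) u))"

text \<open>Surjectivity allows P_y to be cancelled on the right: operators that agree on all
  defects at y agree on all sequences.\<close>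

lemma recur_op_surj: assumes y: "y \<in> G" and c: "\<And>j. valid_supp (c j)"
  shows "\<exists>a. (\<forall>j. valid_supp (a j)) \<and> recur_op y a = c"
proof -
  let ?A = "lift_seq y c"
  have F: "valid_supp (?A N j)" for N j
  proof (induction N arbitrary: j)
    case 0 then show ?case by (simp add: valid_supp_def)
  next
    case (Suc N)
    have "valid_supp (extn y (\<lambda>k. ?A N (k + N)) (rho y))" by (rule Sol_valid_supp[OF Sol_extn]) (use y Suc in auto)
    then have "valid_supp (\<lambda>u. 1 * c N u + 1 * extn y (\<lambda>k. ?A N (k + N)) (rho y) u)" using c by (intro valid_supp_lin)
    then show ?case using Suc by simp
  qed
  have st: "?A (N + d) j = ?A N j" if "j < rho y + N" for N d j
    using that by (induction d) auto
  define a where "a = (\<lambda>j. ?A (Suc j) j)"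
  have aF: "valid_supp (a j)" for j unfolding a_def by (rule F)
  have a: "a j = ?A N j" if "j < rho y + N" for j N
  proof (cases "N \<le> Suc j")
    case True
    then obtain d where "Suc j = N + d" using le_Suc_ex by blast
    then show ?thesis using st[OF that, of d] unfolding a_def by simp
  next
    case False
    then obtain d where "N = Suc j + d" using le_Suc_ex by (metis nat_le_linear)
    then show ?thesis using st[of j "Suc j" d] unfolding a_def by simp
  qed
  have "recur_op y a i = c i" for i
  proof
    fix u
    have "extn y (\<lambda>j. a (j + i)) = extn y (\<lambda>k. ?A i (k + i))"
      by (rule extn_cong[OF y]) (use aF a in auto)
    moreover have "a (rho y + i) = ?A (Suc i) (rho y + i)" by (rule a) simp
    ultimately show "recur_op y a i u = c i u" unfolding recur_op_def by simp
  qed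
  then show ?thesis using aF by blast
qed

text \<open>Applied to the defects of a sequence at the common end point, both products give its
  defects at x.\<close>

lemma ppoly_paths: assumes "x \<in> G" "epath x es" "epath x es'" "pend x es = pend x es'" "\<And>j. valid_supp (c j)"
  shows "ppoly es c = ppoly es' c"
proof -
  have "pend x es \<in> G" using pend_Sx assms Sx_G by blast
  from recur_op_surj[OF this, where c = c, OF assms(5)]
  obtain a where a': "\<forall>j. valid_supp (a j)" "recur_op (pend x es) a = c" by blast
  have a: "\<And>j. valid_supp (a j)" "recur_op (pend x es) a = c" using a' by auto
  show ?thesis using recur_op_path[where a = a, OF a(1) assms(2,1)] recur_op_path[where a = a, OF a(1) assms(3,1)] assms(4) a(2) by simp
qed

fun act :: "('a \<times> 'a) list \<Rightarrow> (('a \<times> nat) list \<Rightarrow> 'k::field) \<Rightarrow> ('a \<times> nat) list \<Rightarrow> 'k" where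
  "act [] \<phi> = \<phi>"
| "act (e # w) \<phi> = edge_op e (act w \<phi>)"

lemma act_append: "act (u @ v) \<phi> = act u (act v \<phi>)"
  by (induction u) auto

lemma act_valid_supp: "set w \<subseteq> E \<Longrightarrow> valid_supp \<phi> \<Longrightarrow> valid_supp (act w \<phi>)"
  by (induction w) (auto simp: edge_op_valid_supp)

lemma edge_op_zero: assumes "e \<in> E" shows "edge_op e (\<lambda>_. 0) = (\<lambda>_. 0)"
  using edge_op_lin[OF assms, of "\<lambda>_. 0" "\<lambda>_. 0" 0 0] by (simp add: valid_supp_def)

lemma act_zero: "set w \<subseteq> E \<Longrightarrow> act w (\<lambda>_. 0) = (\<lambda>_. 0)"
  by (induction w) (auto simp: edge_op_zero)

lemma edge_op_sum: assumes "e \<in> E" "\<And>a. a \<in> A \<Longrightarrow> valid_supp (\<phi> a)"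
  shows "edge_op e (\<lambda>u. \<Sum>a\<in>A. c a * \<phi> a u) = (\<lambda>u. \<Sum>a\<in>A. c a * edge_op e (\<phi> a) u) \<and> valid_supp (\<lambda>u. \<Sum>a\<in>A. c a * \<phi> a u)"
  using assms(2)
proof (induction A rule: infinite_finite_induct)
  case (insert a A)
  have "edge_op e (\<lambda>u. c a * \<phi> a u + 1 * (\<Sum>a\<in>A. c a * \<phi> a u)) = (\<lambda>u. c a * edge_op e (\<phi> a) u + 1 * edge_op e (\<lambda>u. \<Sum>a\<in>A. c a * \<phi> a u) u)"
    using insert by (intro edge_op_lin assms(1)) auto
  then show ?case using insert valid_supp_lin[of "\<phi> a" "\<lambda>u. \<Sum>a\<in>A. c a * \<phi> a u" "c a" 1] by simp
qed (auto simp: edge_op_zero[OF assms(1)] valid_supp_def)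

lemma edge_op_lin_comb: assumes "e \<in> E" "\<And>w. f w \<noteq> 0 \<Longrightarrow> valid_supp (\<psi> w)"
  shows "edge_op e (\<lambda>u. lin f (\<lambda>w. \<psi> w u)) u = lin f (\<lambda>w. edge_op e (\<psi> w) u)"
proof -
  have "edge_op e (\<lambda>u. \<Sum>w | f w \<noteq> 0. f w * \<psi> w u) = (\<lambda>u. \<Sum>w | f w \<noteq> 0. f w * edge_op e (\<psi> w) u)"
    by (rule conjunct1[OF edge_op_sum]) (use assms in auto)
  then show ?thesis unfolding lin_def by metis
qed

lemma lin_valid_supp: "(\<And>w. f w \<noteq> 0 \<Longrightarrow> valid_supp (\<psi> w)) \<Longrightarrow> valid_supp (\<lambda>u. lin f (\<lambda>w. \<psi> w u))"
  unfolding valid_supp_def lin_def by (auto intro!: sum.neutral)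

lemma act_lin_comb: assumes "set v \<subseteq> E" "\<And>w. f w \<noteq> 0 \<Longrightarrow> valid_supp (\<psi> w)"
  shows "act v (\<lambda>u. lin f (\<lambda>w. \<psi> w u)) = (\<lambda>u. lin f (\<lambda>w. act v (\<psi> w) u))"
  using assms(1)
proof (induction v)
  case (Cons e v)
  have "act (e # v) (\<lambda>u. lin f (\<lambda>w. \<psi> w u)) = edge_op e (\<lambda>u. lin f (\<lambda>w. act v (\<psi> w) u))" using Cons by simp
  also have "\<dots> = (\<lambda>u. lin f (\<lambda>w. edge_op e (act v (\<psi> w)) u))"
    by (rule ext, rule edge_op_lin_comb) (use Cons assms act_valid_supp in auto)
  finally show ?case by simp
qed simp

text \<open>Expansion in powers of the shift: for a path \<pi> with n edges, e(\<pi>, j) acts on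
  functions and the power s^(n-j) moves the index to i + n - j.\<close>

lemma ppoly_esym: fixes c :: "nat \<Rightarrow> ('a \<times> nat) list \<Rightarrow> 'k::field" assumes c: "\<And>j. valid_supp (c j)"
  shows "set es \<subseteq> E \<Longrightarrow> ppoly es c i u = (\<Sum>j\<le>length es. lin (esym es j) (\<lambda>w. act w (c (i + length es - j)) u))"
proof (induction es arbitrary: i u)
  case Nil then show ?case by (simp add: lin_esym_0 del: esym_0)
next
  case (Cons e es)
  let ?n = "length es"
  have e: "e \<in> E" "set es \<subseteq> E" using Cons.prems by auto
  have fe: "valid_supp (act w (c k))" if "esym es j w \<noteq> (0::'k)" for j w k
    using esym_supp[OF that] e(2) c by (intro act_valid_supp) auto
  have ff: "valid_supp (\<lambda>u. lin (esym es j) (\<lambda>w. act w (c k) u))" for j k by (rule lin_valid_supp) (rule fe)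
  have p: "ppoly es c i = (\<lambda>u. \<Sum>j\<le>?n. 1 * lin (esym es j) (\<lambda>w. act w (c (i + ?n - j)) u))" for i
    using Cons.IH[OF e(2)] by auto
  have "edge_op e (ppoly es c i) = (\<lambda>u. \<Sum>j\<le>?n. 1 * edge_op e (\<lambda>u. lin (esym es j) (\<lambda>w. act w (c (i + ?n - j)) u)) u)"
    unfolding p by (rule conjunct1[OF edge_op_sum[OF e(1) ff]])
  then have 1: "edge_op e (ppoly es c i) u = (\<Sum>j\<le>?n. lin (esym es j) (\<lambda>w. act (e # w) (c (i + ?n - j)) u))"
    by (simp add: edge_op_lin_comb[OF e(1)] fe)
  have 2: "ppoly es c (Suc i) u = (\<Sum>j\<le>?n. lin (esym es j) (\<lambda>w. act w (c (Suc i + ?n - j)) u))"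
    using Cons.IH[OF e(2)] by simp
  have 3: "\<dots> = (\<Sum>j\<le>Suc ?n. lin (esym es j) (\<lambda>w. act w (c (Suc i + ?n - j)) u))"
    by (simp add: lin_esym_big)
  have "(\<Sum>j\<le>length (e # es). lin (esym (e # es) j) (\<lambda>w. act w (c (i + length (e # es) - j)) u)) =
      lin (esym (e # es) 0) (\<lambda>w. act w (c (Suc i + ?n)) u) +
      (\<Sum>j\<le>?n. lin (esym (e # es) (Suc j)) (\<lambda>w. act w (c (i + ?n - j)) u))"
    by (simp add: sum.atMost_Suc_shift del: sum.atMost_Suc esym_0)
  also have "\<dots> = lin (esym es 0) (\<lambda>w. act w (c (Suc i + ?n)) u) +
      (\<Sum>j\<le>?n. lin (esym es (Suc j)) (\<lambda>w. act w (c (i + ?n - j)) u)) -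
      (\<Sum>j\<le>?n. lin (esym es j) (\<lambda>w. act (e # w) (c (i + ?n - j)) u))"
    by (simp add: lin_esym_Cons lin_esym_0 sum_subtractf del: esym_0)
  also have "lin (esym es 0) (\<lambda>w. act w (c (Suc i + ?n)) u) +
      (\<Sum>j\<le>?n. lin (esym es (Suc j)) (\<lambda>w. act w (c (i + ?n - j)) u)) =
      (\<Sum>j\<le>Suc ?n. lin (esym es j) (\<lambda>w. act w (c (Suc i + ?n - j)) u))"
    by (simp add: sum.atMost_Suc_shift del: sum.atMost_Suc esym_0)
  finally show ?case using 1 2 3 by simp
qed

lemma gens_act: assumes "g \<in> split_gens G lt z0" "valid_supp \<phi>"
  shows "lin g (\<lambda>w. act w \<phi> u) = (0 :: 'k::field)"
proof -
  obtain a b cs cs' j where g: "g = (\<lambda>w. esym (path_edges cs) j w - esym (path_edges cs') j w)" "a \<in> G" "b \<in> G"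
    "is_path G lt z0 b a cs" "is_path G lt z0 b a cs'" "j \<le> rho b - rho a"
    using assms(1) unfolding split_gens_def by auto
  define es where "es = path_edges cs" define es' where "es' = path_edges cs'"
  have p: "epath b es" "pend b es = a" "epath b es'" "pend b es' = a"
    using is_path_epath g unfolding es_def es'_def by auto
  have l: "rho b = rho a + length es" "rho b = rho a + length es'"
    using pend_Sx[OF p(1) g(3)] pend_Sx[OF p(3) g(3)] p(2,4) unfolding Sx_def by auto
  have len: "length es' = length es" "j \<le> length es" using l g(6) by auto
  have ES: "set es \<subseteq> E" "set es' \<subseteq> E" using p epath_E by auto
  \<comment> \<open>A sequence with a single nonzero entry isolates one coefficient of the
    polynomial of a path, here e(\<pi>, j).\<close>
  let ?c = "conc (length es - j) \<phi>"
  have c: "valid_supp (?c i)" for i using assms(2) by (rule conc_valid_supp)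
  have L: "lin (esym fs j) (\<lambda>w. act w \<phi> u) = ppoly fs ?c 0 u" if fs: "set fs \<subseteq> E" "length fs = length es" for fs
  proof -
    have "ppoly fs ?c 0 u = (\<Sum>i\<le>length es. lin (esym fs i) (\<lambda>w. act w (?c (length es - i)) u))"
      using ppoly_esym[of ?c fs 0 u, OF c fs(1)] fs(2) by simp
    also have "\<dots> = (\<Sum>i\<in>{j}. lin (esym fs i) (\<lambda>w. act w (?c (length es - i)) u))"
    proof (rule sum.mono_neutral_right)
      show "\<forall>i\<in>{..length es} - {j}. lin (esym fs i) (\<lambda>w. act w (?c (length es - i)) u) = 0"
      proof
        fix i assume i: "i \<in> {..length es} - {j}"
        have "?c (length es - i) = (\<lambda>_. 0)" using i len unfolding conc_def by auto
        moreover have "lin (esym fs i) (\<lambda>w. act w (\<lambda>_. 0) u) = lin (esym fs i) (\<lambda>w. 0 :: 'k)"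
          by (rule lin_cong) (use esym_supp[of fs i] fs in \<open>fastforce simp: act_zero\<close>)
        ultimately show "lin (esym fs i) (\<lambda>w. act w (?c (length es - i)) u) = 0" by simp
      qed
    qed (use len in auto)
    finally show ?thesis by (simp add: conc_def)
  qed
  have f: "fsupp (esym fs j :: _ \<Rightarrow> 'k)" for fs :: "('a \<times> 'a) list" using esym_tensor[of fs UNIV j] by (intro tensor_fsupp) simp
  have "lin g (\<lambda>w. act w \<phi> u) = ppoly es ?c 0 u - ppoly es' ?c 0 u"
    unfolding g(1) es_def[symmetric] es'_def[symmetric] by (simp add: lin_diff f L ES len)
  then show ?thesis using ppoly_paths[OF g(3) p(1,3), of ?c] p c by simp
qed

lemma I_act: assumes "g \<in> I" "valid_supp \<phi>" shows "lin g (\<lambda>w. act w \<phi> u) = (0 :: 'k::field)"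
proof -
  have "g \<in> ideal_of E (split_gens G lt z0)" using assms(1) unfolding split_ideal_def .
  then show ?thesis
  proof (rule ideal_lin_zero[OF _ split_gens_tensor])
    fix h :: "('a \<times> 'a) list \<Rightarrow> 'k" and a b assume h: "h \<in> split_gens G lt z0" "set a \<subseteq> E" "set b \<subseteq> E"
    have hT: "h w \<noteq> 0 \<Longrightarrow> set w \<subseteq> E" for w using h split_gens_tensor tensor_supp by blast
    have fb: "valid_supp (act b \<phi>)" by (rule act_valid_supp) (use h assms in auto)
    have "lin h (\<lambda>t. act (a @ t @ b) \<phi> u) = lin h (\<lambda>t. act a (act t (act b \<phi>)) u)" by (simp add: act_append)
    also have "\<dots> = act a (\<lambda>s. lin h (\<lambda>t. act t (act b \<phi>) s)) u"
      by (subst act_lin_comb[OF h(2)]) (auto intro: act_valid_supp fb dest: hT)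
    also have "\<dots> = 0" using gens_act[OF h(1) fb] h(2) by (simp add: act_zero)
    finally show "lin h (\<lambda>t. act (a @ t @ b) \<phi> u) = 0" .
  qed
qed

text \<open>To leading order an edge acts as the transpose of right multiplication by its source in
  the monoid. The constant c leaves room for the weight of edges applied before.\<close>

lemma edge_op_weight: assumes e: "(x, y) \<in> E" and F: "valid_supp \<phi>"
  and low: "\<And>u. c + swt u < N \<Longrightarrow> \<phi> u = 0"
  shows "c + swt u + rho x < N \<Longrightarrow> edge_op (x, y) \<phi> u = 0"
    and "c + swt u + rho x = N \<Longrightarrow> valid u \<Longrightarrow> edge_op (x, y) \<phi> u = \<phi> (step u x)"
proof -
  have xy: "x \<in> G" "y \<in> G" "lt y x" "rho x = Suc (rho y)" using e covD[of x y] by (auto simp: E_iff)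
  define n where "n = rho y"
  define a where "a = extn x (conc n \<phi>)"
  \<comment> \<open>In the lift, \<phi> stands at index n = \<open>rho y\<close>, which carries the
    weight \<open>thetn n\<close>.\<close>
  define N' where "N' = N + thetn n"
  have aS: "Sol x a" unfolding a_def using conc_valid_supp[OF F] xy by (intro Sol_extn)
  have ai: "a j = conc n \<phi> j" if "j \<le> n" for j unfolding a_def using that xy n_def by (intro extn_init) simp
  have a0: "a j u = 0" if "c + swt u + Th (rho x) j < N'" for j u
  proof (rule Sol_weight[OF aS xy(1) _ that])
    fix j u assume "j < rho x" "c + swt u + thetn j < N'"
    then show "a j u = 0" using ai[of j] low[of u] xy n_def unfolding conc_def N'_def by auto
  qed
  \<comment> \<open>The correction by a solution at y vanishes even in the top weight: the shift
    moves \<phi> to index n - 1, and from there to index n = \<open>rho y\<close> the weight grows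
    by n only, one less than \<open>rho x\<close>.\<close>
  have b0: "extn y (\<lambda>j. a (j + 1)) (rho y) u = 0" if "c + swt u + rho x \<le> N" for u
  proof (rule Sol_weight[where N = "N + thetn (n - 1)" and c = c])
    show "Sol y (extn y (\<lambda>j. a (j + 1)))" using xy Sol_valid_supp[OF aS] by (intro Sol_extn)
    fix j u assume j: "j < rho y" "c + swt u + thetn j < N + thetn (n - 1)"
    have "extn y (\<lambda>j. a (j + 1)) j = a (j + 1)" using j(1) by (rule extn_init)
    also have "\<dots> = conc n \<phi> (j + 1)" using j n_def by (intro ai) simp
    finally have E: "extn y (\<lambda>j. a (j + 1)) j = conc n \<phi> (j + 1)" .
    show "extn y (\<lambda>j. a (j + 1)) j u = 0"
    proof (cases "j + 1 = n")
      case True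
      then have "n - 1 = j" by simp
      then show ?thesis unfolding E using low[of u] j(2) True by (simp add: conc_def)
    next
      case False then show ?thesis unfolding E by (simp add: conc_def)
    qed
  next
    have "thetn n \<le> thetn (n - 1) + n" by (cases n) auto
    then show "c + swt u + Th (rho y) (rho y) < N + thetn (n - 1)" using that xy n_def by (simp add: Th_def)
  qed (use xy in auto)
  have eo: "edge_op (x, y) \<phi> u = a (rho x) u" if "c + swt u + rho x \<le> N" for u
    unfolding edge_op_def recur_op_def using b0[OF that] xy by (simp add: a_def n_def)
  have Tn: "Th (rho x) (rho x) = thetn n + rho x" unfolding Th_def xy(4) n_def by simp
  show "edge_op (x, y) \<phi> u = 0" if "c + swt u + rho x < N"
    using eo[of u] a0[of u "rho x"] that Tn unfolding N'_def by simp
  show "edge_op (x, y) \<phi> u = \<phi> (step u x)" if u: "c + swt u + rho x = N" "valid u"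
  proof (cases "adm u x")
    case True
    let ?t = "\<lambda>k. (-1) ^ k * a (rho x - k + 0) (app u x k)"
    \<comment> \<open>For k > 1 the index is below n, where the lift is 0. The two remaining terms
      append the pair (x, 1).\<close>
    have z: "?t k = 0" if "k \<le> rho x" "k \<noteq> 0" "k \<noteq> 1" for k
    proof -
      have "rho x - k < n" using that xy n_def by arith
      then show ?thesis using ai[of "rho x - k"] by (simp add: conc_def)
    qed
    have "(\<Sum>k\<le>rho x. ?t k) = (\<Sum>k\<in>{0, 1}. ?t k)"
      by (rule sum.mono_neutral_right) (use z xy in auto)
    also have "\<dots> = a (rho x) u - \<phi> ((x, 1) # u)"
      using ai[of n] xy n_def by (simp add: app_def conc_def)
    finally have "a (rho x) u = \<phi> ((x, 1) # u)" using Sol_eq[OF aS xy(1) _ u(2) True, of 0] by simp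
    then show ?thesis using eo[of u] u True by (simp add: step_adm)
  next
    case False
    obtain w l m where U: "u = (w, l) # m" "x \<in> Sx w l" "w \<in> G" "lt x w" "0 < l" "rho w = rho x + l" "valid m" "adm m w"
      using not_adm_cases[OF False u(2)] .
    let ?t = "\<lambda>k. (-1) ^ k * a (rho w - k + 0) (app m w k)"
    \<comment> \<open>Terms with k < l are too light for \<open>a0\<close>, and terms with k > l + 1
      have an index below n. The two remaining terms lengthen the last pair by one.\<close>
    have z: "?t k = 0" if "k \<le> rho w" "k \<noteq> l" "k \<noteq> Suc l" for k
    proof (cases "k < l")
      case True
      have "c + swt (app m w k) + Th (rho x) (rho w - k + 0) < N'"
        using wtx_Th_cov(2)[OF U(2) that(1) True, of 0] u(1) Tn unfolding swt_app N'_def U(1) by simp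
      then show ?thesis using a0 by simp
    next
      case False
      then have "rho w - k < n" using that xy n_def U(6) by arith
      then show ?thesis using ai[of "rho w - k"] by (simp add: conc_def)
    qed
    have "(\<Sum>k\<le>rho w. ?t k) = (\<Sum>k\<in>{l, Suc l}. ?t k)"
      by (rule sum.mono_neutral_right) (use z xy U in auto)
    also have "\<dots> = (-1) ^ l * (a (rho x) u - \<phi> ((w, Suc l) # m))"
      using ai[of n] xy n_def U by (simp add: app_def conc_def algebra_simps)
    finally have "a (rho x) u = \<phi> ((w, Suc l) # m)" using Sol_eq[OF aS U(3) _ U(7,8), of 0] U(4) by simp
    then show ?thesis using eo[of u] u U by simp
  qed
qed

lemma act_weight: assumes F: "valid_supp \<phi>" and low: "\<And>u. swt u < N \<Longrightarrow> \<phi> u = 0"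
  shows "set w \<subseteq> E \<Longrightarrow> (weightE w + swt u < N \<longrightarrow> act w \<phi> u = 0) \<and>
     (weightE w + swt u = N \<longrightarrow> valid u \<longrightarrow> act w \<phi> u = \<phi> (foldl step u (map fst w)))"
proof (induction w arbitrary: u)
  case (Cons e w)
  obtain x y where e: "e = (x, y)" by (cases e)
  have E: "(x, y) \<in> E" "set w \<subseteq> E" using Cons.prems e by auto
  have Fw: "valid_supp (act w \<phi>)" using E F by (intro act_valid_supp)
  have lw: "act w \<phi> u = 0" if "weightE w + swt u < N" for u using Cons.IH[OF E(2), of u] that by blast
  note W = edge_op_weight[OF E(1) Fw lw, where u = u]
  have "valid u \<Longrightarrow> valid (step u x)" using E_fst[OF E(1)] by (intro step_valid) auto
  then show ?case using W Cons.IH[OF E(2), of "step u x"] unfolding e by (auto simp: swt_step algebra_simps)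
qed (use low in auto)

text \<open>Let \<phi> be the indicator of a normal word m of weight n. Letting a word act on \<phi>
  and evaluating at the empty word is a functional that vanishes on the splitting ideal and in
  weight below n, and that detects the normal form m in weight n. It therefore computes
  \<open>cls f m\<close>.\<close>

lemma J_subset_class_ker: "J \<subseteq> (class_ker :: (('a \<times> 'a) list \<Rightarrow> 'k::field) set)"
proof
  fix f :: "('a \<times> 'a) list \<Rightarrow> 'k" assume f: "f \<in> J"
  have fT: "f \<in> tensor_alg E" using f unfolding assoc_graded_ker_def by auto
  have fs: "fsupp f" using fT by (rule tensor_fsupp)
  have "cls f m = 0" for m
  proof (cases "valid m")
    case False
    show ?thesis
    proof (rule ccontr)
      assume "cls f m \<noteq> 0"
      then obtain w where "f w \<noteq> 0" "NF w = m" using cls_nonzero by blast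
      then show False using tensor_supp[OF fT] NF_valid False by blast
    qed
  next
    case True
    define n where "n = swt m"
    define \<phi> :: "('a \<times> nat) list \<Rightarrow> 'k" where "\<phi> = (\<lambda>u. if u = m then 1 else 0)"
    have F: "valid_supp \<phi>" unfolding valid_supp_def \<phi>_def using True by auto
    have lo: "\<phi> u = 0" if "swt u < n" for u using that unfolding \<phi>_def n_def by auto
    define \<Phi> where "\<Phi> = (\<lambda>w. act w \<phi> [])"
    obtain g h where gh: "g \<in> I" "h \<in> low_fil G lt z0 n" "\<And>w. wpart G lt z0 n f w = g w + h w"
      using f unfolding assoc_graded_ker_def by blast
    have hT: "h \<in> tensor_alg E" "\<And>w. h w \<noteq> 0 \<Longrightarrow> weightE w < n" using gh(2) unfolding low_fil_def by auto
    have "lin g \<Phi> = 0" unfolding \<Phi>_def by (rule I_act[OF gh(1) F])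
    moreover have "lin h \<Phi> = lin h (\<lambda>_. 0)"
    proof (rule lin_cong)
      fix w assume "h w \<noteq> 0"
      then show "\<Phi> w = 0" unfolding \<Phi>_def using act_weight[OF F lo, where u = "[]" and w = w] tensor_supp[OF hT(1)] hT(2)[of w] by auto
    qed
    moreover have "lin (wpart G lt z0 n f) \<Phi> = lin g \<Phi> + lin h \<Phi>"
    proof -
      have "wpart G lt z0 n f = (\<lambda>w. g w + h w)" using gh(3) by blast
      then show ?thesis using tensor_fsupp[OF I_tensor[OF gh(1)]] tensor_fsupp[OF hT(1)] by (simp add: lin_add)
    qed
    moreover have "lin (wpart G lt z0 n f) \<Phi> = cls f m"
    proof -
      have "lin (wpart G lt z0 n f) \<Phi> = (\<Sum>w | f w \<noteq> 0. wpart G lt z0 n f w * \<Phi> w)"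
        by (rule lin_on) (use fs in \<open>auto simp: wpart_def split: if_splits\<close>)
      also have "\<dots> = cls f m" unfolding cls_def lin_def
      proof (rule sum.cong[OF refl])
        fix w assume "w \<in> {w. f w \<noteq> 0}"
        then have w: "set w \<subseteq> E" using tensor_supp[OF fT] by auto
        show "wpart G lt z0 n f w * \<Phi> w = f w * (if NF w = m then 1 else 0)"
        proof (cases "weightE w = n")
          case True
          have "\<Phi> w = \<phi> (NF w)" unfolding \<Phi>_def NF_def using act_weight[OF F lo w, where u = "[]"] True by simp
          then show ?thesis using True by (simp add: wpart_def \<phi>_def)
        next
          case False
          then have "NF w \<noteq> m" using swt_NF[of w] unfolding n_def by auto
          then show ?thesis using False by (simp add: wpart_def)
        qed
      qed
      finally show ?thesis .
    qed
    ultimately show ?thesis by simp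
  qed
  then show "f \<in> class_ker" using fT unfolding class_ker_def by blast
qed

lemma J_eq_class_ker: "J = (class_ker :: (('a \<times> 'a) list \<Rightarrow> 'k::field) set)"
  using J_subset_class_ker class_ker_subset_J by blast

section \<open>Quadraticity and uniformity\<close>

lemma foldl_epath_cov: "\<lbrakk>epath x es; x \<in> Sx b l; b \<in> G\<rbrakk> \<Longrightarrow> foldl step ((b, l) # m) (map fst es) = (b, l + length es) # m"
proof (induction es arbitrary: x l)
  case (Cons e es)
  obtain y where e: "e = (x, y)" using Cons.prems by (cases e) auto
  have "y \<in> Sx b (l + 1)" using Sx_trans[OF Cons.prems(2), of y 1] Cons.prems unfolding e by (simp add: E_Sx)
  then show ?case using Cons.IH[of y "Suc l"] Cons.prems unfolding e by simp
qed simp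

text \<open>\<open>NF\<close> is built by right multiplication, so compatibility with left
  multiplication is the associativity of the monoid. After u, a path either opens a new pair or is
  absorbed completely into the last pair; both outcomes depend only on its source and
  length.\<close>

lemma NF_left: assumes "set t \<subseteq> E" "set t' \<subseteq> E" "NF t = NF t'" "set u \<subseteq> E"
  shows "NF (u @ t) = NF (u @ t')"
proof -
  let ?R = "\<lambda>a b. \<forall>u. set u \<subseteq> E \<longrightarrow> NF (u @ a) = NF (u @ b)"
  have "?R t t'"
  proof (rule NF_congruence[OF _ _ _ _ assms(1-3)])
    fix a b u v assume "?R a b" "set u \<subseteq> E" "set v \<subseteq> E"
    then show "?R (u @ a @ v) (u @ b @ v)"
      by (simp add: NF_append[of "_ @ _" v] flip: append_assoc)
  next
    fix x es es' assume p: "x \<in> G" "epath x es" "epath x es'" "length es = length es'"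
    show "?R es es'"
    proof (intro allI impI)
      fix u assume "set u \<subseteq> E"
      then have val: "valid (NF u)" by (rule NF_valid)
      show "NF (u @ es) = NF (u @ es')"
      proof (cases "es = []")
        case False
        then have ne: "es \<noteq> []" "es' \<noteq> []" using p(4) by auto
        show ?thesis
        proof (cases "adm (NF u) x")
          case True
          then show ?thesis using foldl_epath[OF p(2) True ne(1) p(1)] foldl_epath[OF p(3) True ne(2) p(1)] p(4) by (simp add: NF_append)
        next
          case False
          obtain w l m where U: "NF u = (w, l) # m" "x \<in> Sx w l" "w \<in> G" using not_adm_cases[OF False val] by metis
          show ?thesis unfolding NF_append U(1) using foldl_epath_cov[OF p(2) U(2,3)] foldl_epath_cov[OF p(3) U(2,3)] p(4) by simp
        qed
      qed (use p(4) in simp)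
    qed
  qed auto
  then show ?thesis using assms(4) by blast
qed

lemma NF_ctx: assumes "set t \<subseteq> E" "set t' \<subseteq> E" "NF t = NF t'" "set u \<subseteq> E"
  shows "NF (u @ t @ v) = NF (u @ t' @ v)"
  using NF_left[OF assms] by (simp add: NF_append[of "_ @ _" v] flip: append_assoc)

text \<open>On the support of g the test function factors through \<open>NF\<close>, so it may be
  replaced by a function of normal forms.\<close>

lemma class_ker_lin_inv: assumes g: "g \<in> class_ker" and inv: "\<And>t t'. \<lbrakk>g t \<noteq> 0; g t' \<noteq> 0; NF t = NF t'\<rbrakk> \<Longrightarrow> \<Theta> t = \<Theta> t'"
  shows "lin g \<Theta> = (0 :: 'k::field)"
proof -
  define \<Psi> where "\<Psi> m = \<Theta> (SOME t. g t \<noteq> 0 \<and> NF t = m)" for m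
  have "lin g \<Theta> = lin g (\<lambda>w. \<Psi> (NF w))"
  proof (rule lin_cong)
    fix w assume w: "g w \<noteq> 0"
    have "g (SOME t. g t \<noteq> 0 \<and> NF t = NF w) \<noteq> 0 \<and> NF (SOME t. g t \<noteq> 0 \<and> NF t = NF w) = NF w"
      by (rule someI[of _ w]) (use w in simp)
    then show "\<Theta> w = \<Psi> (NF w)" unfolding \<Psi>_def using w by (intro inv) auto
  qed
  then show ?thesis using class_ker_lin_NF[OF g] by simp
qed

lemma class_ker_tensor: "f \<in> class_ker \<Longrightarrow> f \<in> tensor_alg E"
  unfolding class_ker_def by simp

lemma class_ker_ideal: assumes "Gs \<subseteq> (class_ker :: (('a \<times> 'a) list \<Rightarrow> 'k::field) set)" "f \<in> ideal_of E Gs" shows "f \<in> class_ker"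
proof -
  have T: "Gs \<subseteq> tensor_alg E" using assms(1) class_ker_tensor by blast
  have "cls f m = 0" for m unfolding cls_def
  proof (rule ideal_lin_zero[OF assms(2) T])
    fix g u v assume g: "g \<in> Gs" "set u \<subseteq> E" "set v \<subseteq> E"
    show "lin g (\<lambda>t. if NF (u @ t @ v) = m then 1 else 0 :: 'k) = 0"
    proof (rule class_ker_lin_inv)
      fix t t' assume t: "g t \<noteq> 0" "g t' \<noteq> 0" "NF t = NF t'"
      have "set t \<subseteq> E" "set t' \<subseteq> E" using t g T tensor_supp by blast+
      then show "(if NF (u @ t @ v) = m then 1 else 0 :: 'k) = (if NF (u @ t' @ v) = m then 1 else 0)"
        using NF_ctx[of t t' u v] t g by simp
    qed (use g assms in blast)
  qed
  then show ?thesis using ideal_tensor[OF assms(2) T] unfolding class_ker_def by simp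
qed

abbreviation sim :: "'a \<Rightarrow> ('a \<times> 'a) set" where "sim \<equiv> sim_rel G lt z0"

lemma sim_cov: "(a, b) \<in> (sim x)\<^sup>* \<Longrightarrow> cov x a \<Longrightarrow> cov x b"
  by (induction rule: rtrancl_induct) (auto simp: sim_rel_def)

lemma uniform_iff: "uniform G lt z0 \<longleftrightarrow> (\<forall>x\<in>V. \<forall>a b. cov x a \<longrightarrow> cov x b \<longrightarrow> (a, b) \<in> (sim x)\<^sup>*)"
proof -
  have "card ({a. cov x a} // (sim x)\<^sup>*) = 1 \<longleftrightarrow> (\<forall>a b. cov x a \<longrightarrow> cov x b \<longrightarrow> (a, b) \<in> (sim x)\<^sup>*)" if x: "x \<in> V" for x
  proof
    assume "card ({a. cov x a} // (sim x)\<^sup>*) = 1"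
    then obtain C where C: "{a. cov x a} // (sim x)\<^sup>* = {C}" by (auto simp: card_Suc_eq)
    have "(sim x)\<^sup>* `` {a} = C" if "cov x a" for a
      using C quotientI[of a "{a. cov x a}" "(sim x)\<^sup>*"] that by simp
    then show "\<forall>a b. cov x a \<longrightarrow> cov x b \<longrightarrow> (a, b) \<in> (sim x)\<^sup>*" by blast
  next
    assume a: "\<forall>a b. cov x a \<longrightarrow> cov x b \<longrightarrow> (a, b) \<in> (sim x)\<^sup>*"
    obtain y where y: "cov x y" using cov_exists x by blast
    have eq: "(sim x)\<^sup>* `` {b} = (sim x)\<^sup>* `` {y}" if "cov x b" for b
    proof -
      have "(b, y) \<in> (sim x)\<^sup>*" "(y, b) \<in> (sim x)\<^sup>*" using a that y by blast+
      then show ?thesis using rtrancl_trans[of b y "sim x"] rtrancl_trans[of y b "sim x"] by blast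
    qed
    have "{a. cov x a} // (sim x)\<^sup>* = {(sim x)\<^sup>* `` {y}}"
    proof (intro equalityI subsetI)
      fix C assume "C \<in> {a. cov x a} // (sim x)\<^sup>*"
      then obtain b where "cov x b" "C = (sim x)\<^sup>* `` {b}" by (auto elim: quotientE)
      then show "C \<in> {(sim x)\<^sup>* `` {y}}" using eq[of b] by simp
    next
      fix C assume "C \<in> {(sim x)\<^sup>* `` {y}}"
      then show "C \<in> {a. cov x a} // (sim x)\<^sup>*" using y by (auto intro: quotientI)
    qed
    then show "card ({a. cov x a} // (sim x)\<^sup>*) = 1" by simp
  qed
  then show ?thesis unfolding uniform_def by auto
qed

lemma mono_diff_class_ker: "\<lbrakk>set a \<subseteq> E; set b \<subseteq> E; NF a = NF b\<rbrakk> \<Longrightarrow> (\<lambda>w. mono a w - mono b w :: 'k::field) \<in> class_ker"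
  unfolding class_ker_def by (simp add: tensor_diff tensor_mono cls_diff cls_mono)

lemma epath_NF: "\<lbrakk>epath x es; epath x es'; length es = length es'; x \<in> G\<rbrakk> \<Longrightarrow> NF es = NF es'"
  using foldl_epath[of x es "[]"] foldl_epath[of x es' "[]"] unfolding NF_def by (cases "es = []"; cases "es' = []") auto

text \<open>It suffices to connect two paths from x of equal length by exchanging subpaths of length
  at most two. Along a chain of neighbours below x that share covered elements, the path is rerouted
  through one shared element after another.\<close>

lemma uniform_imp_quadratic:
  assumes "uniform G lt z0"
  shows "(class_ker :: (('a \<times> 'a) list \<Rightarrow> 'k::field) set) = ideal_of E {f \<in> class_ker. homog 1 f \<or> homog 2 f}" (is "_ = ideal_of E ?Gs")
proof
  show "ideal_of E ?Gs \<subseteq> class_ker" using class_ker_ideal[of ?Gs] by blast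
  have T: "?Gs \<subseteq> tensor_alg E" using class_ker_tensor by blast
  define R where "R a b \<longleftrightarrow> (\<lambda>w. mono a w - mono b w :: 'k) \<in> ideal_of E ?Gs" for a b
  have tr: "R a c" if "R a b" "R b c" for a b c
  proof -
    have "(\<lambda>w. (mono a w - mono b w) + (mono b w - mono c w) :: 'k) \<in> ideal_of E ?Gs"
      using that unfolding R_def by (rule ideal_of.add)
    then show ?thesis unfolding R_def by simp
  qed
  have sy: "R b a" if "R a b" for a b
    using ideal_of.smult[OF that[unfolded R_def], of "-1"] unfolding R_def by simp
  have rf: "R a a" for a unfolding R_def by (simp add: ideal_of.zero)
  have ct: "R (u @ a @ v) (u @ b @ v)" if "R a b" "set u \<subseteq> E" "set v \<subseteq> E" for a b u v
    using ideal_ctx[OF that(1)[unfolded R_def] T that(2,3)] unfolding R_def by (simp add: ctx_diff ctx_mono)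
  have ct2: "R (e # a) (e # b)" if "R a b" "e \<in> E" for a b e
    using ct[OF that(1), of "[e]" "[]"] that(2) by simp
  have small: "R es es'" if "x \<in> G" "epath x es" "epath x es'" "length es = length es'" "length es \<le> 2" for x es es'
  proof (cases "es = []")
    case True then show ?thesis using that rf by simp
  next
    case False
    then have "length es = 1 \<or> length es = 2" using that(5) by (cases es) (auto simp: le_Suc_eq)
    moreover have "homog (length es) (\<lambda>w. mono es w - mono es' w :: 'k)" unfolding homog_def
    proof (intro allI impI)
      fix w assume "mono es w - mono es' w \<noteq> (0 :: 'k)"
      then have "w = es \<or> w = es'" by (auto simp: mono_def split: if_splits)
      then show "length w = length es" using that(4) by auto
    qed
    ultimately have "homog 1 (\<lambda>w. mono es w - mono es' w :: 'k) \<or> homog 2 (\<lambda>w. mono es w - mono es' w :: 'k)" by auto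
    moreover have "(\<lambda>w. mono es w - mono es' w :: 'k) \<in> class_ker"
      using that epath_E by (intro mono_diff_class_ker epath_NF[of x]) auto
    ultimately have "(\<lambda>w. mono es w - mono es' w :: 'k) \<in> ?Gs" by blast
    then show ?thesis unfolding R_def by (rule ideal_gen) (intro fsupp_diff fsupp_mono)
  qed
  have pa: "R es es'" if "x \<in> G" "epath x es" "epath x es'" "length es = n" "length es' = n" for n x es es'
    using that
  proof (induction n arbitrary: x es es')
    case 0 then show ?case using rf by simp
  next
    case (Suc k)
    obtain y p where es: "es = (x, y) # p" using Suc.prems by (cases es) auto
    obtain z p' where es': "es' = (x, z) # p'" using Suc.prems by (cases es') auto
    have c: "cov x y" "cov x z" "epath y p" "epath z p'" "length p = k" "length p' = k"
      using Suc.prems unfolding es es' by (auto simp: E_iff)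
    show ?case
    proof (cases "k = 0")
      case True then show ?thesis using small[of x es es'] Suc.prems by simp
    next
      case False
      then obtain k' where k: "k = Suc k'" by (cases k) auto
      have xV: "x \<in> V" using c covD by blast
      have "(y, z) \<in> (sim x)\<^sup>*" using assms c xV unfolding uniform_iff by blast
      then have "\<forall>p'. epath z p' \<longrightarrow> length p' = k \<longrightarrow> R ((x, y) # p) ((x, z) # p')"
      proof (induction rule: rtrancl_induct)
        case base
        have "y \<in> G" using covD[OF c(1)] by blast
        then show ?case using Suc.IH[OF _ c(3) _ c(5)] c(1) by (auto intro!: ct2 simp: E_iff)
      next
        case (step z' z)
        obtain d where d: "cov x z'" "cov x z" "cov z' d" "cov z d" using step(2) unfolding sim_rel_def by blast
        have G: "z \<in> G" "d \<in> G" using covD[OF d(4)] by blast+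
        show ?case
        proof (intro allI impI)
          fix q assume q: "epath z q" "length q = k"
          have "k \<le> rho z" using pend_Sx[OF q(1) G(1)] q(2) by (simp add: Sx_def)
          then have "k' \<le> rho d" using covD[OF d(4)] k by simp
          then obtain r where r: "epath d r" "length r = k'" using epath_exists G by blast
          have rE: "set r \<subseteq> E" using r epath_E by blast
          have 1: "R ((x, y) # p) ((x, z') # (z', d) # r)" using step(3) r d k by (simp add: E_iff)
          \<comment> \<open>The exchange at the shared element d; afterwards the tail beginning at z
            is adjusted by the induction hypothesis for shorter paths.\<close>
          have "R [(x, z'), (z', d)] [(x, z), (z, d)]"
            by (rule small[of x]) (use d xV in \<open>auto simp: E_iff\<close>)
          from ct[OF this, of "[]" r] have 2: "R ((x, z') # (z', d) # r) ((x, z) # (z, d) # r)" using rE by simp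
          have 3: "R ((x, z) # (z, d) # r) ((x, z) # q)"
            using Suc.IH[of z "(z, d) # r" q] G q r d k by (intro ct2) (auto simp: E_iff)
          show "R ((x, y) # p) ((x, z) # q)" using tr[OF tr[OF 1 2] 3] .
        qed
      qed
      then show ?thesis using c unfolding es es' by blast
    qed
  qed
  have NFR: "R w w'" if "set w \<subseteq> E" "set w' \<subseteq> E" "NF w = NF w'" for w w'
    by (rule NF_congruence[of R]) (use tr sy ct pa that in blast)+
  show "class_ker \<subseteq> ideal_of E ?Gs"
  proof
    fix f :: "('a \<times> 'a) list \<Rightarrow> 'k" assume f: "f \<in> class_ker"
    then have fT: "f \<in> tensor_alg E" and fs: "fsupp f" unfolding class_ker_def by (auto dest: tensor_fsupp)
    have "(\<lambda>v. \<Sum>w | f w \<noteq> 0. f w * (mono w v - mono (canon (NF w)) v)) \<in> ideal_of E ?Gs"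
    proof (rule ideal_sum, rule ideal_of.smult)
      fix w assume "w \<in> {w. f w \<noteq> 0}"
      then have w: "set w \<subseteq> E" using tensor_supp[OF fT] by auto
      have "R w (canon (NF w))" by (rule NFR) (use w NF_valid in \<open>simp_all add: canon_E NF_canon\<close>)
      then show "(\<lambda>v. mono w v - mono (canon (NF w)) v) \<in> ideal_of E ?Gs" unfolding R_def .
    qed
    moreover have "(\<Sum>w | f w \<noteq> 0. f w * (mono w v - mono (canon (NF w)) v)) = f v" for v
    proof -
      have "(\<Sum>w | f w \<noteq> 0. f w * mono (canon (NF w)) v) = 0"
        using class_ker_lin_NF[OF f, of "\<lambda>m. mono (canon m) v"] unfolding lin_def .
      then show ?thesis using mono_expansion[OF fs, of v] by (simp add: right_diff_distrib sum_subtractf)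
    qed
    ultimately show "f \<in> ideal_of E ?Gs" by simp
  qed
qed

text \<open>An invariant of source sequences of length 3 under the quadratic relations. It records
  that the third vertex is seen from the class of y, and thereby separates two classes below
  x.\<close>

definition sepf :: "'a \<Rightarrow> 'a \<Rightarrow> 'a list \<Rightarrow> bool" where
  "sepf x y l \<longleftrightarrow> (\<exists>v c. l = [x, v, c] \<and> cov x v \<and> (\<exists>y'. (y, y') \<in> (sim x)\<^sup>* \<and> cov y' c))"

text \<open>Changing the second vertex leaves the third alone. If the third vertex changes, the
  second covers its old value, so it belongs to the class of y and is itself a witness for the new
  value.\<close>

lemma sepf_inv2:
  assumes "cov x y" "cov p q" "cov p q'" "sepf x y (us @ [p, q] @ vs)" shows "sepf x y (us @ [p, q'] @ vs)"
proof -
  obtain v c y' where l: "us @ [p, q] @ vs = [x, v, c]" "cov x v" "(y, y') \<in> (sim x)\<^sup>*" "cov y' c"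
    using assms(4) unfolding sepf_def by blast
  from l(1) consider "us = []" "p = x" "q = v" "vs = [c]" | "us = [x]" "p = v" "q = c" "vs = []"
    by (cases us) (auto simp: Cons_eq_append_conv append_eq_Cons_conv)
  then show ?thesis
  proof cases
    case 1 then show ?thesis using assms l unfolding sepf_def by auto
  next
    case 2
    have "cov x y'" using sim_cov l assms by blast
    then have "(y', v) \<in> sim x" using l(2,4) 2 assms(2) unfolding sim_rel_def by blast
    then have "(y, v) \<in> (sim x)\<^sup>*" using l(3) by simp
    then show ?thesis using 2 l assms(3) unfolding sepf_def by auto
  qed
qed

lemma NF_short: assumes "length t = length t'" "length t \<le> 2" "NF t = NF t'"
  shows "map fst t = map fst t' \<or> (\<exists>p q q'. map fst t = [p, q] \<and> map fst t' = [p, q'] \<and> q \<in> Sx p 1 \<and> q' \<in> Sx p 1)"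
proof -
  consider "t = []" "t' = []" | e e' where "t = [e]" "t' = [e']" | e f e' f' where "t = [e, f]" "t' = [e', f']"
    using assms(1,2) by (cases t; cases t'; cases "tl t"; cases "tl t'"; auto)
  then show ?thesis using assms(3) by cases (auto simp: NF_def split: if_splits)
qed

lemma quadratic_imp_uniform:
  assumes q: "(class_ker :: (('a \<times> 'a) list \<Rightarrow> 'k::field) set) = ideal_of E {f \<in> class_ker. homog 1 f \<or> homog 2 f}" (is "_ = ideal_of E ?Gs")
  shows "uniform G lt z0"
  unfolding uniform_iff
proof (intro ballI allI impI, rule ccontr)
  fix x y z assume x: "x \<in> V" "cov x y" "cov x z" "(y, z) \<notin> (sim x)\<^sup>*"
  have T: "?Gs \<subseteq> tensor_alg E" using class_ker_tensor by blast
  have r: "rho y = rho z" "y \<in> G" "z \<in> G" using covD[OF x(2)] covD[OF x(3)] by auto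
  \<comment> \<open>Words of length 3 from x require vertices different from z0 two levels below x.
    Distinct elements of equal rank are never z0; c and c' are distinct because a shared element
    would relate y and z.\<close>
  have rho0: "c = z0" if "c \<in> G" "rho c = 0" for c using that rho_pos[of c] by auto
  have "y \<noteq> z" using x by auto
  then have "y \<in> V" "z \<in> V" using r rho0[of y] rho0[of z] by auto
  then obtain c c' where c: "cov y c" "cov z c'" using cov_exists by blast
  have rc: "rho c = rho c'" "c \<in> G" "c' \<in> G" using covD[OF c(1)] covD[OF c(2)] r by auto
  have "c \<noteq> c'" using x c unfolding sim_rel_def by blast
  then have "c \<in> V" "c' \<in> V" using rc rho0[of c] rho0[of c'] by auto
  then obtain d d' where d: "cov c d" "cov c' d'" using cov_exists by blast
  let ?W = "[(x, y), (y, c), (c, d)]" let ?W' = "[(x, z), (z, c'), (c', d')]"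
  define f where "f = (\<lambda>w. mono ?W w - mono ?W' w :: 'k)"
  have "f \<in> class_ker" unfolding f_def
    by (rule mono_diff_class_ker) (use x c d in \<open>auto simp: E_iff intro!: epath_NF[of x]\<close>)
  then have fI: "f \<in> ideal_of E ?Gs" using q by blast
  define \<Phi> where "\<Phi> w = (if sepf x y (map fst w) then 1 else 0 :: 'k)" for w :: "('a \<times> 'a) list"
  have "lin f \<Phi> = 0"
  proof (rule ideal_lin_zero[OF fI T])
    fix g u v assume g: "g \<in> ?Gs"
    show "lin g (\<lambda>t. \<Phi> (u @ t @ v)) = 0"
    proof (rule class_ker_lin_inv)
      fix t t' assume t: "g t \<noteq> 0" "g t' \<noteq> 0" "NF t = NF t'"
      have len: "length t = length t'" "length t \<le> 2" using t g unfolding homog_def by auto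
      have tE: "set t \<subseteq> E" using t(1) g class_ker_tensor tensor_supp by blast
      from NF_short[OF len t(3)] show "\<Phi> (u @ t @ v) = \<Phi> (u @ t' @ v)"
      proof
        assume "\<exists>p q q'. map fst t = [p, q] \<and> map fst t' = [p, q'] \<and> q \<in> Sx p 1 \<and> q' \<in> Sx p 1"
        then obtain p q q' where p: "map fst t = [p, q]" "map fst t' = [p, q']" "q \<in> Sx p 1" "q' \<in> Sx p 1" by (elim exE conjE)
        obtain e1 e2 where "t = [e1, e2]" using p(1) by (auto simp: map_eq_Cons_conv)
        then have "p \<in> G" using p(1) tE E_fst[of e1] by auto
        then have "cov p q" "cov p q'" using p(3,4) Sx_1 by auto
        then have "sepf x y (map fst u @ [p, q] @ map fst v) = sepf x y (map fst u @ [p, q'] @ map fst v)"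
          using sepf_inv2 x(2) by blast
        then show ?thesis unfolding \<Phi>_def using p by simp
      qed (simp add: \<Phi>_def)
    qed (use g in blast)
  qed
  moreover have "lin f \<Phi> = \<Phi> ?W - \<Phi> ?W'" unfolding f_def by (simp add: lin_diff)
  moreover have "\<Phi> ?W = 1" unfolding \<Phi>_def sepf_def using x c by auto
  moreover have "\<Phi> ?W' = 0"
  proof -
    have "\<not> ((y, y') \<in> (sim x)\<^sup>* \<and> cov y' c')" for y'
    proof
      assume a: "(y, y') \<in> (sim x)\<^sup>* \<and> cov y' c'"
      then have "(y', z) \<in> sim x" using sim_cov[of y y' x] x c unfolding sim_rel_def by blast
      then show False using a x(4) by (meson rtrancl.rtrancl_into_rtrancl)
    qed
    then show ?thesis unfolding \<Phi>_def sepf_def by auto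
  qed
  ultimately show False by simp
qed

theorem quadratic_iff: "quadratic_pres E (J :: (('a \<times> 'a) list \<Rightarrow> 'k::field) set) \<longleftrightarrow> uniform G lt z0"
  unfolding quadratic_pres_def J_eq_class_ker using uniform_imp_quadratic quadratic_imp_uniform by blast

section \<open>Homology of truncated intervals\<close>

text \<open>The boundary in coordinates: the value at \<tau> collects the coefficients of all lists
  with one element inserted into \<tau>, with sign (-1)^i at position i. Chains are functions on all
  lists, restricted by \<open>supp\<close>; the value at the empty list is the augmentation.\<close>

primrec bd :: "'a list \<Rightarrow> ('a list \<Rightarrow> 'k::field) \<Rightarrow> 'k" where
  "bd [] c = (\<Sum>v\<in>G. c [v])"
| "bd (y # ys) c = (\<Sum>v\<in>G. c (v # y # ys)) - bd ys (\<lambda>\<sigma>. c (y # \<sigma>))"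

lemma bd_zero [simp]: "bd \<tau> (\<lambda>_. 0) = 0"
  by (induction \<tau>) auto

lemma bd_lin: "bd \<tau> (\<lambda>\<sigma>. \<alpha> * c \<sigma> + \<beta> * d \<sigma>) = \<alpha> * bd \<tau> c + \<beta> * bd \<tau> d"
proof (induction \<tau> arbitrary: c d)
  case Nil then show ?case by (simp add: sum.distrib sum_distrib_left)
next
  case (Cons y ys)
  have "bd ys (\<lambda>\<sigma>. \<alpha> * c (y # \<sigma>) + \<beta> * d (y # \<sigma>)) = \<alpha> * bd ys (\<lambda>\<sigma>. c (y # \<sigma>)) + \<beta> * bd ys (\<lambda>\<sigma>. d (y # \<sigma>))"
    by (rule Cons.IH)
  then show ?case by (simp add: sum.distrib sum_distrib_left algebra_simps)
qed

lemma bd_add: "bd \<tau> (\<lambda>\<sigma>. c \<sigma> + d \<sigma>) = bd \<tau> c + bd \<tau> d"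
  using bd_lin[of \<tau> 1 c 1 d] by simp

lemma bd_diff: "bd \<tau> (\<lambda>\<sigma>. c \<sigma> - d \<sigma>) = bd \<tau> c - bd \<tau> d"
  using bd_lin[of \<tau> 1 c "-1" d] by simp

lemma bd_smult: "bd \<tau> (\<lambda>\<sigma>. \<alpha> * c \<sigma>) = \<alpha> * bd \<tau> c"
  using bd_lin[of \<tau> \<alpha> c 0 c] by simp

lemma bd_sum: "bd \<tau> (\<lambda>\<sigma>. \<Sum>i\<in>A. c i \<sigma>) = (\<Sum>i\<in>A. bd \<tau> (c i))"
  by (induction A rule: infinite_finite_induct) (simp_all add: bd_add)

lemma bd_bd: "bd \<tau> (\<lambda>\<sigma>. bd \<sigma> c) = 0"
proof (induction \<tau> arbitrary: c)
  case Nil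
  have "(\<Sum>v\<in>G. \<Sum>w\<in>G. c [w, v]) = (\<Sum>v\<in>G. \<Sum>w\<in>G. c [v, w])" by (rule sum.swap)
  then show ?case by (simp add: sum_subtractf)
next
  case (Cons y ys)
  have 1: "bd ys (\<lambda>\<sigma>. bd (y # \<sigma>) c) = (\<Sum>v\<in>G. bd ys (\<lambda>\<sigma>. c (v # y # \<sigma>)))"
    using Cons.IH[of "\<lambda>\<sigma>. c (y # \<sigma>)"] by (simp add: bd_diff bd_sum)
  have 2: "(\<Sum>v\<in>G. \<Sum>w\<in>G. c (w # v # y # ys)) = (\<Sum>v\<in>G. \<Sum>w\<in>G. c (v # w # y # ys))" by (rule sum.swap)
  have "(\<Sum>v\<in>G. bd (v # y # ys) c) = (\<Sum>v\<in>G. bd ys (\<lambda>\<sigma>. c (v # y # \<sigma>)))"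
    using 2 by (simp add: sum_subtractf)
  then show ?case using 1 by simp
qed

lemma bd_snoc: "bd (\<tau> @ [a]) c = bd \<tau> (\<lambda>\<sigma>. c (\<sigma> @ [a])) + (-1) ^ Suc (length \<tau>) * (\<Sum>v\<in>G. c (\<tau> @ [a, v]))"
proof (induction \<tau> arbitrary: c)
  case (Cons y \<tau>)
  show ?case using Cons.IH[of "\<lambda>\<sigma>. c (y # \<sigma>)"] by (simp add: algebra_simps)
qed simp

lemma bd_nonzero: "bd \<tau> c \<noteq> 0 \<Longrightarrow> \<exists>us v vs. \<tau> = us @ vs \<and> c (us @ v # vs) \<noteq> 0"
proof (induction \<tau> arbitrary: c)
  case Nil
  then obtain v where "c [v] \<noteq> 0" by (auto elim: sum.not_neutral_contains_not_neutral)
  then show ?case by (intro exI[of _ "[]"]) auto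
next
  case (Cons y ys)
  show ?case
  proof (cases "bd ys (\<lambda>\<sigma>. c (y # \<sigma>)) = 0")
    case True
    then have "(\<Sum>v\<in>G. c (v # y # ys)) \<noteq> 0" using Cons.prems by simp
    then obtain v where "c (v # y # ys) \<noteq> 0" by (rule sum.not_neutral_contains_not_neutral)
    then show ?thesis by (intro exI[of _ "[]"] exI[of _ v] exI[of _ "y # ys"]) simp
  next
    case False
    from Cons.IH[OF this] obtain us v vs where "ys = us @ vs" "c (y # us @ v # vs) \<noteq> 0" by blast
    then show ?thesis by (intro exI[of _ "y # us"] exI[of _ v] exI[of _ vs]) simp
  qed
qed

definition dch :: "'a set \<Rightarrow> 'a list \<Rightarrow> bool" where
  "dch P \<sigma> \<longleftrightarrow> sorted_wrt (\<lambda>u v. lt v u) \<sigma> \<and> set \<sigma> \<subseteq> P"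

lemma dch_Nil [simp]: "dch P []"
  and dch_Cons: "dch P (x # \<sigma>) \<longleftrightarrow> x \<in> P \<and> (\<forall>y\<in>set \<sigma>. lt y x) \<and> dch P \<sigma>"
  and dch_snoc: "dch P (\<sigma> @ [x]) \<longleftrightarrow> x \<in> P \<and> (\<forall>y\<in>set \<sigma>. lt x y) \<and> dch P \<sigma>"
  unfolding dch_def by (auto simp: sorted_wrt_append)

lemma dch_mono: "dch P \<sigma> \<Longrightarrow> P \<subseteq> Q \<Longrightarrow> dch Q \<sigma>"
  unfolding dch_def by auto

definition supp :: "'a set \<Rightarrow> nat \<Rightarrow> ('a list \<Rightarrow> 'k::field) \<Rightarrow> bool" where
  "supp P l c \<longleftrightarrow> (\<forall>\<sigma>. c \<sigma> \<noteq> 0 \<longrightarrow> dch P \<sigma> \<and> length \<sigma> = l)"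

lemma suppD: "supp P l c \<Longrightarrow> c \<sigma> \<noteq> 0 \<Longrightarrow> dch P \<sigma> \<and> length \<sigma> = l"
  unfolding supp_def by blast

lemma supp_lin: "supp P l c \<Longrightarrow> supp P l d \<Longrightarrow> supp P l (\<lambda>\<sigma>. \<alpha> * c \<sigma> + \<beta> * d \<sigma>)"
  unfolding supp_def by (metis add_0 mult_zero_right)

lemma supp_add: "supp P l c \<Longrightarrow> supp P l d \<Longrightarrow> supp P l (\<lambda>\<sigma>. c \<sigma> + d \<sigma>)"
  using supp_lin[of P l c d 1 1] by simp

lemma supp_diff: "supp P l c \<Longrightarrow> supp P l d \<Longrightarrow> supp P l (\<lambda>\<sigma>. c \<sigma> - d \<sigma>)"
  using supp_lin[of P l c d 1 "-1"] by simp

lemma supp_mono: "supp P l c \<Longrightarrow> P \<subseteq> Q \<Longrightarrow> supp Q l c"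
  unfolding supp_def using dch_mono by blast

lemma supp_bd: "supp P (Suc l) c \<Longrightarrow> supp P l (\<lambda>\<tau>. bd \<tau> c)"
  unfolding supp_def
proof (intro allI impI)
  fix \<tau> assume c: "\<forall>\<sigma>. c \<sigma> \<noteq> 0 \<longrightarrow> dch P \<sigma> \<and> length \<sigma> = Suc l" and "bd \<tau> c \<noteq> 0"
  then obtain us v vs where "\<tau> = us @ vs" "c (us @ v # vs) \<noteq> 0" using bd_nonzero by blast
  then show "dch P \<tau> \<and> length \<tau> = l" using c unfolding dch_def by (fastforce simp: sorted_wrt_append)
qed

text \<open>Vanishing of reduced homology in dimension l - 1. Counting elements instead of dimension
  makes the augmentation the ordinary case l = 0.\<close>

definition acyclic_at :: "'k::field itself \<Rightarrow> 'a set \<Rightarrow> nat \<Rightarrow> bool" where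
  "acyclic_at K P l \<longleftrightarrow> (\<forall>c :: 'a list \<Rightarrow> 'k. supp P l c \<longrightarrow> (\<forall>\<tau>. bd \<tau> c = 0) \<longrightarrow>
      (\<exists>\<eta>. supp P (Suc l) \<eta> \<and> (\<forall>\<tau>. bd \<tau> \<eta> = c \<tau>)))"

lemma vanHE: fixes c :: "'a list \<Rightarrow> 'k::field"
  assumes "acyclic_at TYPE('k) P l" "supp P l c" "\<And>\<tau>. bd \<tau> c = 0"
  shows "\<exists>\<eta>. supp P (Suc l) \<eta> \<and> (\<forall>\<tau>. bd \<tau> \<eta> = c \<tau>)"
  using assms unfolding acyclic_at_def by blast

definition trunc :: "'a \<Rightarrow> nat \<Rightarrow> 'a set" where "trunc b r = {z\<in>G. lt z b \<and> r < rho z}"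

text \<open>A chain in \<open>trunc b r\<close> has at most \<open>rho b - r - 1\<close> elements,
  so the bound on l means below the top dimension. The same count with \<open>rho a\<close> for r
  applies to \<open>interval_acyclic\<close>.\<close>

definition trunc_acyclic :: "'k::field itself \<Rightarrow> 'a \<Rightarrow> nat \<Rightarrow> bool" where
  "trunc_acyclic K b r \<longleftrightarrow> (\<forall>l. l + r + 1 < rho b \<longrightarrow> acyclic_at K (trunc b r) l)"

definition interval_acyclic :: "'k::field itself \<Rightarrow> 'a \<Rightarrow> 'a \<Rightarrow> bool" where
  "interval_acyclic K a b \<longleftrightarrow> (\<forall>l. l + rho a + 1 < rho b \<longrightarrow> acyclic_at K (open_int G lt a b) l)"

lemma open_z0: "open_int G lt z0 b = trunc b 0"
proof -
  have "lt z0 x \<longleftrightarrow> 0 < rho x" if "x \<in> G" for x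
    using z0_least[of x] rho_pos[of x] that by (cases "x = z0") auto
  then show ?thesis unfolding open_int_def trunc_def by auto
qed

text \<open>A cycle c above a bounds in the truncation above the rank of a, and it also bounds its
  cone with vertex a. The two fillings together form a cycle of the truncation one level lower; the
  part of a filling of that cycle that ends in a fills c.\<close>

lemma trunc_acyclic_interval_acyclic:
  assumes trunc_acyclic: "\<And>r. trunc_acyclic TYPE('k::field) b r" and ab: "a \<in> G" "b \<in> G" "lt a b"
  shows "interval_acyclic TYPE('k) a b"
proof (cases "a = z0")
  case True
  then show ?thesis using trunc_acyclic[of 0] unfolding interval_acyclic_def trunc_acyclic_def open_z0 True by simp
next
  case False
  have ra: "0 < rho a" using rho_pos ab False by blast
  define s where "s = rho a - 1"
  have s: "rho a = Suc s" using ra unfolding s_def by simp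
  have sub: "open_int G lt a b \<subseteq> trunc b (rho a)" "trunc b (rho a) \<subseteq> trunc b s"
    unfolding open_int_def trunc_def s using rho_less[OF _ ab(1)] s by auto
  show ?thesis unfolding interval_acyclic_def acyclic_at_def
  proof (intro allI impI)
    fix l and c :: "'a list \<Rightarrow> 'k"
    assume l: "l + rho a + 1 < rho b" and c: "supp (open_int G lt a b) l c" "\<forall>\<tau>. bd \<tau> c = 0"
    obtain \<eta> where \<eta>: "supp (trunc b (rho a)) (Suc l) \<eta>" "\<And>\<tau>. bd \<tau> \<eta> = c \<tau>"
      using vanHE[of "trunc b (rho a)" l c] trunc_acyclic[of "rho a"] l c supp_mono[OF c(1) sub(1)] unfolding trunc_acyclic_def
      by blast
    \<comment> \<open>The cone over c with a appended at the bottom; its boundary is (-1)^l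
      c.\<close>
    define \<zeta>0 where "\<zeta>0 \<sigma> = (if \<sigma> \<noteq> [] \<and> last \<sigma> = a then c (butlast \<sigma>) else 0)" for \<sigma>
    have \<zeta>0: "\<zeta>0 (\<sigma> @ [v]) = (if v = a then c \<sigma> else 0)" for \<sigma> v unfolding \<zeta>0_def by simp
    have \<zeta>0': "\<zeta>0 (\<sigma> @ [w, v]) = (if v = a then c (\<sigma> @ [w]) else 0)" for \<sigma> v w using \<zeta>0[of "\<sigma> @ [w]" v] by simp
    have bz: "bd \<tau> \<zeta>0 = (-1) ^ length \<tau> * c \<tau>" for \<tau>
    proof (cases \<tau> rule: rev_cases)
      case Nil then show ?thesis using \<zeta>0[of "[]"] ab(1) by simp
    next
      case (snoc \<tau>' v)
      have "bd \<tau>' (\<lambda>\<sigma>. \<zeta>0 (\<sigma> @ [v])) = 0" unfolding \<zeta>0 using c(2) by (cases "v = a") auto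
      then show ?thesis unfolding snoc bd_snoc \<zeta>0' using ab(1) by simp
    qed
    define \<zeta> where "\<zeta> = (\<lambda>\<sigma>. \<zeta>0 \<sigma> - (-1) ^ l * \<eta> \<sigma>)"
    have "bd \<tau> \<zeta> = 0" for \<tau>
    proof -
      have "bd \<tau> \<zeta> = (-1) ^ length \<tau> * c \<tau> - (-1) ^ l * c \<tau>"
        unfolding \<zeta>_def bd_diff bd_smult bz \<eta>(2) ..
      then show ?thesis using suppD[OF c(1), of \<tau>] by (cases "c \<tau> = 0") auto
    qed
    moreover have "supp (trunc b s) (Suc l) \<zeta>"
    proof -
      have "supp (trunc b s) (Suc l) \<zeta>0" unfolding supp_def
      proof (intro allI impI)
        fix \<sigma> assume nz: "\<zeta>0 \<sigma> \<noteq> 0"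
        then obtain \<sigma>' where \<sigma>: "\<sigma> = \<sigma>' @ [a]" by (cases \<sigma> rule: rev_cases) (auto simp: \<zeta>0 \<zeta>0_def split: if_splits)
        then have "c \<sigma>' \<noteq> 0" using nz \<zeta>0 by simp
        then have d: "dch (open_int G lt a b) \<sigma>'" "length \<sigma>' = l" using suppD[OF c(1)] by blast+
        have "dch (trunc b s) \<sigma>'" using d(1) dch_mono sub by blast
        then show "dch (trunc b s) \<sigma> \<and> length \<sigma> = Suc l" unfolding \<sigma> dch_snoc using d ab s
          by (auto simp: dch_def open_int_def trunc_def)
      qed
      moreover have "supp (trunc b s) (Suc l) \<eta>" using supp_mono \<eta>(1) sub(2) by blast
      ultimately show ?thesis unfolding \<zeta>_def using supp_lin[of "trunc b s" "Suc l" \<zeta>0 \<eta> 1 "- ((-1) ^ l)"] by simp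
    qed
    moreover have "acyclic_at TYPE('k) (trunc b s) (Suc l)" using trunc_acyclic[of s] l s unfolding trunc_acyclic_def by simp
    ultimately obtain \<theta> where \<theta>: "supp (trunc b s) (Suc (Suc l)) \<theta>" "\<And>\<tau>. bd \<tau> \<theta> = \<zeta> \<tau>"
      using vanHE[of "trunc b s" "Suc l" \<zeta>] by blast
    show "\<exists>\<eta>. supp (open_int G lt a b) (Suc l) \<eta> \<and> (\<forall>\<tau>. bd \<tau> \<eta> = c \<tau>)"
    proof (intro exI conjI allI)
      show "supp (open_int G lt a b) (Suc l) (\<lambda>\<sigma>. \<theta> (\<sigma> @ [a]))" unfolding supp_def
      proof (intro allI impI)
        fix \<sigma> assume "\<theta> (\<sigma> @ [a]) \<noteq> 0"
        then have "dch (trunc b s) (\<sigma> @ [a])" "length (\<sigma> @ [a]) = Suc (Suc l)" using suppD[OF \<theta>(1)] by blast+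
        then show "dch (open_int G lt a b) \<sigma> \<and> length \<sigma> = Suc l" unfolding dch_snoc
          by (auto simp: dch_def open_int_def trunc_def)
      qed
      fix \<tau>
      \<comment> \<open>The rank of a is minimal in this truncation, so no chain continues below a
        and only the first summand of \<open>bd_snoc\<close> survives.\<close>
      have "\<theta> (\<tau> @ [a, v]) = 0" for v
      proof (rule ccontr)
        assume "\<theta> (\<tau> @ [a, v]) \<noteq> 0"
        then have "dch (trunc b s) ((\<tau> @ [a]) @ [v])" using suppD[OF \<theta>(1)] by fastforce
        then have "v \<in> trunc b s" "lt v a" unfolding dch_snoc by auto
        then show False using rho_less[OF ab(1), of v] s unfolding trunc_def by auto
      qed
      then have "bd \<tau> (\<lambda>\<sigma>. \<theta> (\<sigma> @ [a])) = \<zeta> (\<tau> @ [a])" using bd_snoc[of \<tau> a \<theta>] \<theta>(2) by simp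
      moreover have "\<eta> (\<tau> @ [a]) = 0"
      proof (rule ccontr)
        assume "\<eta> (\<tau> @ [a]) \<noteq> 0"
        then have "dch (trunc b (rho a)) (\<tau> @ [a])" using suppD[OF \<eta>(1)] by blast
        then show False unfolding dch_snoc trunc_def by auto
      qed
      ultimately show "bd \<tau> (\<lambda>\<sigma>. \<theta> (\<sigma> @ [a])) = c \<tau>" unfolding \<zeta>_def by (simp add: \<zeta>0)
    qed
  qed
qed

text \<open>A cycle is filled in the truncation that still contains the level r + 1. For a in that
  level, the part of the filling ending in a is a cycle in (a, b); subtracting the boundaries of
  cones over fillings of these parts clears the level.\<close>

lemma interval_acyclic_trunc_acyclic:
  assumes interval_acyclic: "\<And>a. \<lbrakk>a \<in> G; lt a b\<rbrakk> \<Longrightarrow> interval_acyclic TYPE('k::field) a b" and b: "b \<in> G"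
  shows "trunc_acyclic TYPE('k) b r"
proof (induction r)
  case 0
  show ?case
  proof (cases "b = z0")
    case True then show ?thesis unfolding trunc_acyclic_def by simp
  next
    case False
    then show ?thesis using interval_acyclic[OF z0_in z0_least[OF b False]] unfolding interval_acyclic_def trunc_acyclic_def open_z0 by simp
  qed
next
  case (Suc r)
  let ?A = "{a\<in>G. lt a b \<and> rho a = Suc r}"
  have sub: "trunc b (Suc r) \<subseteq> trunc b r" unfolding trunc_def by auto
  show ?case unfolding trunc_acyclic_def acyclic_at_def
  proof (intro allI impI)
    fix l and c :: "'a list \<Rightarrow> 'k"
    assume l: "l + Suc r + 1 < rho b" and c: "supp (trunc b (Suc r)) l c" "\<forall>\<tau>. bd \<tau> c = 0"
    have "acyclic_at TYPE('k) (trunc b r) l" using Suc l unfolding trunc_acyclic_def by simp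
    then obtain \<eta> where \<eta>: "supp (trunc b r) (Suc l) \<eta>" "\<And>\<tau>. bd \<tau> \<eta> = c \<tau>"
      using vanHE[of "trunc b r" l c] c supp_mono[OF c(1) sub] by blast
    have "\<exists>\<theta>. supp (open_int G lt a b) (Suc l) \<theta> \<and> (\<forall>\<tau>. bd \<tau> \<theta> = \<eta> (\<tau> @ [a]))" if a: "a \<in> ?A" for a
    proof (rule vanHE)
      show "acyclic_at TYPE('k) (open_int G lt a b) l" using interval_acyclic[of a] a l unfolding interval_acyclic_def by simp
      show "supp (open_int G lt a b) l (\<lambda>\<sigma>. \<eta> (\<sigma> @ [a]))" unfolding supp_def
      proof (intro allI impI)
        fix \<sigma> assume "\<eta> (\<sigma> @ [a]) \<noteq> 0"
        then have "dch (trunc b r) (\<sigma> @ [a])" "length (\<sigma> @ [a]) = Suc l" using suppD[OF \<eta>(1)] by blast+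
        then show "dch (open_int G lt a b) \<sigma> \<and> length \<sigma> = l" unfolding dch_snoc
          by (auto simp: dch_def open_int_def trunc_def)
      qed
      fix \<tau>
      have "\<eta> (\<tau> @ [a, v]) = 0" for v
      proof (rule ccontr)
        assume "\<eta> (\<tau> @ [a, v]) \<noteq> 0"
        then have "dch (trunc b r) ((\<tau> @ [a]) @ [v])" using suppD[OF \<eta>(1)] by fastforce
        then have "v \<in> trunc b r" "lt v a" unfolding dch_snoc by auto
        then show False using rho_less[of a v] a unfolding trunc_def by auto
      qed
      then have "bd \<tau> (\<lambda>\<sigma>. \<eta> (\<sigma> @ [a])) = c (\<tau> @ [a])" using bd_snoc[of \<tau> a \<eta>] \<eta>(2) by simp
      moreover have "c (\<tau> @ [a]) = 0"
      proof (rule ccontr)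
        assume "c (\<tau> @ [a]) \<noteq> 0"
        then have "dch (trunc b (Suc r)) (\<tau> @ [a])" using suppD[OF c(1)] by blast
        then show False unfolding dch_snoc trunc_def using a by auto
      qed
      ultimately show "bd \<tau> (\<lambda>\<sigma>. \<eta> (\<sigma> @ [a])) = 0" by simp
    qed
    then have "\<forall>a\<in>?A. \<exists>\<theta>. supp (open_int G lt a b) (Suc l) \<theta> \<and> (\<forall>\<tau>. bd \<tau> \<theta> = \<eta> (\<tau> @ [a]))" by blast
    then obtain \<Theta> where \<Theta>: "\<forall>a\<in>?A. supp (open_int G lt a b) (Suc l) (\<Theta> a) \<and> (\<forall>\<tau>. bd \<tau> (\<Theta> a) = \<eta> (\<tau> @ [a]))"
      by (rule bchoice[THEN exE])
    define \<theta> where "\<theta> \<sigma> = (if \<sigma> \<noteq> [] \<and> last \<sigma> \<in> ?A then \<Theta> (last \<sigma>) (butlast \<sigma>) else 0)" for \<sigma>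
    have \<theta>: "\<theta> (\<sigma> @ [v]) = (if v \<in> ?A then \<Theta> v \<sigma> else 0)" for \<sigma> v unfolding \<theta>_def by simp
    have \<theta>': "\<theta> (\<sigma> @ [w, v]) = (if v \<in> ?A then \<Theta> v (\<sigma> @ [w]) else 0)" for \<sigma> v w using \<theta>[of "\<sigma> @ [w]" v] by simp
    have s\<theta>: "supp (trunc b r) (Suc (Suc l)) \<theta>" unfolding supp_def
    proof (intro allI impI)
      fix \<sigma> assume nz: "\<theta> \<sigma> \<noteq> 0"
      then obtain \<sigma>' v where \<sigma>: "\<sigma> = \<sigma>' @ [v]" "v \<in> ?A" by (cases \<sigma> rule: rev_cases) (auto simp: \<theta> \<theta>_def split: if_splits)
      then have "\<Theta> v \<sigma>' \<noteq> 0" using nz \<theta> by simp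
      then have d: "dch (open_int G lt v b) \<sigma>'" "length \<sigma>' = Suc l" using suppD \<Theta> \<sigma>(2) by blast+
      have "open_int G lt v b \<subseteq> trunc b r" unfolding open_int_def trunc_def using \<sigma>(2) rho_less by fastforce
      then have "dch (trunc b r) \<sigma>'" using d(1) dch_mono by blast
      then show "dch (trunc b r) \<sigma> \<and> length \<sigma> = Suc (Suc l)" unfolding \<sigma>(1) dch_snoc using d \<sigma>(2)
        by (auto simp: dch_def open_int_def trunc_def)
    qed
    define \<eta>' where "\<eta>' = (\<lambda>\<sigma>. \<eta> \<sigma> - bd \<sigma> \<theta>)"
    have z: "\<eta>' (\<tau> @ [a]) = 0" if a: "a \<in> ?A" for \<tau> a
    proof -
      have "\<theta> (\<tau> @ [a, v]) = 0" for v
      proof (rule ccontr)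
        assume "\<theta> (\<tau> @ [a, v]) \<noteq> 0"
        then have v: "v \<in> ?A" "\<Theta> v (\<tau> @ [a]) \<noteq> 0" unfolding \<theta>' by (auto split: if_splits)
        then have "dch (open_int G lt v b) (\<tau> @ [a])" using suppD \<Theta> by blast
        then have "lt v a" unfolding dch_snoc open_int_def by auto
        then show False using rho_less[of a v] a v by auto
      qed
      then have "bd (\<tau> @ [a]) \<theta> = bd \<tau> (\<lambda>\<sigma>. \<theta> (\<sigma> @ [a]))" using bd_snoc[of \<tau> a \<theta>] by simp
      also have "\<dots> = bd \<tau> (\<Theta> a)" unfolding \<theta> using a by simp
      also have "\<dots> = \<eta> (\<tau> @ [a])" using \<Theta> a by blast
      finally show ?thesis unfolding \<eta>'_def by simp
    qed
    have s\<eta>: "supp (trunc b r) (Suc l) \<eta>'" unfolding \<eta>'_def using \<eta>(1) supp_bd[OF s\<theta>] by (rule supp_diff)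
    show "\<exists>\<eta>. supp (trunc b (Suc r)) (Suc l) \<eta> \<and> (\<forall>\<tau>. bd \<tau> \<eta> = c \<tau>)"
    proof (intro exI conjI allI)
      show "bd \<tau> \<eta>' = c \<tau>" for \<tau> unfolding \<eta>'_def bd_diff bd_bd \<eta>(2) by simp
      show "supp (trunc b (Suc r)) (Suc l) \<eta>'" unfolding supp_def
      proof (intro allI impI)
        fix \<sigma> assume nz: "\<eta>' \<sigma> \<noteq> 0"
        then have d: "dch (trunc b r) \<sigma>" "length \<sigma> = Suc l" using suppD[OF s\<eta>] by blast+
        then obtain \<sigma>' v where \<sigma>: "\<sigma> = \<sigma>' @ [v]" by (cases \<sigma> rule: rev_cases) auto
        have v: "v \<in> trunc b r" "v \<notin> ?A" using d nz z unfolding \<sigma> dch_snoc by auto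
        then have rv: "Suc r < rho v" "v \<in> G" unfolding trunc_def by auto
        have "Suc r < rho y" if "y \<in> set \<sigma>'" for y
        proof -
          have "lt v y" "y \<in> G" using d(1) that unfolding \<sigma> dch_snoc by (auto simp: dch_def trunc_def)
          then show ?thesis using rho_less[of y v] rv by auto
        qed
        then have "set \<sigma> \<subseteq> trunc b (Suc r)" using d(1) rv unfolding \<sigma> dch_def trunc_def by auto
        then show "dch (trunc b (Suc r)) \<sigma> \<and> length \<sigma> = Suc l" using d unfolding dch_def by blast
      qed
    qed
  qed
qed

section \<open>Saturated chains and the Koszul complex\<close>

fun sat :: "'a list \<Rightarrow> bool" where
  "sat [] = True"
| "sat [x] = (x \<in> V)"
| "sat (x # y # \<sigma>) = (cov x y \<and> sat (y # \<sigma>))"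

text \<open>The degree p part of the Koszul dual coalgebra.\<close>
definition koszul_cycle :: "nat \<Rightarrow> ('a list \<Rightarrow> 'k::field) \<Rightarrow> bool" where
  "koszul_cycle p c \<longleftrightarrow> (\<forall>\<sigma>. c \<sigma> \<noteq> 0 \<longrightarrow> length \<sigma> = p \<and> sat \<sigma>) \<and> (\<forall>x ys. bd ys (\<lambda>\<sigma>. c (x # \<sigma>)) = 0)"

text \<open>Insertions after the head cancel because slices are cycles. So the simplicial boundary
  on C is the operation of forgetting the head, which is the differential of the Koszul
  complex.\<close>

lemma koszul_cycle_bd: "koszul_cycle p v \<Longrightarrow> bd \<tau> v = (\<Sum>x\<in>G. v (x # \<tau>))"
  unfolding koszul_cycle_def by (cases \<tau>) auto

lemma koszul_cycle_zero: "koszul_cycle p (\<lambda>_. 0)"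
  unfolding koszul_cycle_def by simp

definition headsin :: "'a set \<Rightarrow> ('a list \<Rightarrow> 'k::field) \<Rightarrow> bool" where
  "headsin S c \<longleftrightarrow> (\<forall>x \<sigma>. c (x # \<sigma>) \<noteq> 0 \<longrightarrow> x \<in> S)"

text \<open>Exactness of the pieces into which the Koszul complex splits: a normal word with last
  pair (b, k) carries the part of C with heads at depth k below b.\<close>

definition koszul_exact :: "'k::field itself \<Rightarrow> bool" where
  "koszul_exact K \<longleftrightarrow> (\<forall>b\<in>V. \<forall>k p. \<forall>u :: 'a list \<Rightarrow> 'k. 0 < k \<longrightarrow> k \<le> rho b \<longrightarrow> koszul_cycle p u \<longrightarrow> headsin (Sx b k) u \<longrightarrow>
     (\<forall>\<tau>. (\<Sum>x\<in>G. u (x # \<tau>)) = 0) \<longrightarrow>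
     (\<exists>v. koszul_cycle (Suc p) v \<and> headsin (Sx b (k - 1)) v \<and> (\<forall>\<tau>. (\<Sum>x\<in>G. v (x # \<tau>)) = u \<tau>)))"

lemma DexE: fixes u :: "'a list \<Rightarrow> 'k::field"
  assumes "koszul_exact TYPE('k)" "b \<in> V" "0 < k" "k \<le> rho b" "koszul_cycle p u" "headsin (Sx b k) u" "\<And>\<tau>. (\<Sum>x\<in>G. u (x # \<tau>)) = 0"
  shows "\<exists>v. koszul_cycle (Suc p) v \<and> headsin (Sx b (k - 1)) v \<and> (\<forall>\<tau>. (\<Sum>x\<in>G. v (x # \<tau>)) = u \<tau>)"
  using assms unfolding koszul_exact_def by blast

lemma sat_V: "sat (x # \<sigma>) \<Longrightarrow> x \<in> V"
  by (cases \<sigma>) (auto dest: covD)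

lemma sat_rho: "sat (x # \<sigma>) \<Longrightarrow> Suc (length \<sigma>) \<le> rho x"
proof (induction \<sigma> arbitrary: x)
  case Nil then show ?case using rho_pos[of x] by simp
next
  case (Cons y \<sigma>) then show ?case using Cons.IH[of y] covD[of x y] by auto
qed

lemma sat_dch: "sat (x # \<sigma>) \<Longrightarrow> rho x = r + Suc (length \<sigma>) \<Longrightarrow> dch {z\<in>G. r < rho z} (x # \<sigma>)"
proof (induction \<sigma> arbitrary: x)
  case Nil then show ?case by (auto simp: dch_Cons)
next
  case (Cons y \<sigma>)
  have c: "cov x y" "sat (y # \<sigma>)" using Cons.prems by auto
  have d: "dch {z\<in>G. r < rho z} (y # \<sigma>)" using Cons.IH[OF c(2)] covD[OF c(1)] Cons.prems by simp
  have "lt w x" if "w \<in> set (y # \<sigma>)" for w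
    using that d covD[OF c(1)] lt_trans[of w y x] by (auto simp: dch_Cons dch_def)
  then show ?case using d covD[OF c(1)] Cons.prems by (auto simp: dch_Cons)
qed

text \<open>A chain of n elements of rank above r whose top has rank at most r + n has no room for
  gaps.\<close>

lemma chain_sat: "dch {z\<in>G. r < rho z} (x # \<sigma>) \<Longrightarrow> rho x \<le> r + Suc (length \<sigma>) \<Longrightarrow> sat (x # \<sigma>) \<and> rho x = r + Suc (length \<sigma>)"
proof (induction \<sigma> arbitrary: x)
  case Nil then show ?case by (auto simp: dch_Cons)
next
  case (Cons y \<sigma>)
  have d: "dch {z\<in>G. r < rho z} (y # \<sigma>)" "lt y x" "x \<in> G" "y \<in> G" using Cons.prems(1) unfolding dch_Cons[of _ x] by (auto simp: dch_Cons)
  have "rho y < rho x" using d rho_less by blast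
  then have y: "sat (y # \<sigma>) \<and> rho y = r + Suc (length \<sigma>)" using Cons.IH[OF d(1)] Cons.prems(2) by simp
  have rx: "rho x = r + Suc (length (y # \<sigma>))" using y Cons.prems(2) \<open>rho y < rho x\<close> by simp
  then have "cov x y" using d y unfolding covers_def by simp
  then show ?case using y rx by simp
qed

lemma trunc_sub: "trunc b r \<subseteq> {z\<in>G. r < rho z}"
  unfolding trunc_def by auto

text \<open>A chain can be pushed, modulo boundaries, onto the saturated chains ending at the
  bottom level: the top rank of its support is lowered one step at a time.\<close>
lemma push_down:
  fixes \<eta> :: "'a list \<Rightarrow> 'k::field"
  assumes trunc_acyclic: "\<And>x. x \<in> G \<Longrightarrow> lt x b \<Longrightarrow> trunc_acyclic TYPE('k) x r" and b: "b \<in> G"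
  shows "\<lbrakk>supp (trunc b r) L \<eta>; \<And>y ys. bd (y # ys) \<eta> \<noteq> 0 \<Longrightarrow> rho y \<le> r + L; \<And>x \<sigma>. \<eta> (x # \<sigma>) \<noteq> 0 \<Longrightarrow> rho x \<le> t\<rbrakk>
    \<Longrightarrow> \<exists>\<theta>. supp (trunc b r) (Suc L) \<theta> \<and> (\<forall>x \<sigma>. \<eta> (x # \<sigma>) + bd (x # \<sigma>) \<theta> \<noteq> 0 \<longrightarrow> rho x \<le> r + L)"
proof (induction t arbitrary: \<eta>)
  case 0
  then show ?case by (intro exI[of _ "\<lambda>_. 0"]) (fastforce simp: supp_def)
next
  case (Suc t)
  show ?case
  proof (cases "Suc t \<le> r + L \<or> L = 0")
    case True
    have "rho x \<le> r + L" if "\<eta> (x # \<sigma>) \<noteq> 0" for x \<sigma>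
      using True Suc.prems(3)[OF that] suppD[OF Suc.prems(1) that] by auto
    then show ?thesis by (intro exI[of _ "\<lambda>_. 0"]) (simp add: supp_def)
  next
    case False
    then obtain L' where L: "L = Suc L'" "r + L < Suc t" by (cases L) auto
    let ?A = "{x\<in>trunc b r. rho x = Suc t}"
    \<comment> \<open>At the highest rank t + 1 the slice below x is a cycle, since nothing can be
      inserted above x and the boundary of \<eta> has no head of that rank. Cones with vertex x over
      fillings of the slices cancel the heads of rank t + 1.\<close>
    have "\<exists>\<theta>. supp (trunc x r) (Suc L') \<theta> \<and> (\<forall>\<tau>. bd \<tau> \<theta> = \<eta> (x # \<tau>))" if x: "x \<in> ?A" for x
    proof (rule vanHE)
      have xG: "x \<in> G" "lt x b" using x unfolding trunc_def by auto
      show "acyclic_at TYPE('k) (trunc x r) L'" using trunc_acyclic[OF xG] x L unfolding trunc_acyclic_def by simp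
      show "supp (trunc x r) L' (\<lambda>\<sigma>. \<eta> (x # \<sigma>))" unfolding supp_def
      proof (intro allI impI)
        fix \<sigma> assume "\<eta> (x # \<sigma>) \<noteq> 0"
        then have "dch (trunc b r) (x # \<sigma>)" "length (x # \<sigma>) = L" using suppD[OF Suc.prems(1)] by blast+
        then show "dch (trunc x r) \<sigma> \<and> length \<sigma> = L'" using L(1) unfolding dch_Cons by (auto simp: dch_def trunc_def)
      qed
      fix \<tau>
      have "\<eta> (v # x # \<tau>) = 0" for v
      proof (rule ccontr)
        assume nz: "\<eta> (v # x # \<tau>) \<noteq> 0"
        then have "dch (trunc b r) (v # x # \<tau>)" using suppD[OF Suc.prems(1)] by blast
        then have "lt x v" "v \<in> G" by (auto simp: dch_Cons trunc_def)
        then have "Suc t < rho v" using rho_less[of v x] x xG by auto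
        then show False using Suc.prems(3)[OF nz] by simp
      qed
      moreover have "bd (x # \<tau>) \<eta> = 0" using Suc.prems(2)[of x \<tau>] x L by auto
      ultimately show "bd \<tau> (\<lambda>\<sigma>. \<eta> (x # \<sigma>)) = 0" by simp
    qed
    then have "\<forall>x\<in>?A. \<exists>\<theta>. supp (trunc x r) (Suc L') \<theta> \<and> (\<forall>\<tau>. bd \<tau> \<theta> = \<eta> (x # \<tau>))" by blast
    then obtain \<Theta> where \<Theta>: "\<forall>x\<in>?A. supp (trunc x r) (Suc L') (\<Theta> x) \<and> (\<forall>\<tau>. bd \<tau> (\<Theta> x) = \<eta> (x # \<tau>))"
      by (rule bchoice[THEN exE])
    define \<theta> where "\<theta> \<sigma> = (case \<sigma> of [] \<Rightarrow> 0 | x # \<sigma>' \<Rightarrow> if x \<in> ?A then \<Theta> x \<sigma>' else 0)" for \<sigma>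
    have \<theta>: "\<theta> (x # \<sigma>) = (if x \<in> ?A then \<Theta> x \<sigma> else 0)" for x \<sigma> unfolding \<theta>_def by simp
    have \<theta>N: "\<theta> [] = 0" unfolding \<theta>_def by simp
    have s\<theta>: "supp (trunc b r) (Suc L) \<theta>" unfolding supp_def
    proof (intro allI impI)
      fix \<sigma> assume nz: "\<theta> \<sigma> \<noteq> 0"
      then obtain x \<sigma>' where \<sigma>: "\<sigma> = x # \<sigma>'" "x \<in> ?A" "\<Theta> x \<sigma>' \<noteq> 0" by (cases \<sigma>) (auto simp: \<theta> \<theta>N split: if_splits)
      then have d: "dch (trunc x r) \<sigma>'" "length \<sigma>' = Suc L'" using suppD \<Theta> by blast+
      have "trunc x r \<subseteq> trunc b r" using \<sigma>(2) lt_trans[of _ x b] b unfolding trunc_def by blast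
      then have "dch (trunc b r) \<sigma>'" using d(1) dch_mono by blast
      then show "dch (trunc b r) \<sigma> \<and> length \<sigma> = Suc L" unfolding \<sigma>(1) dch_Cons using d \<sigma>(2) L
        by (auto simp: dch_def trunc_def)
    qed
    define \<eta>1 where "\<eta>1 = (\<lambda>\<sigma>. \<eta> \<sigma> + bd \<sigma> \<theta>)"
    have s1: "supp (trunc b r) L \<eta>1" unfolding \<eta>1_def using Suc.prems(1) supp_bd[OF s\<theta>] by (rule supp_add)
    have bd1: "bd \<tau> \<eta>1 = bd \<tau> \<eta>" for \<tau> unfolding \<eta>1_def bd_add bd_bd by simp
    have le: "rho y \<le> t" if nz: "\<eta>1 (y # ys) \<noteq> 0" for y ys
    proof (rule ccontr)
      assume ry: "\<not> rho y \<le> t"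
      have yG: "y \<in> trunc b r" using suppD[OF s1 nz] by (auto simp: dch_Cons)
      have "\<theta> (v # y # ys) = 0" for v
      proof (rule ccontr)
        assume "\<theta> (v # y # ys) \<noteq> 0"
        then have v: "v \<in> ?A" "\<Theta> v (y # ys) \<noteq> 0" unfolding \<theta> by (auto split: if_splits)
        then have "dch (trunc v r) (y # ys)" using suppD \<Theta> by blast
        then have "lt y v" "y \<in> G" by (auto simp: dch_Cons trunc_def)
        then show False using rho_less[of v y] v ry by (auto simp: trunc_def)
      qed
      then have B: "bd (y # ys) \<theta> = - bd ys (\<lambda>\<sigma>. \<theta> (y # \<sigma>))" by simp
      show False
      proof (cases "rho y = Suc t")
        case True
        then have "bd (y # ys) \<theta> = - \<eta> (y # ys)" using B \<Theta> yG by (simp add: \<theta>)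
        then show False using nz unfolding \<eta>1_def by simp
      next
        case False
        then have "bd (y # ys) \<theta> = 0" using B by (simp add: \<theta>)
        moreover have "\<eta> (y # ys) = 0" using Suc.prems(3)[of y ys] False ry by auto
        ultimately show False using nz unfolding \<eta>1_def by simp
      qed
    qed
    have bd1': "rho y \<le> r + L" if "bd (y # ys) \<eta>1 \<noteq> 0" for y ys using that Suc.prems(2)[of y ys] bd1 by simp
    have "\<exists>\<theta>. supp (trunc b r) (Suc L) \<theta> \<and> (\<forall>x \<sigma>. \<eta>1 (x # \<sigma>) + bd (x # \<sigma>) \<theta> \<noteq> 0 \<longrightarrow> rho x \<le> r + L)"
      by (rule Suc.IH[OF s1]) (erule bd1', erule le)
    then obtain \<theta>' where \<theta>': "supp (trunc b r) (Suc L) \<theta>'"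
      "\<And>x \<sigma>. \<eta>1 (x # \<sigma>) + bd (x # \<sigma>) \<theta>' \<noteq> 0 \<Longrightarrow> rho x \<le> r + L" by blast
    show ?thesis
    proof (intro exI conjI allI impI)
      show "supp (trunc b r) (Suc L) (\<lambda>\<sigma>. \<theta> \<sigma> + \<theta>' \<sigma>)" using s\<theta> \<theta>'(1) by (rule supp_add)
      fix x \<sigma> assume "\<eta> (x # \<sigma>) + bd (x # \<sigma>) (\<lambda>\<sigma>. \<theta> \<sigma> + \<theta>' \<sigma>) \<noteq> 0"
      then show "rho x \<le> r + L" using \<theta>'(2)[of x \<sigma>] unfolding \<eta>1_def bd_add[of "x # \<sigma>"] by (simp only: add.assoc not_False_eq_True)
    qed
  qed
qed

text \<open>Once all heads have rank at most r + L, the chains are saturated and their heads have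
  rank exactly r + L. The boundary has no heads of that rank, which makes the slices cycles.\<close>

lemma push_down_koszul_cycle:
  fixes \<eta> :: "'a list \<Rightarrow> 'k::field"
  assumes trunc_acyclic: "\<And>x. x \<in> G \<Longrightarrow> lt x b \<Longrightarrow> trunc_acyclic TYPE('k) x r" and b: "b \<in> G"
    and \<eta>: "supp (trunc b r) L \<eta>" "0 < L" "\<And>y ys. bd (y # ys) \<eta> \<noteq> 0 \<Longrightarrow> rho y < r + L"
  obtains \<theta> where "supp (trunc b r) (Suc L) \<theta>" "koszul_cycle L (\<lambda>\<sigma>. \<eta> \<sigma> + bd \<sigma> \<theta>)"
    "headsin (Sx b (rho b - (r + L))) (\<lambda>\<sigma>. \<eta> \<sigma> + bd \<sigma> \<theta>)"
proof -
  have "\<exists>\<theta>. supp (trunc b r) (Suc L) \<theta> \<and> (\<forall>x \<sigma>. \<eta> (x # \<sigma>) + bd (x # \<sigma>) \<theta> \<noteq> 0 \<longrightarrow> rho x \<le> r + L)"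
  proof (rule push_down[OF trunc_acyclic b \<eta>(1)])
    show "rho x \<le> rho b" if "\<eta> (x # \<sigma>) \<noteq> 0" for x \<sigma>
      using suppD[OF \<eta>(1) that] rho_less[OF b, of x] by (auto simp: dch_Cons trunc_def)
  qed (use \<eta>(3) in \<open>auto simp: less_imp_le\<close>)
  then obtain \<theta> where \<theta>: "supp (trunc b r) (Suc L) \<theta>" "\<And>x \<sigma>. \<eta> (x # \<sigma>) + bd (x # \<sigma>) \<theta> \<noteq> 0 \<Longrightarrow> rho x \<le> r + L" by blast
  define c where "c = (\<lambda>\<sigma>. \<eta> \<sigma> + bd \<sigma> \<theta>)"
  have sc: "supp (trunc b r) L c" unfolding c_def using \<eta>(1) supp_bd[OF \<theta>(1)] by (rule supp_add)
  have bdc: "bd \<tau> c = bd \<tau> \<eta>" for \<tau> unfolding c_def bd_add bd_bd by simp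
  have hd: "sat (x # \<sigma>) \<and> rho x = r + L \<and> Suc (length \<sigma>) = L \<and> lt x b \<and> x \<in> G" if "c (x # \<sigma>) \<noteq> 0" for x \<sigma>
  proof -
    have d: "dch (trunc b r) (x # \<sigma>)" "length (x # \<sigma>) = L" using suppD[OF sc that] by blast+
    then have "rho x \<le> r + Suc (length \<sigma>)" using \<theta>(2)[of x \<sigma>] that unfolding c_def by simp
    then show ?thesis using chain_sat[OF dch_mono[OF d(1) trunc_sub]] d by (auto simp: dch_Cons trunc_def)
  qed
  have "koszul_cycle L c" unfolding koszul_cycle_def
  proof (intro conjI allI impI)
    fix \<sigma> assume nz: "c \<sigma> \<noteq> 0"
    then show "length \<sigma> = L" using suppD[OF sc] by blast
    then obtain x \<sigma>' where "\<sigma> = x # \<sigma>'" using \<eta>(2) by (cases \<sigma>) auto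
    then show "sat \<sigma>" using hd nz by blast
  next
    fix x ys
    show "bd ys (\<lambda>\<sigma>. c (x # \<sigma>)) = 0"
    proof (cases "rho x = r + L")
      case True
      have "c (v # x # ys) = 0" for v
      proof (rule ccontr)
        assume nz: "c (v # x # ys) \<noteq> 0"
        have "rho v = Suc (rho x)" using hd[OF nz] covD[of v x] by simp
        then show False using hd[OF nz] True by simp
      qed
      moreover have "bd (x # ys) c = 0" using \<eta>(3)[of x ys] True bdc by auto
      ultimately show ?thesis by simp
    next
      case False
      then have "c (x # \<sigma>) = 0" for \<sigma> using hd by blast
      then show ?thesis by simp
    qed
  qed
  moreover have "headsin (Sx b (rho b - (r + L))) c" unfolding headsin_def
  proof (intro allI impI)
    fix x \<sigma> assume "c (x # \<sigma>) \<noteq> 0"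
    then have "rho x = r + L" "lt x b" "x \<in> G" using hd by blast+
    then show "x \<in> Sx b (rho b - (r + L))" using rho_less[OF b, of x] unfolding Sx_def by simp
  qed
  ultimately show ?thesis using that[OF \<theta>(1)] unfolding c_def by blast
qed

lemma koszul_cycle_supp: assumes b: "b \<in> G" and "koszul_cycle p v" "headsin (Sx b k) v" "0 < k" "0 < p" "rho b = r + p + k"
  shows "supp (trunc b r) p v"
  unfolding supp_def
proof (intro allI impI)
  fix \<sigma> assume nz: "v \<sigma> \<noteq> 0"
  have s: "length \<sigma> = p" "sat \<sigma>" using assms(2) nz unfolding koszul_cycle_def by blast+
  then obtain x \<sigma>' where \<sigma>: "\<sigma> = x # \<sigma>'" using assms(5) by (cases \<sigma>) auto
  have x: "x \<in> G" "x = b \<or> lt x b" "rho b = rho x + k" using assms(3) nz unfolding \<sigma> headsin_def Sx_def by auto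
  then have x': "lt x b" "rho x = r + p" using assms(4,6) by auto
  have d: "dch {z\<in>G. r < rho z} (x # \<sigma>')" using sat_dch[of x \<sigma>' r] s x' unfolding \<sigma> by simp
  have "lt z b" if "z \<in> set \<sigma>'" for z
    using that d x x' b lt_trans[of z x b] by (auto simp: dch_Cons dch_def)
  then have "dch (trunc b r) (x # \<sigma>')" using d x' x(1) unfolding dch_def trunc_def by auto
  then show "dch (trunc b r) \<sigma> \<and> length \<sigma> = p" using s unfolding \<sigma> by blast
qed

text \<open>A cycle is pushed down to an element u of C. Exactness gives v in C with boundary u, and
  v minus the chain used for pushing fills the cycle. Induction on the rank of b provides the
  acyclicity below b that pushing requires.\<close>

lemma koszul_exact_trunc_acyclic: assumes D: "koszul_exact TYPE('k::field)" shows "b \<in> G \<Longrightarrow> trunc_acyclic TYPE('k) b r"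
proof (induction "rho b" arbitrary: b rule: less_induct)
  case less
  have trunc_x: "trunc_acyclic TYPE('k) x r" if "x \<in> G" "lt x b" for x
    using less.hyps[OF rho_less[OF less.prems that] that(1)] .
  show ?case unfolding trunc_acyclic_def acyclic_at_def
  proof (intro allI impI)
    fix l and c :: "'a list \<Rightarrow> 'k"
    assume l: "l + r + 1 < rho b" and c: "supp (trunc b r) l c" "\<forall>\<tau>. bd \<tau> c = 0"
    define k where "k = rho b - (r + l)"
    have k: "0 < k" "k \<le> rho b" "0 < k - 1" "rho b = r + Suc l + (k - 1)" using l unfolding k_def by auto
    have bV: "b \<in> V" using less.prems l by auto
    obtain \<theta> where \<theta>: "supp (trunc b r) (Suc l) \<theta>" "koszul_cycle l (\<lambda>\<sigma>. c \<sigma> + bd \<sigma> \<theta>)"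
      "headsin (Sx b k) (\<lambda>\<sigma>. c \<sigma> + bd \<sigma> \<theta>)"
    \<comment> \<open>Pushing is formulated for nonempty chains; a multiple of the empty chain
      already lies in C.\<close>
    proof (cases "l = 0")
      case True
      have c0: "c (x # \<sigma>) = 0" for x \<sigma> using suppD[OF c(1), of "x # \<sigma>"] True by auto
      have "length \<sigma> = l \<and> sat \<sigma>" if "c \<sigma> \<noteq> 0" for \<sigma> using c0 that True by (cases \<sigma>) auto
      then have "koszul_cycle l (\<lambda>\<sigma>. c \<sigma> + bd \<sigma> (\<lambda>_. 0))" unfolding koszul_cycle_def by (simp add: c0)
      then show ?thesis using that[of "\<lambda>_. 0"] c0 by (simp add: supp_def headsin_def)
    next
      case False
      show ?thesis
        by (rule push_down_koszul_cycle[OF trunc_x less.prems c(1)]) (use False c(2) that in \<open>auto simp: k_def\<close>)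
    qed
    let ?u = "\<lambda>\<sigma>. c \<sigma> + bd \<sigma> \<theta>"
    have z: "(\<Sum>x\<in>G. ?u (x # \<tau>)) = 0" for \<tau>
      using koszul_cycle_bd[OF \<theta>(2), of \<tau>] c(2) by (simp add: bd_add bd_bd)
    obtain v where v: "koszul_cycle (Suc l) v" "headsin (Sx b (k - 1)) v" "\<And>\<tau>. (\<Sum>x\<in>G. v (x # \<tau>)) = ?u \<tau>"
      using DexE[OF D bV k(1,2) \<theta>(2,3) z] by blast
    have sv: "supp (trunc b r) (Suc l) v" using koszul_cycle_supp[OF less.prems v(1,2) k(3) _ k(4)] by simp
    show "\<exists>\<eta>. supp (trunc b r) (Suc l) \<eta> \<and> (\<forall>\<tau>. bd \<tau> \<eta> = c \<tau>)"
      using supp_diff[OF sv \<theta>(1)] by (intro exI[of _ "\<lambda>\<sigma>. v \<sigma> - \<theta> \<sigma>"]) (simp add: bd_diff koszul_cycle_bd[OF v(1)] v(3))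
  qed
qed

text \<open>For k = 1 the only possible head is b, and prefixing b works. For k > 1 the cut-off r is
  chosen so that saturated chains of p elements with head at depth k end exactly at rank r + 1; then
  u is a cycle of the truncation, and a filling is pushed down into C.\<close>

lemma trunc_acyclic_koszul_exact: assumes trunc_acyclic: "\<And>b r. b \<in> G \<Longrightarrow> trunc_acyclic TYPE('k::field) b r" shows "koszul_exact TYPE('k)"
  unfolding koszul_exact_def
proof (intro ballI allI impI)
  fix b k p and u :: "'a list \<Rightarrow> 'k"
  assume b: "b \<in> V" and k: "0 < k" "k \<le> rho b" and u: "koszul_cycle p u" "headsin (Sx b k) u" "\<forall>\<tau>. (\<Sum>x\<in>G. u (x # \<tau>)) = 0"
  have bG: "b \<in> G" using b by simp
  have bu: "bd \<tau> u = 0" for \<tau> using koszul_cycle_bd[OF u(1)] u(3) by simp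
  show "\<exists>v. koszul_cycle (Suc p) v \<and> headsin (Sx b (k - 1)) v \<and> (\<forall>\<tau>. (\<Sum>x\<in>G. v (x # \<tau>)) = u \<tau>)"
  proof (cases "k = 1")
    case True
    define v where "v \<sigma> = (case \<sigma> of [] \<Rightarrow> 0 | x # \<sigma>' \<Rightarrow> if x = b then u \<sigma>' else 0)" for \<sigma>
    have v: "v (x # \<sigma>) = (if x = b then u \<sigma> else 0)" "v [] = 0" for x \<sigma> unfolding v_def by simp_all
    have "koszul_cycle (Suc p) v" unfolding koszul_cycle_def
    proof (intro conjI allI impI)
      fix \<sigma> assume nz: "v \<sigma> \<noteq> 0"
      then obtain \<sigma>' where \<sigma>: "\<sigma> = b # \<sigma>'" "u \<sigma>' \<noteq> 0" by (cases \<sigma>) (auto simp: v split: if_splits)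
      then have s: "length \<sigma>' = p" "sat \<sigma>'" using u(1) unfolding koszul_cycle_def by blast+
      then show "length \<sigma> = Suc p" using \<sigma> by simp
      show "sat \<sigma>"
      proof (cases \<sigma>')
        case Nil then show ?thesis using \<sigma> b by simp
      next
        case (Cons x \<sigma>'')
        then have "x \<in> Sx b 1" using u(2) \<sigma> True unfolding headsin_def by blast
        then show ?thesis using s \<sigma> Cons Sx_1[OF bG] by simp
      qed
    next
      fix x ys
      show "bd ys (\<lambda>\<sigma>. v (x # \<sigma>)) = 0" unfolding v using bu by (cases "x = b") simp_all
    qed
    moreover have "headsin (Sx b (k - 1)) v" unfolding headsin_def using True bG by (simp add: v)
    moreover have "(\<Sum>x\<in>G. v (x # \<tau>)) = u \<tau>" for \<tau> unfolding v using bG by simp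
    ultimately show ?thesis by blast
  next
    case False
    show ?thesis
    proof (cases "p + k \<le> rho b")
      \<comment> \<open>Heads at depth k now have rank below p, too low for a saturated chain of p
        elements different from z0.\<close>
      case big: False
      have "u \<sigma> = 0" for \<sigma>
      proof (rule ccontr)
        assume nz: "u \<sigma> \<noteq> 0"
        then have s: "length \<sigma> = p" "sat \<sigma>" using u(1) unfolding koszul_cycle_def by blast+
        show False
        proof (cases \<sigma>)
          case Nil then show False using s big k by simp
        next
          case (Cons x \<sigma>')
          then have "rho b = rho x + k" using u(2) nz unfolding headsin_def Sx_def by blast
          then show False using sat_rho[of x \<sigma>'] s big Cons by simp
        qed
      qed
      then show ?thesis by (intro exI[of _ "\<lambda>_. 0"]) (simp add: koszul_cycle_zero headsin_def)
    next
      case True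
      define r where "r = rho b - (p + k)"
      have r: "rho b = r + p + k" using True unfolding r_def by simp
      have su: "supp (trunc b r) p u"
      proof (cases "p = 0")
        case True
        have "dch (trunc b r) \<sigma> \<and> length \<sigma> = p" if "u \<sigma> \<noteq> 0" for \<sigma>
          using that u(1) True unfolding koszul_cycle_def by (cases \<sigma>) auto
        then show ?thesis unfolding supp_def by blast
      next
        case False then show ?thesis using koszul_cycle_supp[OF bG u(1,2) k(1) _ r] by simp
      qed
      have "acyclic_at TYPE('k) (trunc b r) p" using trunc_acyclic[OF bG, of r] r False k unfolding trunc_acyclic_def by simp
      then obtain \<eta> where \<eta>: "supp (trunc b r) (Suc p) \<eta>" "\<And>\<tau>. bd \<tau> \<eta> = u \<tau>" using vanHE[OF _ su bu] by blast
      have trunc_x: "trunc_acyclic TYPE('k) x r" if "x \<in> G" "lt x b" for x by (rule trunc_acyclic[OF that(1)])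
      obtain \<theta> where \<theta>: "supp (trunc b r) (Suc (Suc p)) \<theta>" "koszul_cycle (Suc p) (\<lambda>\<sigma>. \<eta> \<sigma> + bd \<sigma> \<theta>)"
        "headsin (Sx b (rho b - (r + Suc p))) (\<lambda>\<sigma>. \<eta> \<sigma> + bd \<sigma> \<theta>)"
      proof (rule push_down_koszul_cycle[OF trunc_x bG \<eta>(1)])
        fix y ys assume "bd (y # ys) \<eta> \<noteq> 0"
        then have "u (y # ys) \<noteq> 0" using \<eta>(2) by simp
        then have "rho b = rho y + k" using u(2) unfolding headsin_def Sx_def by blast
        then show "rho y < r + Suc p" using r by simp
      qed auto
      have "(\<Sum>x\<in>G. \<eta> (x # \<tau>) + bd (x # \<tau>) \<theta>) = u \<tau>" for \<tau>
        using koszul_cycle_bd[OF \<theta>(2), of \<tau>] \<eta>(2) by (simp add: bd_add bd_bd)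
      moreover have e: "rho b - (r + Suc p) = k - 1" using r by simp
      ultimately show ?thesis using \<theta>(2) \<theta>(3)[unfolded e] by (intro exI[of _ "\<lambda>\<sigma>. \<eta> \<sigma> + bd \<sigma> \<theta>"]) simp
    qed
  qed
qed

lemma koszul_exact_iff_interval_acyclic: "koszul_exact TYPE('k::field) \<longleftrightarrow> (\<forall>a\<in>G. \<forall>b\<in>G. lt a b \<longrightarrow> interval_acyclic TYPE('k) a b)"
  using koszul_exact_trunc_acyclic trunc_acyclic_interval_acyclic trunc_acyclic_koszul_exact interval_acyclic_trunc_acyclic by meson

end

section \<open>Reduced cohomology of order complexes\<close>

text \<open>Gaussian elimination on the rows of T: a nonzero row clears one column from the other
  rows and from y, and the induction applies to the reduced system. It transfers exactness between
  chains and cochains.\<close>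

lemma fredholm:
  fixes T :: "'i \<Rightarrow> 'j \<Rightarrow> 'k::field"
  assumes "finite A" "finite B"
  shows "(\<And>z. (\<forall>i\<in>A. (\<Sum>j\<in>B. T i j * z j) = 0) \<Longrightarrow> (\<Sum>j\<in>B. y j * z j) = 0) \<Longrightarrow>
    \<exists>x. \<forall>j\<in>B. y j = (\<Sum>i\<in>A. x i * T i j)"
  using assms(1)
proof (induction A arbitrary: T y rule: finite_induct)
  case empty
  have "y j = 0" if "j \<in> B" for j
  proof -
    have "(\<Sum>l\<in>B. y l * (if l = j then 1 else 0)) = 0" by (rule empty) simp
    moreover have "(\<Sum>l\<in>B. y l * (if l = j then 1 else 0)) = (\<Sum>l\<in>{j}. y l * (if l = j then 1 else 0))"
      by (rule sum.mono_neutral_right) (use that assms(2) in auto)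
    ultimately show ?thesis by simp
  qed
  then show ?case by simp
next
  case (insert a A)
  show ?case
  proof (cases "\<forall>j\<in>B. T a j = 0")
    case True
    have "\<exists>x. \<forall>j\<in>B. y j = (\<Sum>i\<in>A. x i * T i j)"
      by (rule insert.IH, rule insert.prems) (use True in simp)
    then obtain x where "\<forall>j\<in>B. y j = (\<Sum>i\<in>A. x i * T i j)" by blast
    then show ?thesis using True insert(1,2) by (intro exI[of _ x]) simp
  next
    case False
    then obtain j0 where j0: "j0 \<in> B" "T a j0 \<noteq> 0" by blast
    define T' where "T' i j = T i j - T i j0 / T a j0 * T a j" for i j
    define y' where "y' j = y j - y j0 / T a j0 * T a j" for j
    have "\<exists>x. \<forall>j\<in>B. y' j = (\<Sum>i\<in>A. x i * T' i j)"
    proof (rule insert.IH)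
      fix z assume z: "\<forall>i\<in>A. (\<Sum>j\<in>B. T' i j * z j) = 0"
      \<comment> \<open>The entry at the pivot column is adjusted so that the pivot row annihilates
        the vector as well; the reduced rows and y' are 0 in that column.\<close>
      define z' where "z' j = (if j = j0 then z j - (\<Sum>j\<in>B. T a j * z j) / T a j0 else z j)" for j
      have same: "(\<Sum>j\<in>B. f j * z' j) = (\<Sum>j\<in>B. f j * z j)" if "f j0 = 0" for f
        by (rule sum.cong) (auto simp: z'_def that)
      have za: "(\<Sum>j\<in>B. T a j * z' j) = 0"
      proof -
        have "(\<Sum>j\<in>B. T a j * z' j) = (\<Sum>j\<in>B. T a j * z j - (if j = j0 then (\<Sum>j\<in>B. T a j * z j) else 0))"
          by (rule sum.cong) (use j0 in \<open>auto simp: z'_def field_simps\<close>)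
        then show ?thesis using j0 assms(2) by (simp add: sum_subtractf)
      qed
      have zi: "(\<Sum>j\<in>B. T i j * z' j) = (\<Sum>j\<in>B. T' i j * z' j)" for i
      proof -
        have "(\<Sum>j\<in>B. T' i j * z' j) = (\<Sum>j\<in>B. T i j * z' j) - T i j0 / T a j0 * (\<Sum>j\<in>B. T a j * z' j)"
          unfolding T'_def by (simp add: left_diff_distrib sum_subtractf sum_distrib_left mult.assoc)
        then show ?thesis using za by simp
      qed
      have zy: "(\<Sum>j\<in>B. y j * z' j) = (\<Sum>j\<in>B. y' j * z' j)"
      proof -
        have "(\<Sum>j\<in>B. y' j * z' j) = (\<Sum>j\<in>B. y j * z' j) - y j0 / T a j0 * (\<Sum>j\<in>B. T a j * z' j)"
          unfolding y'_def by (simp add: left_diff_distrib sum_subtractf sum_distrib_left mult.assoc)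
        then show ?thesis using za by simp
      qed
      have "(\<Sum>j\<in>B. y j * z' j) = 0"
      proof (rule insert.prems, rule ballI)
        fix i assume i: "i \<in> insert a A"
        have "T' i j0 = 0" using j0 unfolding T'_def by simp
        then show "(\<Sum>j\<in>B. T i j * z' j) = 0" using i za z zi[of i] same[of "T' i"] by auto
      qed
      moreover have "y' j0 = 0" using j0 unfolding y'_def by simp
      ultimately show "(\<Sum>j\<in>B. y' j * z j) = 0" using zy same[of y'] by simp
    qed
    then obtain x where x: "\<forall>j\<in>B. y' j = (\<Sum>i\<in>A. x i * T' i j)" by blast
    define xa where "xa = y j0 / T a j0 - (\<Sum>i\<in>A. x i * (T i j0 / T a j0))"
    have "y j = (\<Sum>i\<in>insert a A. (x(a := xa)) i * T i j)" if "j \<in> B" for j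
    proof -
      have "(\<Sum>i\<in>insert a A. (x(a := xa)) i * T i j) = xa * T a j + (\<Sum>i\<in>A. (x(a := xa)) i * T i j)"
        using insert(1,2) by simp
      also have "(\<Sum>i\<in>A. (x(a := xa)) i * T i j) = (\<Sum>i\<in>A. x i * T i j)"
        by (rule sum.cong) (use insert(2) in auto)
      finally have 1: "(\<Sum>i\<in>insert a A. (x(a := xa)) i * T i j) = xa * T a j + (\<Sum>i\<in>A. x i * T i j)" .
      have "y' j = (\<Sum>i\<in>A. x i * T i j) - (\<Sum>i\<in>A. x i * (T i j0 / T a j0)) * T a j"
        using x that unfolding T'_def by (simp add: right_diff_distrib sum_subtractf sum_distrib_right mult.assoc)
      then have "y j = (\<Sum>i\<in>A. x i * T i j) + xa * T a j" unfolding y'_def xa_def by (simp add: algebra_simps)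
      then show ?thesis unfolding 1 by (simp add: add.commute)
    qed
    then show ?thesis by (intro exI[of _ "x(a := xa)"]) blast
  qed
qed

context rposet begin

section \<open>Coboundaries on lists and duality with the boundary\<close>

primrec cob :: "'a list \<Rightarrow> ('a list \<Rightarrow> 'k::field) \<Rightarrow> 'k" where
  "cob [] \<phi> = 0"
| "cob (s # \<sigma>) \<phi> = \<phi> \<sigma> - cob \<sigma> (\<lambda>\<tau>. \<phi> (s # \<tau>))"

lemma cob_zero [simp]: "cob \<sigma> (\<lambda>_. 0) = 0"
  by (induction \<sigma>) auto

lemma cob_add: "cob \<sigma> (\<lambda>\<tau>. \<phi> \<tau> + \<psi> \<tau>) = cob \<sigma> \<phi> + cob \<sigma> \<psi>"
  by (induction \<sigma> arbitrary: \<phi> \<psi>) (simp_all add: algebra_simps)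

lemma cob_smult: "cob \<sigma> (\<lambda>\<tau>. \<alpha> * \<phi> \<tau>) = \<alpha> * cob \<sigma> \<phi>"
  by (induction \<sigma> arbitrary: \<phi>) (simp_all add: algebra_simps)

lemma cob_sum: "cob \<sigma> (\<lambda>\<tau>. \<Sum>i\<in>A. \<phi> i \<tau>) = (\<Sum>i\<in>A. cob \<sigma> (\<phi> i))"
  by (induction A rule: infinite_finite_induct) (simp_all add: cob_add)

lemma cob_cong: "(\<And>us v vs. \<sigma> = us @ v # vs \<Longrightarrow> \<phi> (us @ vs) = \<psi> (us @ vs)) \<Longrightarrow> cob \<sigma> \<phi> = cob \<sigma> \<psi>"
proof (induction \<sigma> arbitrary: \<phi> \<psi>)
  case (Cons s \<sigma>)
  have "\<phi> \<sigma> = \<psi> \<sigma>" using Cons.prems[of "[]" s \<sigma>] by simp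
  moreover have "cob \<sigma> (\<lambda>\<tau>. \<phi> (s # \<tau>)) = cob \<sigma> (\<lambda>\<tau>. \<psi> (s # \<tau>))"
    by (rule Cons.IH) (use Cons.prems[of "s # _"] in simp)
  ultimately show ?case by simp
qed simp

definition LL :: "nat \<Rightarrow> 'a list set" where "LL n = {\<sigma>. set \<sigma> \<subseteq> G \<and> length \<sigma> = n}"

lemma finite_LL [simp]: "finite (LL n)"
  unfolding LL_def using finite_lists_length_eq[of G n] by simp

lemma sum_LL_Suc: "(\<Sum>\<sigma>\<in>LL (Suc n). f \<sigma>) = (\<Sum>x\<in>G. \<Sum>\<sigma>\<in>LL n. f (x # \<sigma>))"
proof -
  have "LL (Suc n) = (\<lambda>(x, \<sigma>). x # \<sigma>) ` (G \<times> LL n)"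
    unfolding LL_def by (auto simp: length_Suc_conv image_iff)
  moreover have "inj_on (\<lambda>(x, \<sigma>). x # \<sigma>) (G \<times> LL n)" by (auto simp: inj_on_def)
  ultimately show ?thesis by (simp add: sum.reindex sum.cartesian_product split_def)
qed

lemma LL_0: "LL 0 = {[]}"
  unfolding LL_def by auto

lemma bd_cob_adjoint: "(\<Sum>\<sigma>\<in>LL (Suc n). c \<sigma> * cob \<sigma> \<phi>) = (\<Sum>\<tau>\<in>LL n. bd \<tau> c * \<phi> \<tau>)"
proof (induction n arbitrary: c \<phi>)
  case 0
  show ?case unfolding sum_LL_Suc LL_0 by (simp add: sum_distrib_right)
next
  case (Suc n)
  have "(\<Sum>\<sigma>\<in>LL (Suc (Suc n)). c \<sigma> * cob \<sigma> \<phi>) =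
     (\<Sum>x\<in>G. \<Sum>\<sigma>\<in>LL (Suc n). c (x # \<sigma>) * \<phi> \<sigma>) - (\<Sum>x\<in>G. \<Sum>\<sigma>\<in>LL (Suc n). c (x # \<sigma>) * cob \<sigma> (\<lambda>\<tau>. \<phi> (x # \<tau>)))"
    unfolding sum_LL_Suc[of _ "Suc n"] by (simp add: right_diff_distrib sum_subtractf)
  also have "(\<Sum>x\<in>G. \<Sum>\<sigma>\<in>LL (Suc n). c (x # \<sigma>) * cob \<sigma> (\<lambda>\<tau>. \<phi> (x # \<tau>))) =
     (\<Sum>y\<in>G. \<Sum>\<tau>\<in>LL n. bd \<tau> (\<lambda>\<sigma>. c (y # \<sigma>)) * \<phi> (y # \<tau>))"
    by (rule sum.cong[OF refl]) (rule Suc.IH)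
  also have "(\<Sum>x\<in>G. \<Sum>\<sigma>\<in>LL (Suc n). c (x # \<sigma>) * \<phi> \<sigma>) = (\<Sum>\<sigma>\<in>LL (Suc n). \<Sum>x\<in>G. c (x # \<sigma>) * \<phi> \<sigma>)"
    by (rule sum.swap)
  also have "\<dots> = (\<Sum>y\<in>G. \<Sum>\<tau>\<in>LL n. (\<Sum>x\<in>G. c (x # y # \<tau>)) * \<phi> (y # \<tau>))"
    unfolding sum_LL_Suc[of _ n] by (simp add: sum_distrib_right)
  finally show ?case unfolding sum_LL_Suc[of _ n] by (simp add: left_diff_distrib sum_subtractf)
qed

definition DD :: "'a set \<Rightarrow> nat \<Rightarrow> 'a list set" where "DD P l = {\<sigma>. dch P \<sigma> \<and> length \<sigma> = l}"

definition coacyclic_at :: "'k::field itself \<Rightarrow> 'a set \<Rightarrow> nat \<Rightarrow> bool" where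
  "coacyclic_at K P l \<longleftrightarrow> (\<forall>\<phi> :: 'a list \<Rightarrow> 'k. (\<forall>\<sigma>\<in>DD P (Suc l). cob \<sigma> \<phi> = 0) \<longrightarrow> (\<exists>\<psi>. \<forall>\<sigma>\<in>DD P l. \<phi> \<sigma> = cob \<sigma> \<psi>))"

lemma DD_LL: "P \<subseteq> G \<Longrightarrow> DD P l \<subseteq> LL l"
  unfolding DD_def LL_def dch_def by auto

lemma sum_LL_DD: assumes "P \<subseteq> G" "supp P l c" shows "(\<Sum>\<sigma>\<in>LL l. c \<sigma> * f \<sigma>) = (\<Sum>\<sigma>\<in>DD P l. c \<sigma> * f \<sigma>)"
  by (rule sum.mono_neutral_right) (use DD_LL[OF assms(1), of l] suppD[OF assms(2)] in \<open>auto simp: DD_def\<close>)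

lemma delta_expansion: "finite S \<Longrightarrow> (\<Sum>\<tau>\<in>S. z \<tau> * (if \<sigma> = \<tau> then 1 else 0)) = (if \<sigma> \<in> S then z \<sigma> else (0 :: 'k::field))"
proof -
  assume "finite S"
  have "(\<Sum>\<tau>\<in>S. z \<tau> * (if \<sigma> = \<tau> then 1 else 0)) = (\<Sum>\<tau>\<in>S. if \<sigma> = \<tau> then z \<tau> else 0)" by (rule sum.cong) auto
  then show ?thesis using \<open>finite S\<close> by simp
qed

text \<open>A chain is a boundary if it is orthogonal to all cocycles. These are coboundaries by
  hypothesis, and coboundaries are orthogonal to cycles by adjointness.\<close>

lemma coacyclic_at_acyclic_at: assumes P: "P \<subseteq> G" and coacyclic_at: "coacyclic_at TYPE('k::field) P l" shows "acyclic_at TYPE('k) P l"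
  unfolding acyclic_at_def
proof (intro allI impI)
  fix c :: "'a list \<Rightarrow> 'k" assume c: "supp P l c" "\<forall>\<tau>. bd \<tau> c = 0"
  have fin: "finite (DD P n)" for n using finite_subset[OF DD_LL[OF P]] by simp
  let ?d = "\<lambda>\<tau> \<sigma>. (if \<sigma> = \<tau> then 1 else 0) :: 'k"
  have "\<exists>x. \<forall>\<tau>\<in>DD P l. c \<tau> = (\<Sum>\<sigma>\<in>DD P (Suc l). x \<sigma> * cob \<sigma> (?d \<tau>))"
  proof (rule fredholm[OF fin fin])
    fix z assume z: "\<forall>\<sigma>\<in>DD P (Suc l). (\<Sum>\<tau>\<in>DD P l. cob \<sigma> (?d \<tau>) * z \<tau>) = 0"
    define \<phi> where "\<phi> \<sigma> = (\<Sum>\<tau>\<in>DD P l. z \<tau> * ?d \<tau> \<sigma>)" for \<sigma>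
    have "cob \<sigma> \<phi> = 0" if "\<sigma> \<in> DD P (Suc l)" for \<sigma>
      unfolding \<phi>_def cob_sum cob_smult using z that by (simp add: mult.commute)
    then obtain \<psi> where \<psi>: "\<forall>\<sigma>\<in>DD P l. \<phi> \<sigma> = cob \<sigma> \<psi>" using coacyclic_at unfolding coacyclic_at_def by blast
    have "(\<Sum>\<tau>\<in>DD P l. c \<tau> * z \<tau>) = (\<Sum>\<tau>\<in>DD P l. c \<tau> * cob \<tau> \<psi>)"
    proof (rule sum.cong[OF refl])
      fix \<tau> assume "\<tau> \<in> DD P l"
      then have "\<phi> \<tau> = z \<tau>" unfolding \<phi>_def by (simp add: delta_expansion[OF fin])
      then show "c \<tau> * z \<tau> = c \<tau> * cob \<tau> \<psi>" using \<psi> \<open>\<tau> \<in> DD P l\<close> by simp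
    qed
    also have "\<dots> = (\<Sum>\<tau>\<in>LL l. c \<tau> * cob \<tau> \<psi>)" using sum_LL_DD[OF P c(1)] by simp
    also have "\<dots> = 0" using bd_cob_adjoint[where c = c and \<phi> = \<psi>] c(2) by (cases l) (simp_all add: LL_0)
    finally show "(\<Sum>\<tau>\<in>DD P l. c \<tau> * z \<tau>) = 0" .
  qed
  then obtain x where x: "\<forall>\<tau>\<in>DD P l. c \<tau> = (\<Sum>\<sigma>\<in>DD P (Suc l). x \<sigma> * cob \<sigma> (?d \<tau>))" by blast
  define \<eta> where "\<eta> \<sigma> = (if \<sigma> \<in> DD P (Suc l) then x \<sigma> else 0)" for \<sigma>
  have s: "supp P (Suc l) \<eta>" unfolding supp_def \<eta>_def DD_def by simp
  have "bd \<tau> \<eta> = c \<tau>" for \<tau>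
  proof (cases "\<tau> \<in> DD P l")
    case True
    then have t: "\<tau> \<in> LL l" using DD_LL[OF P] by blast
    have "bd \<tau> \<eta> = (\<Sum>\<tau>'\<in>LL l. bd \<tau>' \<eta> * ?d \<tau> \<tau>')"
      using delta_expansion[of "LL l" "\<lambda>\<tau>. bd \<tau> \<eta>" \<tau>] t by (simp add: eq_commute)
    also have "\<dots> = (\<Sum>\<sigma>\<in>DD P (Suc l). \<eta> \<sigma> * cob \<sigma> (?d \<tau>))"
      unfolding bd_cob_adjoint[symmetric] by (rule sum_LL_DD[OF P s])
    also have "\<dots> = c \<tau>" using x True by (simp add: \<eta>_def)
    finally show ?thesis .
  next
    case False
    then have "c \<tau> = 0" "bd \<tau> \<eta> = 0" using suppD[OF c(1)] suppD[OF supp_bd[OF s]] unfolding DD_def by blast+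
    then show ?thesis by simp
  qed
  then show "\<exists>\<eta>. supp P (Suc l) \<eta> \<and> (\<forall>\<tau>. bd \<tau> \<eta> = c \<tau>)" using s by blast
qed

lemma acyclic_at_coacyclic_at: assumes P: "P \<subseteq> G" and van: "acyclic_at TYPE('k::field) P l" shows "coacyclic_at TYPE('k) P l"
  unfolding coacyclic_at_def
proof (intro allI impI)
  fix \<phi> :: "'a list \<Rightarrow> 'k" assume \<phi>: "\<forall>\<sigma>\<in>DD P (Suc l). cob \<sigma> \<phi> = 0"
  have fin: "finite (DD P n)" for n using finite_subset[OF DD_LL[OF P]] by simp
  let ?d = "\<lambda>\<tau> \<sigma>. (if \<sigma> = \<tau> then 1 else 0) :: 'k"
  \<comment> \<open>Lists of length l - 1 index a spanning set of coboundaries. For l = 0 there are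
    none, in agreement with \<open>cob\<close> being 0 on the empty list.\<close>
  define A where "A = (case l of 0 \<Rightarrow> {} | Suc l' \<Rightarrow> LL l')"
  have fA: "finite A" unfolding A_def by (cases l) auto
  have "\<exists>x. \<forall>\<sigma>\<in>DD P l. \<phi> \<sigma> = (\<Sum>\<tau>\<in>A. x \<tau> * cob \<sigma> (?d \<tau>))"
  proof (rule fredholm[OF fA fin])
    fix z assume z: "\<forall>\<tau>\<in>A. (\<Sum>\<sigma>\<in>DD P l. cob \<sigma> (?d \<tau>) * z \<sigma>) = 0"
    define c where "c \<sigma> = (if \<sigma> \<in> DD P l then z \<sigma> else 0)" for \<sigma>
    have s: "supp P l c" unfolding supp_def c_def DD_def by simp
    have "bd \<tau> c = 0" for \<tau>
    proof (cases l)
      case 0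
      show ?thesis
      proof (rule ccontr)
        assume "bd \<tau> c \<noteq> 0"
        then obtain us v vs where "c (us @ v # vs) \<noteq> 0" using bd_nonzero by blast
        then show False using suppD[OF s] 0 by fastforce
      qed
    next
      case (Suc l')
      show ?thesis
      proof (cases "\<tau> \<in> LL l'")
        case True
        have "bd \<tau> c = (\<Sum>\<tau>'\<in>LL l'. bd \<tau>' c * ?d \<tau> \<tau>')"
          using delta_expansion[of "LL l'" "\<lambda>\<tau>. bd \<tau> c" \<tau>] True by (simp add: eq_commute)
        also have "\<dots> = (\<Sum>\<sigma>\<in>DD P (Suc l'). c \<sigma> * cob \<sigma> (?d \<tau>))"
          unfolding bd_cob_adjoint[symmetric] using s Suc by (intro sum_LL_DD[OF P]) simp
        also have "\<dots> = (\<Sum>\<sigma>\<in>DD P l. cob \<sigma> (?d \<tau>) * z \<sigma>)"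
          unfolding Suc by (rule sum.cong) (simp_all add: c_def Suc mult.commute)
        also have "\<dots> = 0" using z True Suc unfolding A_def by simp
        finally show ?thesis .
      next
        case False
        have "supp P l' (\<lambda>\<tau>. bd \<tau> c)" using s Suc by (intro supp_bd) simp
        then show ?thesis using suppD False DD_LL[OF P, of l'] unfolding DD_def by blast
      qed
    qed
    then obtain \<eta> where \<eta>: "supp P (Suc l) \<eta>" "\<And>\<tau>. bd \<tau> \<eta> = c \<tau>" using vanHE[OF van s] by blast
    have "(\<Sum>\<sigma>\<in>DD P l. \<phi> \<sigma> * z \<sigma>) = (\<Sum>\<sigma>\<in>DD P l. c \<sigma> * \<phi> \<sigma>)"
      by (rule sum.cong) (simp_all add: c_def mult.commute)
    also have "\<dots> = (\<Sum>\<sigma>\<in>LL l. bd \<sigma> \<eta> * \<phi> \<sigma>)" using sum_LL_DD[OF P s, of \<phi>] \<eta>(2) by simp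
    also have "\<dots> = (\<Sum>\<sigma>\<in>DD P (Suc l). \<eta> \<sigma> * cob \<sigma> \<phi>)" unfolding bd_cob_adjoint[symmetric] by (rule sum_LL_DD[OF P \<eta>(1)])
    also have "\<dots> = 0" using \<phi> by simp
    finally show "(\<Sum>\<sigma>\<in>DD P l. \<phi> \<sigma> * z \<sigma>) = 0" .
  qed
  then obtain x where x: "\<forall>\<sigma>\<in>DD P l. \<phi> \<sigma> = (\<Sum>\<tau>\<in>A. x \<tau> * cob \<sigma> (?d \<tau>))" by blast
  have "cob \<sigma> (\<lambda>\<rho>. \<Sum>\<tau>\<in>A. x \<tau> * ?d \<tau> \<rho>) = (\<Sum>\<tau>\<in>A. x \<tau> * cob \<sigma> (?d \<tau>))" for \<sigma>
    unfolding cob_sum cob_smult ..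
  then show "\<exists>\<psi>. \<forall>\<sigma>\<in>DD P l. \<phi> \<sigma> = cob \<sigma> \<psi>" using x by (intro exI[of _ "\<lambda>\<rho>. \<Sum>\<tau>\<in>A. x \<tau> * ?d \<tau> \<rho>"]) simp
qed

section \<open>Order complexes in terms of decreasing lists\<close>

lemma dch_distinct: "P \<subseteq> G \<Longrightarrow> dch P \<sigma> \<Longrightarrow> distinct \<sigma>"
proof (induction \<sigma>)
  case (Cons x \<sigma>)
  have "x \<notin> set \<sigma>" using Cons.prems lt_irrefl[of x] unfolding dch_Cons by blast
  then show ?case using Cons unfolding dch_Cons by simp
qed simp

lemma dch_unique: "P \<subseteq> G \<Longrightarrow> dch P \<sigma> \<Longrightarrow> dch P \<tau> \<Longrightarrow> set \<sigma> = set \<tau> \<Longrightarrow> \<sigma> = \<tau>"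
proof (induction \<sigma> arbitrary: \<tau>)
  case (Cons x \<sigma>)
  obtain y \<tau>' where \<tau>: "\<tau> = y # \<tau>'" using Cons.prems(4) by (cases \<tau>) auto
  have d: "dch P \<sigma>" "dch P \<tau>'" "x \<in> G" "y \<in> G" using Cons.prems unfolding \<tau> dch_Cons by auto
  have "x = y"
  proof (rule ccontr)
    assume "x \<noteq> y"
    then have "x \<in> set \<tau>'" "y \<in> set \<sigma>" using Cons.prems(4) unfolding \<tau> by auto
    then have "lt x y" "lt y x" using Cons.prems(2,3) unfolding \<tau> dch_Cons by auto
    then show False using lt_asym d by blast
  qed
  moreover have "x \<notin> set \<sigma>" "y \<notin> set \<tau>'" using dch_distinct[OF Cons.prems(1,2)] dch_distinct[OF Cons.prems(1,3)] unfolding \<tau> by auto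
  ultimately have "set \<sigma> = set \<tau>'" using Cons.prems(4) unfolding \<tau> by (metis Diff_insert_absorb list.simps(15))
  then show ?case using Cons.IH[OF Cons.prems(1) d(1,2)] \<open>x = y\<close> unfolding \<tau> by simp
qed simp

lemma dch_of_chain: "\<lbrakk>finite s; s \<subseteq> P; P \<subseteq> G; is_chain lt s\<rbrakk> \<Longrightarrow> \<exists>\<sigma>. dch P \<sigma> \<and> set \<sigma> = s"
proof (induction "card s" arbitrary: s)
  case 0 then show ?case by (intro exI[of _ "[]"]) simp
next
  case (Suc n)
  have "s \<subseteq> G" "s \<noteq> {}" using Suc by auto
  from maximal_exists[OF this] obtain x where x: "x \<in> s" "\<forall>w\<in>s. \<not> lt x w" by blast
  have "\<exists>\<sigma>. dch P \<sigma> \<and> set \<sigma> = s - {x}"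
    by (rule Suc.hyps(1)) (use Suc x in \<open>auto simp: is_chain_def\<close>)
  then obtain \<sigma> where \<sigma>: "dch P \<sigma>" "set \<sigma> = s - {x}" by blast
  have "lt y x" if "y \<in> set \<sigma>" for y
    using that x Suc.prems(4) unfolding \<sigma>(2) is_chain_def by blast
  then have "dch P (x # \<sigma>)" using \<sigma>(1) x Suc.prems unfolding dch_Cons by blast
  then show ?case using \<sigma>(2) x by (intro exI[of _ "x # \<sigma>"]) auto
qed

lemma simplices_DD: assumes "P \<subseteq> G" shows "simplices P lt (int l - 1) = set ` DD P l"
proof (intro equalityI subsetI)
  fix s assume "s \<in> simplices P lt (int l - 1)"
  then have s: "s \<subseteq> P" "finite s" "is_chain lt s" "card s = l" unfolding simplices_def chain_sets_def by auto
  then obtain \<sigma> where "dch P \<sigma>" "set \<sigma> = s" using dch_of_chain assms by blast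
  then show "s \<in> set ` DD P l" using s distinct_card[OF dch_distinct[OF assms]] unfolding DD_def by auto
next
  fix s assume "s \<in> set ` DD P l"
  then obtain \<sigma> where \<sigma>: "dch P \<sigma>" "length \<sigma> = l" "s = set \<sigma>" unfolding DD_def by auto
  have "is_chain lt (set \<sigma>)" using \<sigma>(1) by (induction \<sigma>) (auto simp: is_chain_def dch_Cons)
  then show "s \<in> simplices P lt (int l - 1)" using \<sigma> distinct_card[OF dch_distinct[OF assms \<sigma>(1)]]
    unfolding simplices_def chain_sets_def by (auto simp: dch_def)
qed

text \<open>In a decreasing list of n elements the one at position i has n - 1 - i elements below
  it, so the two sign conventions differ by a factor depending on n alone.\<close>

lemma cobdry_cob: "P \<subseteq> G \<Longrightarrow> dch P \<sigma> \<Longrightarrow> cobdry lt \<phi> (set \<sigma>) = - ((-1) ^ length \<sigma>) * cob \<sigma> (\<lambda>\<tau>. \<phi> (set \<tau>))"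
proof (induction \<sigma> arbitrary: \<phi>)
  case Nil then show ?case by (simp add: cobdry_def)
next
  case (Cons s \<sigma>)
  have d: "dch P \<sigma>" "\<And>y. y \<in> set \<sigma> \<Longrightarrow> lt y s" "s \<in> G" "set \<sigma> \<subseteq> G" using Cons.prems unfolding dch_Cons by (auto simp: dch_def)
  have dist: "distinct (s # \<sigma>)" using dch_distinct Cons.prems by blast
  then have sn: "s \<notin> set \<sigma>" by simp
  have "{u \<in> set (s # \<sigma>). lt u s} = set \<sigma>" using d by auto
  then have c: "card {u \<in> set (s # \<sigma>). lt u s} = length \<sigma>" using dist distinct_card[of \<sigma>] by simp
  have e: "{u \<in> set (s # \<sigma>). lt u v} = {u \<in> set \<sigma>. lt u v}" "set (s # \<sigma>) - {v} = insert s (set \<sigma> - {v})" if "v \<in> set \<sigma>" for v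
    using that d sn lt_asym[of v s] by auto
  have "cobdry lt \<phi> (set (s # \<sigma>)) = (-1) ^ card {u \<in> set (s # \<sigma>). lt u s} * \<phi> (set (s # \<sigma>) - {s}) +
     (\<Sum>v\<in>set \<sigma>. (-1) ^ card {u \<in> set (s # \<sigma>). lt u v} * \<phi> (set (s # \<sigma>) - {v}))"
    unfolding cobdry_def using sn by simp
  also have "(\<Sum>v\<in>set \<sigma>. (-1) ^ card {u \<in> set (s # \<sigma>). lt u v} * \<phi> (set (s # \<sigma>) - {v})) = cobdry lt (\<lambda>t. \<phi> (insert s t)) (set \<sigma>)"
    unfolding cobdry_def by (rule sum.cong[OF refl]) (simp only: e)
  also have "\<dots> = - ((-1) ^ length \<sigma>) * cob \<sigma> (\<lambda>\<tau>. \<phi> (insert s (set \<tau>)))" by (rule Cons.IH[OF Cons.prems(1) d(1)])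
  finally show ?case unfolding c using sn by (simp add: algebra_simps)
qed

lemma dch_remove: "dch P (us @ v # vs) \<Longrightarrow> dch P (us @ vs)"
  unfolding dch_def by (auto simp: sorted_wrt_append)

text \<open>Cochains on sets and on lists correspond through the unique decreasing enumeration of a
  chain; the sign between the conventions is absorbed into the primitive.\<close>

lemma red_coh_iff: assumes P: "P \<subseteq> G" shows "red_coh_nonzero TYPE('k::field) P lt (int l - 1) \<longleftrightarrow> \<not> coacyclic_at TYPE('k) P l"
proof -
  have S: "simplices P lt (int l - 1 + 1) = set ` DD P (Suc l)" using simplices_DD[OF P, of "Suc l"] by simp
  define e :: 'k where "e = - ((-1) ^ l)"
  have ee: "e * e = 1" unfolding e_def by (simp flip: power_mult_distrib)
  define lst where "lst s = (SOME \<tau>. dch P \<tau> \<and> set \<tau> = s)" for s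
  have lst: "lst (set \<tau>) = \<tau>" if "dch P \<tau>" for \<tau>
  proof -
    have "dch P (lst (set \<tau>)) \<and> set (lst (set \<tau>)) = set \<tau>" unfolding lst_def by (rule someI[of _ \<tau>]) (use that in simp)
    then show ?thesis using dch_unique[OF P] that by blast
  qed
  have clst: "cob \<sigma> (\<lambda>\<tau>. f (lst (set \<tau>))) = cob \<sigma> f" if "dch P \<sigma>" for \<sigma> and f :: "'a list \<Rightarrow> 'k"
  proof (rule cob_cong)
    fix us v vs assume "\<sigma> = us @ v # vs"
    then have "dch P (us @ vs)" using that dch_remove by blast
    then show "f (lst (set (us @ vs))) = f (us @ vs)" by (simp only: lst)
  qed
  have "(\<forall>\<phi> :: 'a set \<Rightarrow> 'k. (\<forall>t\<in>simplices P lt (int l - 1 + 1). cobdry lt \<phi> t = 0) \<longrightarrow>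
     (\<exists>\<psi> :: 'a set \<Rightarrow> 'k. \<forall>s\<in>simplices P lt (int l - 1). \<phi> s = cobdry lt \<psi> s)) \<longleftrightarrow> coacyclic_at TYPE('k) P l" (is "?L \<longleftrightarrow> _")
  proof
    assume L: ?L
    show "coacyclic_at TYPE('k) P l" unfolding coacyclic_at_def
    proof (intro allI impI)
      fix \<phi> :: "'a list \<Rightarrow> 'k" assume \<phi>: "\<forall>\<sigma>\<in>DD P (Suc l). cob \<sigma> \<phi> = 0"
      have "\<forall>t\<in>simplices P lt (int l - 1 + 1). cobdry lt (\<lambda>s. \<phi> (lst s)) t = 0"
        unfolding S using \<phi> by (auto simp: DD_def cobdry_cob[OF P] clst)
      then obtain \<psi> :: "'a set \<Rightarrow> 'k" where \<psi>: "\<forall>s\<in>simplices P lt (int l - 1). \<phi> (lst s) = cobdry lt \<psi> s"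
        using L[rule_format, of "\<lambda>s. \<phi> (lst s)"] by blast
      have "\<phi> \<sigma> = cob \<sigma> (\<lambda>\<tau>. e * \<psi> (set \<tau>))" if "\<sigma> \<in> DD P l" for \<sigma>
        using \<psi>[unfolded simplices_DD[OF P]] that unfolding cob_smult e_def by (auto simp: DD_def lst cobdry_cob[OF P])
      then show "\<exists>\<psi>. \<forall>\<sigma>\<in>DD P l. \<phi> \<sigma> = cob \<sigma> \<psi>" by (intro exI[of _ "\<lambda>\<tau>. e * \<psi> (set \<tau>)"]) blast
    qed
  next
    assume R: "coacyclic_at TYPE('k) P l"
    show ?L
    proof (intro allI impI)
      fix \<phi> :: "'a set \<Rightarrow> 'k" assume \<phi>: "\<forall>t\<in>simplices P lt (int l - 1 + 1). cobdry lt \<phi> t = 0"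
      have "\<forall>\<sigma>\<in>DD P (Suc l). cob \<sigma> (\<lambda>\<tau>. \<phi> (set \<tau>)) = 0"
        using \<phi> unfolding S by (auto simp: DD_def cobdry_cob[OF P])
      then obtain \<psi> where \<psi>: "\<forall>\<sigma>\<in>DD P l. \<phi> (set \<sigma>) = cob \<sigma> \<psi>"
        using R[unfolded coacyclic_at_def, rule_format, of "\<lambda>\<tau>. \<phi> (set \<tau>)"] by blast
      have "\<phi> (set \<sigma>) = cobdry lt (\<lambda>s. e * \<psi> (lst s)) (set \<sigma>)" if s: "\<sigma> \<in> DD P l" for \<sigma>
      proof -
        have d: "dch P \<sigma>" "length \<sigma> = l" using s unfolding DD_def by auto
        have "cobdry lt (\<lambda>s. e * \<psi> (lst s)) (set \<sigma>) = e * (e * cob \<sigma> \<psi>)"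
          unfolding cobdry_cob[OF P d(1)] cob_smult clst[OF d(1)] d(2) e_def ..
        then show ?thesis using \<psi> s ee by (simp flip: mult.assoc)
      qed
      then show "\<exists>\<psi> :: 'a set \<Rightarrow> 'k. \<forall>s\<in>simplices P lt (int l - 1). \<phi> s = cobdry lt \<psi> s"
        unfolding simplices_DD[OF P] by (intro exI[of _ "\<lambda>s. e * \<psi> (lst s)"]) blast
    qed
  qed
  moreover have "int l - 1 \<ge> -1" by simp
  ultimately show ?thesis unfolding red_coh_nonzero_def by blast
qed

lemma dch_open_length: assumes "a \<in> G" "b \<in> G" "lt a b" "dch (open_int G lt a b) \<sigma>"
  shows "length \<sigma> + rho a + 1 \<le> rho b"
proof -
  have "length \<sigma> + rho a \<le> rho x" if "dch (open_int G lt a b) (x # \<sigma>')" "\<sigma> = x # \<sigma>'" for x \<sigma>' \<sigma>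
    using that
  proof (induction \<sigma>' arbitrary: x \<sigma>)
    case Nil then show ?case using rho_less[of x a] assms by (auto simp: dch_Cons open_int_def)
  next
    case (Cons y \<sigma>')
    have d: "dch (open_int G lt a b) (y # \<sigma>')" "lt y x" "x \<in> G" "y \<in> G" using Cons.prems(1) by (auto simp: dch_Cons open_int_def)
    have "length (y # \<sigma>') + rho a \<le> rho y" by (rule Cons.IH[OF d(1) refl])
    then show ?case using rho_less[OF d(3,4,2)] Cons.prems(2) by simp
  qed
  note H = this
  show ?thesis
  proof (cases \<sigma>)
    case Nil then show ?thesis using rho_less[OF assms(2,1,3)] by simp
  next
    case (Cons x \<sigma>')
    have "length \<sigma> + rho a \<le> rho x" using H[of x \<sigma>' \<sigma>] assms(4) Cons by simp
    moreover have "rho x < rho b" using assms Cons by (auto simp: dch_Cons open_int_def intro: rho_less)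
    ultimately show ?thesis by simp
  qed
qed

lemma dch_open_exists: "b \<in> G \<Longrightarrow> a \<in> Sx b (Suc k) \<Longrightarrow> \<exists>\<sigma>. dch (open_int G lt a b) \<sigma> \<and> length \<sigma> = k"
proof (induction k arbitrary: b)
  case 0 then show ?case by (intro exI[of _ "[]"]) simp
next
  case (Suc k)
  obtain c where c: "cov b c" "a \<in> Sx c (Suc k)" using Sx_Suc_elim Suc.prems by metis
  have cG: "c \<in> G" "lt c b" "lt a c" "a \<in> G" using covD[OF c(1)] c(2) by (auto simp: Sx_def)
  from Suc.IH[OF cG(1) c(2)] obtain \<sigma> where \<sigma>: "dch (open_int G lt a c) \<sigma>" "length \<sigma> = k" by blast
  have "open_int G lt a c \<subseteq> open_int G lt a b" unfolding open_int_def using cG lt_trans[of _ c b] Suc.prems(1) by blast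
  then have "dch (open_int G lt a b) (c # \<sigma>)" using \<sigma>(1) dch_mono cG
    unfolding dch_Cons by (auto simp: open_int_def dch_def)
  then show ?case using \<sigma>(2) by (intro exI[of _ "c # \<sigma>"]) simp
qed

lemma cplx_dim_open: assumes "a \<in> G" "b \<in> G" "lt a b"
  shows "cplx_dim (open_int G lt a b) lt = int (rho b) - int (rho a) - 2"
proof -
  let ?P = "open_int G lt a b"
  have P: "?P \<subseteq> G" unfolding open_int_def by auto
  have r: "rho a < rho b" using rho_less assms by blast
  have "a \<in> Sx b (Suc (rho b - rho a - 1))" using assms r by (simp add: Sx_def)
  then obtain \<sigma> where \<sigma>: "dch ?P \<sigma>" "length \<sigma> = rho b - rho a - 1" using dch_open_exists assms by blast
  have mem: "set \<sigma> \<in> chain_sets ?P lt" "int (card (set \<sigma>)) - 1 = int (rho b) - int (rho a) - 2"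
    using simplices_DD[OF P, of "length \<sigma>"] \<sigma> r distinct_card[OF dch_distinct[OF P \<sigma>(1)]] unfolding DD_def simplices_def by auto
  have bnd: "int (card s) - 1 \<le> int (rho b) - int (rho a) - 2" if "s \<in> chain_sets ?P lt" for s
  proof -
    have s: "s \<subseteq> ?P" "finite s" "is_chain lt s" using that unfolding chain_sets_def by auto
    then obtain \<tau> where "dch ?P \<tau>" "set \<tau> = s" using dch_of_chain P by blast
    then show ?thesis using dch_open_length[OF assms, of \<tau>] distinct_card[OF dch_distinct[OF P]] by fastforce
  qed
  have "finite (chain_sets ?P lt)"
    by (rule finite_subset[of _ "Pow G"]) (use P in \<open>auto simp: chain_sets_def\<close>)
  then show ?thesis unfolding cplx_dim_def by (intro Max_eqI) (use mem bnd in \<open>auto simp: image_iff intro!: bexI[of _ "set \<sigma>"]\<close>)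
qed

text \<open>Below the top length the conditions match degree by degree. Beyond it there are no
  chains, hence no classes.\<close>

lemma cohen_macaulay_iff: "cohen_macaulay TYPE('k::field) G lt \<longleftrightarrow> (\<forall>a\<in>G. \<forall>b\<in>G. lt a b \<longrightarrow> interval_acyclic TYPE('k) a b)"
proof -
  have "(\<forall>n. red_coh_nonzero TYPE('k) (open_int G lt a b) lt n \<longrightarrow> n = cplx_dim (open_int G lt a b) lt) \<longleftrightarrow> interval_acyclic TYPE('k) a b"
    if ab: "a \<in> G" "b \<in> G" "lt a b" for a b
  proof -
    let ?P = "open_int G lt a b"
    have P: "?P \<subseteq> G" unfolding open_int_def by auto
    show ?thesis unfolding cplx_dim_open[OF ab]
    proof
      assume L: "\<forall>n. red_coh_nonzero TYPE('k) ?P lt n \<longrightarrow> n = int (rho b) - int (rho a) - 2"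
      show "interval_acyclic TYPE('k) a b" unfolding interval_acyclic_def
      proof (intro allI impI)
        fix l assume l: "l + rho a + 1 < rho b"
        have "\<not> red_coh_nonzero TYPE('k) ?P lt (int l - 1)" using L l by fastforce
        then show "acyclic_at TYPE('k) ?P l" using red_coh_iff[OF P] coacyclic_at_acyclic_at[OF P] by blast
      qed
    next
      assume R: "interval_acyclic TYPE('k) a b"
      show "\<forall>n. red_coh_nonzero TYPE('k) ?P lt n \<longrightarrow> n = int (rho b) - int (rho a) - 2"
      proof (intro allI impI)
        fix n assume n: "red_coh_nonzero TYPE('k) ?P lt n"
        then have "n \<ge> -1" unfolding red_coh_nonzero_def by simp
        then obtain l where l: "n = int l - 1" by (metis add.commute add_diff_cancel_left' diff_ge_0_iff_ge nonneg_int_cases uminus_add_conv_diff diff_minus_eq_add)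
        have sol_adm: "\<not> coacyclic_at TYPE('k) ?P l" using n red_coh_iff[OF P] unfolding l by blast
        have "\<not> l + rho a + 1 < rho b" using sol_adm R acyclic_at_coacyclic_at[OF P] unfolding interval_acyclic_def by blast
        moreover have "DD ?P l \<noteq> {}" using sol_adm unfolding coacyclic_at_def by auto
        then have "l + rho a + 1 \<le> rho b" using dch_open_length[OF ab] unfolding DD_def by blast
        ultimately show "n = int (rho b) - int (rho a) - 2" unfolding l by simp
      qed
    qed
  qed
  then show ?thesis unfolding cohen_macaulay_def by blast
qed

end

section \<open>Linear resolutions\<close>

text \<open>Induction on the coordinates: a member that is nonzero at s is normalised there and
  added to a basis of the members vanishing at s.\<close>

lemma subspace_basis:
  fixes S :: "'x set"
  assumes "finite S"
  shows "\<lbrakk>\<And>f g \<alpha> \<beta>. f \<in> W \<Longrightarrow> g \<in> W \<Longrightarrow> (\<lambda>x. \<alpha> * f x + \<beta> * g x) \<in> W; \<And>f x. f \<in> W \<Longrightarrow> f x \<noteq> 0 \<Longrightarrow> x \<in> S\<rbrakk> \<Longrightarrow>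
   \<exists>(n :: nat) (c :: nat \<Rightarrow> 'x \<Rightarrow> 'k::field). (\<forall>k<n. c k \<in> W) \<and>
     (\<forall>\<alpha>. (\<forall>x. (\<Sum>k<n. \<alpha> k * c k x) = 0) \<longrightarrow> (\<forall>k<n. \<alpha> k = 0)) \<and>
     (\<forall>u\<in>W. \<exists>\<alpha>. \<forall>x. u x = (\<Sum>k<n. \<alpha> k * c k x))"
  using assms
proof (induction S arbitrary: W rule: finite_induct)
  case empty
  have "f x = 0" if "f \<in> W" for f x using empty.prems(2)[OF that] by blast
  then show ?case by (intro exI[of _ "0::nat"] exI[of _ "\<lambda>_ _. 0"]) simp
next
  case (insert s S)
  show ?case
  proof (cases "\<exists>f\<in>W. f s \<noteq> 0")
    case False
    show ?thesis
    proof (rule insert.IH[OF insert.prems(1)])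
      fix f x assume "f \<in> W" "f x \<noteq> 0"
      then show "x \<in> S" using insert.prems(2)[of f x] False by blast
    qed
  next
    case True
    then obtain f where f: "f \<in> W" "f s \<noteq> 0" by blast
    define f0 where "f0 x = (1 / f s) * f x + 0 * f x" for x
    have f0: "f0 \<in> W" "f0 s = 1" using insert.prems(1)[OF f(1,1), of "1 / f s" 0] f(2) unfolding f0_def by auto
    let ?W = "{f \<in> W. f s = 0}"
    have "\<exists>(n :: nat) c. (\<forall>k<n. c k \<in> ?W) \<and>
     (\<forall>\<alpha>. (\<forall>x. (\<Sum>k<n. \<alpha> k * c k x) = 0) \<longrightarrow> (\<forall>k<n. \<alpha> k = 0)) \<and>
     (\<forall>u\<in>?W. \<exists>\<alpha>. \<forall>x. u x = (\<Sum>k<n. \<alpha> k * c k x))"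
    proof (rule insert.IH)
      fix f x assume "f \<in> ?W" "f x \<noteq> 0"
      then show "x \<in> S" using insert.prems(2)[of f x] by auto
    qed (use insert.prems(1) in auto)
    then obtain n :: nat and c where c: "\<forall>k<n. c k \<in> ?W"
     "\<And>\<alpha>. (\<forall>x. (\<Sum>k<n. \<alpha> k * c k x) = 0) \<Longrightarrow> (\<forall>k<n. \<alpha> k = 0)"
     "\<forall>u\<in>?W. \<exists>\<alpha>. \<forall>x. u x = (\<Sum>k<n. \<alpha> k * c k x)" by blast
    let ?c = "c(n := f0)"
    have sm: "(\<Sum>k<Suc n. \<alpha> k * ?c k x) = (\<Sum>k<n. \<alpha> k * c k x) + \<alpha> n * f0 x" for \<alpha> x by simp
    show ?thesis
    proof (intro exI[of _ "Suc n"] exI[of _ ?c] conjI allI impI ballI)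
      show "?c k \<in> W" if "k < Suc n" for k using that c(1) f0 by (auto simp: less_Suc_eq)
      fix \<alpha> :: "nat \<Rightarrow> 'k" and k assume z: "\<forall>x. (\<Sum>k<Suc n. \<alpha> k * ?c k x) = 0" and k: "k < Suc n"
      have "(\<Sum>k<n. \<alpha> k * c k s) = 0" using c(1) by (intro sum.neutral) auto
      then have an: "\<alpha> n = 0" using z[rule_format, of s] f0 unfolding sm by simp
      then have "\<forall>k<n. \<alpha> k = 0" using z unfolding sm by (intro c(2)) simp
      then show "\<alpha> k = 0" using an k by (auto simp: less_Suc_eq)
    next
      fix u assume u: "u \<in> W"
      have "(\<lambda>x. 1 * u x + (- u s) * f0 x) \<in> ?W" using insert.prems(1)[OF u f0(1), of 1 "- u s"] f0 by simp
      then have "\<exists>\<alpha>. \<forall>x. 1 * u x + (- u s) * f0 x = (\<Sum>k<n. \<alpha> k * c k x)" by (rule c(3)[THEN bspec])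
      then obtain \<alpha> where \<alpha>: "\<forall>x. 1 * u x + (- u s) * f0 x = (\<Sum>k<n. \<alpha> k * c k x)" by (elim exE)
      have "u x = (\<Sum>k<Suc n. (\<alpha>(n := u s)) k * ?c k x)" for x
      proof -
        have "(\<Sum>k<n. (\<alpha>(n := u s)) k * c k x) = (\<Sum>k<n. \<alpha> k * c k x)" by (rule sum.cong) auto
        then show ?thesis unfolding sm using \<alpha>[rule_format, of x] by (simp add: algebra_simps)
      qed
      then show "\<exists>\<alpha>. \<forall>x. u x = (\<Sum>k<Suc n. \<alpha> k * ?c k x)" by blast
    qed
  qed
qed

context rposet begin

section \<open>The spaces C_p and their slices\<close>

lemma koszul_cycle_lin: assumes "koszul_cycle p u" "koszul_cycle p v" shows "koszul_cycle p (\<lambda>\<sigma>. \<alpha> * u \<sigma> + \<beta> * v \<sigma>)"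
proof -
  have "length \<sigma> = p \<and> sat \<sigma>" if "\<alpha> * u \<sigma> + \<beta> * v \<sigma> \<noteq> 0" for \<sigma>
    using that assms unfolding koszul_cycle_def by (cases "u \<sigma> = 0") auto
  then show ?thesis using assms unfolding koszul_cycle_def by (simp add: bd_lin)
qed

lemma koszul_cycle_sum: "(\<And>i. i \<in> A \<Longrightarrow> koszul_cycle p (u i)) \<Longrightarrow> koszul_cycle p (\<lambda>\<sigma>. \<Sum>i\<in>A. \<alpha> i * u i \<sigma>)"
proof (induction A rule: infinite_finite_induct)
  case (insert a A)
  then show ?case using koszul_cycle_lin[of p "u a" "\<lambda>\<sigma>. \<Sum>i\<in>A. \<alpha> i * u i \<sigma>" "\<alpha> a" 1] by simp
qed (simp_all add: koszul_cycle_zero)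

lemma koszul_cycle_Nil: "koszul_cycle (Suc p) u \<Longrightarrow> u [] = 0"
  unfolding koszul_cycle_def by force

lemma koszul_cycle_nonzero: "koszul_cycle p u \<Longrightarrow> u \<sigma> \<noteq> 0 \<Longrightarrow> length \<sigma> = p \<and> sat \<sigma>"
  unfolding koszul_cycle_def by blast

lemma koszul_cycle_head: "koszul_cycle p u \<Longrightarrow> u (x # \<sigma>) \<noteq> 0 \<Longrightarrow> x \<in> V"
  using koszul_cycle_nonzero sat_V by blast

text \<open>Nothing fits between x and an element y covered by x. So in the boundary of the slice at
  x only the insertions after y remain, and they must cancel among themselves.\<close>

lemma koszul_cycle_slice: assumes u: "koszul_cycle (Suc p) u" shows "koszul_cycle p (\<lambda>\<sigma>. u (x # \<sigma>))"
  unfolding koszul_cycle_def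
proof (intro conjI allI impI)
  fix \<sigma> assume "u (x # \<sigma>) \<noteq> 0"
  then have "length (x # \<sigma>) = Suc p" "sat (x # \<sigma>)" using koszul_cycle_nonzero[OF u] by blast+
  then show "length \<sigma> = p" "sat \<sigma>" by (cases \<sigma>, auto)+
next
  fix y ys
  show "bd ys (\<lambda>\<sigma>. u (x # y # \<sigma>)) = 0"
  proof (cases "cov x y")
    case True
    have "u (x # v # y # ys) = 0" for v
    proof (rule ccontr)
      assume "u (x # v # y # ys) \<noteq> 0"
      then have "cov x v" "cov v y" using koszul_cycle_nonzero[OF u] by fastforce+
      then show False using covD[OF True] covD[of x v] covD[of v y] by simp
    qed
    moreover have "bd (y # ys) (\<lambda>\<sigma>. u (x # \<sigma>)) = 0" using u unfolding koszul_cycle_def by blast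
    ultimately show ?thesis by simp
  next
    case False
    then have "u (x # y # \<sigma>) = 0" for \<sigma> using koszul_cycle_nonzero[OF u, of "x # y # \<sigma>"] by auto
    then show ?thesis by simp
  qed
qed

lemma koszul_cycle_sum_second: assumes "koszul_cycle (Suc p) u" shows "(\<Sum>z\<in>G. u (x # z # \<tau>)) = 0"
  using koszul_cycle_bd[OF koszul_cycle_slice[OF assms], of \<tau> x] assms unfolding koszul_cycle_def by simp

text \<open>The quadratic description of C: slices lie in C, and the sum and covering conditions on
  the first two entries say that these entries form a degree 2 relation of A'.\<close>

lemma koszul_cycle_SucI: assumes "\<And>x. koszul_cycle p (\<lambda>\<sigma>. u (x # \<sigma>))" "\<And>x \<tau>. (\<Sum>z\<in>G. u (x # z # \<tau>)) = 0"
  "u [] = 0" "\<And>x \<sigma>. u (x # \<sigma>) \<noteq> 0 \<Longrightarrow> x \<in> V" "\<And>x z \<sigma>. u (x # z # \<sigma>) \<noteq> 0 \<Longrightarrow> cov x z"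
  shows "koszul_cycle (Suc p) u"
  unfolding koszul_cycle_def
proof (intro conjI allI impI)
  fix \<sigma> assume nz: "u \<sigma> \<noteq> 0"
  then obtain x \<sigma>' where \<sigma>: "\<sigma> = x # \<sigma>'" using assms(3) by (cases \<sigma>) auto
  have s: "length \<sigma>' = p \<and> sat \<sigma>'" using koszul_cycle_nonzero[OF assms(1)[of x]] nz unfolding \<sigma> by blast
  then show "length \<sigma> = Suc p" unfolding \<sigma> by simp
  show "sat \<sigma>" using s nz assms(4,5) unfolding \<sigma> by (cases \<sigma>') auto
next
  fix x ys
  show "bd ys (\<lambda>\<sigma>. u (x # \<sigma>)) = 0" using koszul_cycle_bd[OF assms(1)[of x], of ys] assms(2)[of x ys] by simp
qed

text \<open>The conditions defining koszul_cycle concern one head at a time, so functions may be glued head by head.\<close>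
lemma koszul_cycle_headwise: assumes "\<And>x. koszul_cycle (Suc p) (v x)" shows "koszul_cycle (Suc p) (\<lambda>\<sigma>. case \<sigma> of [] \<Rightarrow> 0 | x # \<sigma>' \<Rightarrow> v x (x # \<sigma>'))"
  unfolding koszul_cycle_def
proof (intro conjI allI impI)
  fix \<sigma> assume "(case \<sigma> of [] \<Rightarrow> 0 | x # \<sigma>' \<Rightarrow> v x (x # \<sigma>')) \<noteq> 0"
  then show "length \<sigma> = Suc p" "sat \<sigma>" using koszul_cycle_nonzero[OF assms] by (cases \<sigma>; fastforce)+
next
  fix x ys
  show "bd ys (\<lambda>\<sigma>. case x # \<sigma> of [] \<Rightarrow> 0 | x # \<sigma>' \<Rightarrow> v x (x # \<sigma>')) = 0" using assms[of x] unfolding koszul_cycle_def by simp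
qed

definition isbasis :: "nat \<Rightarrow> nat \<Rightarrow> (nat \<Rightarrow> 'a list \<Rightarrow> 'k::field) \<Rightarrow> bool" where
  "isbasis p n c \<longleftrightarrow> (\<forall>k<n. koszul_cycle p (c k)) \<and>
     (\<forall>\<alpha>. (\<forall>\<sigma>. (\<Sum>k<n. \<alpha> k * c k \<sigma>) = 0) \<longrightarrow> (\<forall>k<n. \<alpha> k = 0)) \<and>
     (\<forall>u. koszul_cycle p u \<longrightarrow> (\<exists>\<alpha>. \<forall>\<sigma>. u \<sigma> = (\<Sum>k<n. \<alpha> k * c k \<sigma>)))"

lemma isbasis_indep: "\<lbrakk>isbasis p n c; \<And>\<sigma>. (\<Sum>k<n. \<alpha> k * c k \<sigma>) = 0; k < n\<rbrakk> \<Longrightarrow> \<alpha> k = 0"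
  unfolding isbasis_def by blast

lemma isbasis_koszul_cycle: "isbasis p n c \<Longrightarrow> k < n \<Longrightarrow> koszul_cycle p (c k)"
  unfolding isbasis_def by blast

lemma isbasis_span: "isbasis p n c \<Longrightarrow> koszul_cycle p u \<Longrightarrow> \<exists>\<alpha>. \<forall>\<sigma>. u \<sigma> = (\<Sum>k<n. \<alpha> k * c k \<sigma>)"
  unfolding isbasis_def by blast

lemma isbasis_exists: "\<exists>n (c :: nat \<Rightarrow> 'a list \<Rightarrow> 'k::field). isbasis p n c"
proof -
  have "\<exists>(n :: nat) (c :: nat \<Rightarrow> 'a list \<Rightarrow> 'k). (\<forall>k<n. c k \<in> {u. koszul_cycle p u}) \<and>
     (\<forall>\<alpha>. (\<forall>x. (\<Sum>k<n. \<alpha> k * c k x) = 0) \<longrightarrow> (\<forall>k<n. \<alpha> k = 0)) \<and>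
     (\<forall>u\<in>{u. koszul_cycle p u}. \<exists>\<alpha>. \<forall>x. u x = (\<Sum>k<n. \<alpha> k * c k x))"
  proof (rule subspace_basis[of "LL p"])
    have satG: "sat \<sigma> \<Longrightarrow> set \<sigma> \<subseteq> G" for \<sigma> by (induction \<sigma> rule: sat.induct) (auto dest: covD)
    show "x \<in> LL p" if "f \<in> {u. koszul_cycle p u}" "f x \<noteq> 0" for f :: "'a list \<Rightarrow> 'k" and x
      using koszul_cycle_nonzero[of p f x] that satG unfolding LL_def by auto
  qed (auto intro: koszul_cycle_lin)
  then show ?thesis unfolding isbasis_def by simp
qed

lemma koszul_cycle_0_iff: "koszul_cycle 0 u \<longleftrightarrow> (\<forall>x \<sigma>. u (x # \<sigma>) = 0)"
proof
  assume "koszul_cycle 0 u"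
  then show "\<forall>x \<sigma>. u (x # \<sigma>) = 0" using koszul_cycle_nonzero by fastforce
next
  assume a: "\<forall>x \<sigma>. u (x # \<sigma>) = 0"
  have "length \<sigma> = 0 \<and> sat \<sigma>" if "u \<sigma> \<noteq> 0" for \<sigma> using that a by (cases \<sigma>) auto
  then show "koszul_cycle 0 u" using a unfolding koszul_cycle_def by simp
qed

definition dlt :: "'a list \<Rightarrow> 'k::field" where "dlt \<sigma> = (if \<sigma> = [] then 1 else 0)"

lemma isbasis_0: "isbasis 0 (Suc 0) (\<lambda>_. dlt :: 'a list \<Rightarrow> 'k::field)"
  unfolding isbasis_def
proof (intro conjI allI impI)
  show "koszul_cycle 0 dlt" by (simp add: koszul_cycle_0_iff dlt_def)
  show "\<alpha> k = 0" if "\<forall>\<sigma>. (\<Sum>k<Suc 0. \<alpha> k * dlt \<sigma>) = 0" "k < Suc 0" for \<alpha> :: "nat \<Rightarrow> 'k" and k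
    using that(1)[rule_format, of "[]"] that(2) by (simp add: dlt_def)
  fix u :: "'a list \<Rightarrow> 'k" assume "koszul_cycle 0 u"
  then have z: "u (x # \<sigma>) = 0" for x \<sigma> unfolding koszul_cycle_0_iff by blast
  have "u \<sigma> = (\<Sum>k<Suc 0. u [] * dlt \<sigma>)" for \<sigma> by (cases \<sigma>) (simp_all add: z dlt_def)
  then show "\<exists>\<alpha>. \<forall>\<sigma>. u \<sigma> = (\<Sum>k<Suc 0. \<alpha> k * dlt \<sigma>)" by (intro exI[of _ "\<lambda>_. u []"] allI)
qed

text \<open>Coordinates of degree 1 elements in A', which has one generator for each x different
  from z0.\<close>

definition gl :: "(('a \<times> 'a) list \<Rightarrow> 'k::field) \<Rightarrow> 'a \<Rightarrow> 'k" where "gl g x = cls g [(x, 1)]"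

lemma cls_invalid: "f \<in> tensor_alg E \<Longrightarrow> \<not> valid m \<Longrightarrow> cls f m = 0"
  using cls_nonzero[of f m] NF_valid tensor_supp by blast

lemma gl_V: "g \<in> tensor_alg E \<Longrightarrow> x \<notin> V \<Longrightarrow> gl g x = 0"
  unfolding gl_def by (rule cls_invalid) auto

lemma homog1_word: "homog 1 g \<Longrightarrow> g v \<noteq> 0 \<Longrightarrow> \<exists>e. v = [e]"
  unfolding homog_def by (cases v) auto

lemma cls_ncmul_gen:
  fixes f g :: "('a \<times> 'a) list \<Rightarrow> 'k::field"
  assumes "f \<in> tensor_alg E" "g \<in> tensor_alg E" "homog 1 g"
  shows "cls (ncmul f g) m = (\<Sum>x\<in>G. gl g x * lin f (\<lambda>u. if step (NF u) x = m then 1 else 0))"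
proof -
  let ?i = "\<lambda>u x. if step (NF u) x = m then 1 else 0 :: 'k"
  have in1: "lin g (\<lambda>v. if NF (u @ v) = m then 1 else 0) = (\<Sum>x\<in>G. gl g x * ?i u x)" for u
  proof -
    have "lin g (\<lambda>v. if NF (u @ v) = m then 1 else 0) = lin g (\<lambda>v. \<Sum>x\<in>G. ?i u x * (if NF v = [(x, 1)] then 1 else 0))"
    proof (rule lin_cong)
      fix v assume nz: "g v \<noteq> 0"
      obtain e where v: "v = [e]" using homog1_word[OF assms(3) nz] by blast
      have eG: "fst e \<in> G" using tensor_supp[OF assms(2) nz] E_fst[of e] unfolding v by simp
      have NFe: "NF [e] = [(fst e, 1)]" by (simp add: NF_def)
      have "(\<Sum>x\<in>G. ?i u x * (if NF v = [(x, 1)] then 1 else 0)) = (\<Sum>x\<in>G. if x = fst e then ?i u x else 0)"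
        unfolding v NFe by (rule sum.cong) auto
      also have "\<dots> = ?i u (fst e)" using eG by simp
      finally show "(if NF (u @ v) = m then 1 else 0) = (\<Sum>x\<in>G. ?i u x * (if NF v = [(x, 1)] then 1 else 0))"
        unfolding v by simp
    qed
    also have "\<dots> = (\<Sum>x\<in>G. ?i u x * gl g x)" unfolding lin_sum_right lin_mult_right gl_def cls_def ..
    finally show ?thesis by (simp add: mult.commute)
  qed
  have "cls (ncmul f g) m = lin f (\<lambda>u. \<Sum>x\<in>G. gl g x * ?i u x)"
    unfolding cls_def lin_ncmul[OF tensor_fsupp[OF assms(1)] tensor_fsupp[OF assms(2)]] in1 ..
  then show ?thesis unfolding lin_sum_right lin_mult_right .
qed

lemma cls_ncmul_Nil: "\<lbrakk>f \<in> tensor_alg E; g \<in> tensor_alg E; homog 1 g\<rbrakk> \<Longrightarrow> cls (ncmul f g) [] = 0"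
  unfolding cls_ncmul_gen by simp

text \<open>A letter at depth k - 1 below b leads to the given word from \<open>prevst\<close> of
  that word and from nowhere else; other letters do not lead to it.\<close>

lemma cls_ncmul:
  fixes f g :: "('a \<times> 'a) list \<Rightarrow> 'k::field"
  assumes "f \<in> tensor_alg E" "g \<in> tensor_alg E" "homog 1 g" "valid ((b, k) # m)"
  shows "cls (ncmul f g) ((b, k) # m) = (\<Sum>x\<in>Sx b (k - 1). gl g x * cls f (prevst ((b, k) # m)))"
proof -
  let ?m = "(b, k) # m"
  have "lin f (\<lambda>u. if step (NF u) x = ?m then 1 else 0) = (if x \<in> Sx b (k - 1) then cls f (prevst ?m) else 0)" if x: "x \<in> V" for x
  proof -
    have "lin f (\<lambda>u. if step (NF u) x = ?m then 1 else 0) = lin f (\<lambda>u. (if x \<in> Sx b (k - 1) then 1 else 0) * (if NF u = prevst ?m then 1 else 0))"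
    proof (rule lin_cong)
      fix u assume "f u \<noteq> 0"
      then have "valid (NF u)" using tensor_supp[OF assms(1)] NF_valid by blast
      then have "step (NF u) x = ?m \<longleftrightarrow> NF u = prevst ?m \<and> x \<in> Sx b (k - 1)"
        using step_eqD[of "NF u" x b k m] prev_valid(2)[OF assms(4) _ x] x by metis
      then show "(if step (NF u) x = ?m then 1 else 0) = (if x \<in> Sx b (k - 1) then 1 else 0 :: 'k) * (if NF u = prevst ?m then 1 else 0)" by simp
    qed
    then show ?thesis unfolding lin_mult_right cls_def by simp
  qed
  then have "gl g x * lin f (\<lambda>u. if step (NF u) x = ?m then 1 else 0) = (if x \<in> Sx b (k - 1) then gl g x * cls f (prevst ?m) else 0)" for x
    using gl_V[OF assms(2), of x] by (cases "x \<in> V") auto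
  then have "cls (ncmul f g) ?m = (\<Sum>x\<in>G. if x \<in> Sx b (k - 1) then gl g x * cls f (prevst ?m) else 0)"
    unfolding cls_ncmul_gen[OF assms(1-3)] by simp
  also have "\<dots> = (\<Sum>x\<in>Sx b (k - 1). gl g x * cls f (prevst ?m))"
    by (rule sum.mono_neutral_cong_right) (auto simp: Sx_def)
  finally show ?thesis .
qed

text \<open>The boundary of the complex A' (x) C, with A' expanded in normal words: the words m' with
  m' x = (b, k) m are the single word prevst ((b, k) m), for x in Sx b (k - 1).\<close>
fun cycle_bd :: "(('a \<times> nat) list \<Rightarrow> 'a list \<Rightarrow> 'k::field) \<Rightarrow> ('a \<times> nat) list \<Rightarrow> 'a list \<Rightarrow> 'k" where
  "cycle_bd Y [] \<tau> = 0"
| "cycle_bd Y ((b, k) # m) \<tau> = (\<Sum>x\<in>Sx b (k - 1). Y (prevst ((b, k) # m)) (x # \<tau>))"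

text \<open>If the last pair has length at least 2, both removed letters belong to it, and summing a
  member of C over its second entry gives 0. If the length is 1, the letter removed second would
  cover b, so b would have merged into the preceding pair.\<close>

lemma cycle_bd_cycle_bd: assumes Y: "\<And>m. koszul_cycle (Suc p) (Y m)" and m: "valid m" shows "cycle_bd (cycle_bd Y) m \<tau> = 0"
proof (cases m)
  case (Cons q m')
  obtain b k where q: "q = (b, k)" by (cases q)
  have v: "valid m'" "adm m' b" "b \<in> V" "0 < k" "k \<le> rho b" using m unfolding Cons q by auto
  show ?thesis
  proof (cases "k = 1")
    case True
    show ?thesis
    proof (cases m')
      case Nil then show ?thesis using True unfolding Cons q by simp
    next
      case (Cons q' m'')
      obtain b' k' where q': "q' = (b', k')" by (cases q')
      have v': "valid ((b', k') # m'')" "b' \<in> G" "0 < k'" using v(1) unfolding Cons q' by auto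
      have "Y (prevst ((b', k') # m'')) (x # b # \<tau>) = 0" if "x \<in> Sx b' (k' - 1)" for x
      proof (rule ccontr)
        assume "Y (prevst ((b', k') # m'')) (x # b # \<tau>) \<noteq> 0"
        then have "cov x b" using koszul_cycle_nonzero[OF Y] by fastforce
        then have "b \<in> Sx x (Suc 0)" using Sx_1[of x b] covD[of x b] by blast
        then have "b \<in> Sx b' k'" using Sx_trans[OF that _ v'(2), of b "Suc 0"] v'(3) by simp
        then show False using v(2) unfolding Cons q' by simp
      qed
      then have "cycle_bd Y ((b', k') # m'') (b # \<tau>) = 0" by simp
      then show ?thesis using True v(3) unfolding \<open>m = q # m'\<close> q Cons q' by simp
    qed
  next
    case False
    have "(\<Sum>x\<in>Sx b (k - 1). Y M (x' # x # \<tau>)) = 0" if x': "x' \<in> Sx b (k - 1 - 1)" for x' M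
    proof -
      have "(\<Sum>x\<in>Sx b (k - 1). Y M (x' # x # \<tau>)) = (\<Sum>x\<in>G. Y M (x' # x # \<tau>))"
      proof (rule sum.mono_neutral_left)
        show "\<forall>x\<in>G - Sx b (k - 1). Y M (x' # x # \<tau>) = 0"
        proof (intro ballI, rule ccontr)
          fix x assume x: "x \<in> G - Sx b (k - 1)" "Y M (x' # x # \<tau>) \<noteq> 0"
          then have "cov x' x" using koszul_cycle_nonzero[OF Y] by fastforce
          then have "x \<in> Sx x' (Suc 0)" using Sx_1[of x' x] covD[of x' x] by blast
          then have "x \<in> Sx b (k - 1 - 1 + Suc 0)" using x' v(3) by (intro Sx_trans[of x']) auto
          moreover have "k - 1 - 1 + Suc 0 = k - 1" using False v(4) by simp
          ultimately show False using x(1) by simp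
        qed
      qed (auto simp: Sx_def)
      then show ?thesis using koszul_cycle_sum_second[OF Y] by simp
    qed
    then have "(\<Sum>x'\<in>Sx b (k - 1 - 1). \<Sum>x\<in>Sx b (k - 1). Y (prevst ((b, k - 1) # m')) (x' # x # \<tau>)) = 0" by simp
    moreover have "cycle_bd (cycle_bd Y) m \<tau> = (\<Sum>x\<in>Sx b (k - 1). \<Sum>x'\<in>Sx b (k - 1 - 1). Y (prevst ((b, k - 1) # m')) (x' # x # \<tau>))"
      using False unfolding Cons q by simp
    moreover have "\<dots> = (\<Sum>x'\<in>Sx b (k - 1 - 1). \<Sum>x\<in>Sx b (k - 1). Y (prevst ((b, k - 1) # m')) (x' # x # \<tau>))" by (rule sum.swap)
    ultimately show ?thesis by simp
  qed
qed simp

end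

text \<open>The matrices M i of a linear complex, together with the images c p k of the basis vectors of its
  p-th term in p-fold tensors.\<close>
locale kdata = rposet +
  fixes d :: "nat \<Rightarrow> nat" and M :: "nat \<Rightarrow> nat \<Rightarrow> nat \<Rightarrow> ('a \<times> 'a) list \<Rightarrow> 'k::field" and c :: "nat \<Rightarrow> nat \<Rightarrow> 'a list \<Rightarrow> 'k"
  assumes MT: "M i k l \<in> tensor_alg E" and Mh: "homog 1 (M i k l)"
    and compat: "k < d (Suc p) \<Longrightarrow> c (Suc p) k (x # \<tau>) = (\<Sum>l<d p. gl (M p k l) x * c p l \<tau>)"
begin

text \<open>The element of A' (x) C_p with coordinate tuple y, expanded in normal words m and chains
  \<sigma>. In this form the differential no longer refers to the matrices.\<close>

definition dict :: "nat \<Rightarrow> (nat \<Rightarrow> ('a \<times> 'a) list \<Rightarrow> 'k) \<Rightarrow> ('a \<times> nat) list \<Rightarrow> 'a list \<Rightarrow> 'k" where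
  "dict p y m \<sigma> = (\<Sum>k<d p. cls (y k) m * c p k \<sigma>)"

abbreviation BB :: "nat \<Rightarrow> bool" where "BB p \<equiv> isbasis p (d p) (c p)"
abbreviation TT :: "nat \<Rightarrow> (nat \<Rightarrow> ('a \<times> 'a) list \<Rightarrow> 'k) set" where "TT p \<equiv> tuples E (d p)"
abbreviation bb :: "nat \<Rightarrow> (nat \<Rightarrow> ('a \<times> 'a) list \<Rightarrow> 'k) \<Rightarrow> nat \<Rightarrow> ('a \<times> 'a) list \<Rightarrow> 'k" where "bb \<equiv> bdry d M"

lemma TT_tensor: "y \<in> TT p \<Longrightarrow> k < d p \<Longrightarrow> y k \<in> tensor_alg E"
  unfolding tuples_def by simp

lemma bb_tensor: assumes "y \<in> TT (Suc p)" shows "bb p y l \<in> tensor_alg E"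
  unfolding bdry_def by (intro tensor_sum tensor_ncmul[OF TT_tensor[OF assms] MT]) simp

lemma bb_TT: "y \<in> TT (Suc p) \<Longrightarrow> bb p y \<in> TT p"
  unfolding tuples_def[of E "d p"] by (simp add: bb_tensor)

lemma cls_bb: assumes "y \<in> TT (Suc p)" shows "cls (bb p y l) m = (\<Sum>k<d (Suc p). cls (ncmul (y k) (M p k l)) m)"
  unfolding bdry_def by (rule cls_sum) (auto intro!: fsupp_ncmul tensor_fsupp[OF TT_tensor[OF assms]] tensor_fsupp[OF MT])

lemma cls_bb_Nil: assumes "y \<in> TT (Suc p)" shows "cls (bb p y l) [] = 0"
  unfolding cls_bb[OF assms] by (intro sum.neutral ballI cls_ncmul_Nil) (use assms MT Mh in \<open>auto intro: TT_tensor\<close>)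

text \<open>By \<open>compat\<close> the matrix entries are the coefficients of removing a head, so
  summation over the generators turns the matrix product into \<open>cycle_bd\<close>.\<close>

lemma dict_bb: assumes y: "y \<in> TT (Suc p)" and m: "valid m" shows "dict p (bb p y) m \<tau> = cycle_bd (dict (Suc p) y) m \<tau>"
proof (cases m)
  case Nil then show ?thesis unfolding dict_def using cls_bb_Nil[OF y] by simp
next
  case (Cons q m')
  obtain b k where q: "q = (b, k)" by (cases q)
  let ?p = "prevst ((b, k) # m')"
  let ?S = "Sx b (k - 1)"
  have "dict p (bb p y) m \<tau> = (\<Sum>l<d p. (\<Sum>j<d (Suc p). \<Sum>x\<in>?S. gl (M p j l) x * cls (y j) ?p) * c p l \<tau>)"
    unfolding dict_def cls_bb[OF y] Cons q
    by (intro sum.cong refl arg_cong2[where f = "(*)"] cls_ncmul) (use y MT Mh m in \<open>auto intro: TT_tensor simp: Cons q\<close>)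
  also have "\<dots> = (\<Sum>l<d p. \<Sum>j<d (Suc p). \<Sum>x\<in>?S. cls (y j) ?p * (gl (M p j l) x * c p l \<tau>))"
    unfolding sum_distrib_right by (intro sum.cong refl) (simp add: mult_ac del: prevst.simps)
  also have "\<dots> = (\<Sum>j<d (Suc p). \<Sum>l<d p. \<Sum>x\<in>?S. cls (y j) ?p * (gl (M p j l) x * c p l \<tau>))"
    by (rule sum.swap)
  also have "\<dots> = (\<Sum>j<d (Suc p). \<Sum>x\<in>?S. \<Sum>l<d p. cls (y j) ?p * (gl (M p j l) x * c p l \<tau>))"
    by (intro sum.cong refl sum.swap)
  also have "\<dots> = (\<Sum>j<d (Suc p). \<Sum>x\<in>?S. cls (y j) ?p * c (Suc p) j (x # \<tau>))"
    by (intro sum.cong refl) (simp add: compat sum_distrib_left)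
  also have "\<dots> = (\<Sum>x\<in>?S. \<Sum>j<d (Suc p). cls (y j) ?p * c (Suc p) j (x # \<tau>))"
    by (rule sum.swap)
  finally show ?thesis unfolding dict_def Cons q by simp
qed

lemma dict_eq_imp: assumes B: "BB p" and y: "y \<in> TT p" "y' \<in> TT p" and eq: "\<And>m \<sigma>. valid m \<Longrightarrow> dict p y m \<sigma> = dict p y' m \<sigma>"
  and k: "k < d p"
  shows "(\<lambda>w. y k w - y' k w) \<in> class_ker"
proof -
  have ft: "fsupp (y k)" "fsupp (y' k)" using TT_tensor[OF y(1) k] TT_tensor[OF y(2) k] tensor_fsupp by blast+
  have "cls (y k) m - cls (y' k) m = 0" for m
  proof (cases "valid m")
    case True
    have "(\<Sum>k<d p. (cls (y k) m - cls (y' k) m) * c p k \<sigma>) = 0" for \<sigma>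
      using eq[OF True, of \<sigma>] unfolding dict_def by (simp add: left_diff_distrib sum_subtractf)
    from isbasis_indep[OF B, where \<alpha> = "\<lambda>k. cls (y k) m - cls (y' k) m", OF this k] show ?thesis .
  next
    case False then show ?thesis using cls_invalid[OF TT_tensor[OF y(1) k] False] cls_invalid[OF TT_tensor[OF y(2) k] False] by simp
  qed
  then show ?thesis unfolding class_ker_def using TT_tensor[OF y(1) k] TT_tensor[OF y(2) k] ft by (simp add: tensor_diff cls_diff)
qed

lemma dict_eqI: assumes y: "y \<in> TT p" "y' \<in> TT p" and k: "\<And>k. k < d p \<Longrightarrow> (\<lambda>w. y k w - y' k w) \<in> class_ker"
  shows "dict p y m \<sigma> = dict p y' m \<sigma>"
proof -
  have "cls (y k) m = cls (y' k) m" if "k < d p" for k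
  proof -
    have "cls (\<lambda>w. y k w - y' k w) m = 0" using k[OF that] unfolding class_ker_def by blast
    then show ?thesis using TT_tensor[OF y(1) that] TT_tensor[OF y(2) that] by (simp add: cls_diff tensor_fsupp)
  qed
  then show ?thesis unfolding dict_def by simp
qed

lemma zero_TT: "(\<lambda>_ _. 0) \<in> TT p"
  unfolding tuples_def by (simp add: tensor_zero)

lemma dict_zero [simp]: "dict p (\<lambda>_ _. 0) m \<sigma> = 0"
  unfolding dict_def by (simp add: cls_zero)

lemma dict_koszul_cycle: "BB p \<Longrightarrow> koszul_cycle p (dict p y m)"
proof -
  assume B: "BB p"
  have "koszul_cycle p (\<lambda>\<sigma>. \<Sum>k<d p. cls (y k) m * c p k \<sigma>)" by (rule koszul_cycle_sum) (use B in \<open>simp add: isbasis_def\<close>)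
  then show ?thesis unfolding dict_def[abs_def] .
qed

lemma dict_finite: assumes "y \<in> TT p" shows "finite {m. dict p y m \<noteq> (\<lambda>_. 0)}"
proof (rule finite_subset)
  show "{m. dict p y m \<noteq> (\<lambda>_. 0)} \<subseteq> (\<Union>k<d p. NF ` {w. y k w \<noteq> 0})"
  proof
    fix m assume "m \<in> {m. dict p y m \<noteq> (\<lambda>_. 0)}"
    then obtain \<sigma> where "dict p y m \<sigma> \<noteq> 0" by auto
    then obtain k where "k < d p" "cls (y k) m \<noteq> 0" unfolding dict_def
      by (metis (no_types, lifting) lessThan_iff mult_zero_left sum.neutral)
    then show "m \<in> (\<Union>k<d p. NF ` {w. y k w \<noteq> 0})" using cls_nonzero[of "y k" m] by blast
  qed
  show "finite (\<Union>k<d p. NF ` {w. y k w \<noteq> 0})" using TT_tensor[OF assms] tensor_fsupp by blast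
qed

lemma dict_surj: assumes B: "BB p" and Y: "\<And>m. koszul_cycle p (Y m)" "finite {m. Y m \<noteq> (\<lambda>_. 0)}" "\<And>m. \<not> valid m \<Longrightarrow> Y m = (\<lambda>_. 0)"
  shows "\<exists>y\<in>TT p. \<forall>m. dict p y m = Y m"
proof -
  let ?F = "{m. Y m \<noteq> (\<lambda>_. 0)}"
  have "\<forall>m. \<exists>\<alpha>. \<forall>\<sigma>. Y m \<sigma> = (\<Sum>k<d p. \<alpha> k * c p k \<sigma>)" using B Y(1) unfolding isbasis_def by blast
  then obtain \<alpha> where \<alpha>: "\<forall>m \<sigma>. Y m \<sigma> = (\<Sum>k<d p. \<alpha> m k * c p k \<sigma>)" by (rule choice[THEN exE])
  define y where "y k w = (\<Sum>m\<in>?F. \<alpha> m k * mono (canon m) w)" for k w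
  have val: "valid m" if "m \<in> ?F" for m using Y(3) that by blast
  have yT: "y \<in> TT p" unfolding tuples_def y_def
    using val by (auto intro!: tensor_sum tensor_smult tensor_mono canon_E)
  have cy: "cls (y k) m = (if m \<in> ?F then \<alpha> m k else 0)" for k m
  proof -
    have "cls (y k) m = (\<Sum>m'\<in>?F. \<alpha> m' k * (if NF (canon m') = m then 1 else 0))"
      unfolding y_def using Y(2) by (subst cls_sum) (auto simp: cls_smult cls_mono fsupp_smult)
    also have "\<dots> = (\<Sum>m'\<in>?F. if m' = m then \<alpha> m' k else 0)"
      by (rule sum.cong) (use val in \<open>auto simp: NF_canon\<close>)
    finally show ?thesis using Y(2) by simp
  qed
  have "dict p y m = Y m" for m
  proof
    fix \<sigma>
    show "dict p y m \<sigma> = Y m \<sigma>"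
    proof (cases "m \<in> ?F")
      case True then show ?thesis unfolding dict_def cy using \<alpha> by simp
    next
      case False
      then have "Y m \<sigma> = 0" by simp
      then show ?thesis unfolding dict_def cy using False by simp
    qed
  qed
  then show ?thesis using yT by blast
qed

text \<open>Each nonempty normal word gives its own instance of \<open>koszul_exact\<close>. A head
  x over m1 belongs to the instance of \<open>step m1 x\<close>, so preimages chosen for different
  words never collide and can be assembled head by head.\<close>

lemma exactness:
  assumes D: "koszul_exact TYPE('k)" and B: "BB p" "BB (Suc p)" and y: "y \<in> TT p"
    and N: "dict p y [] = (\<lambda>_. 0)" and Z: "\<And>m \<tau>. valid m \<Longrightarrow> cycle_bd (dict p y) m \<tau> = 0"
  shows "\<exists>y'\<in>TT (Suc p). \<forall>k<d p. (\<lambda>w. y k w - bb p y' k w) \<in> class_ker"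
proof -
  let ?Y = "dict p y"
  have Y: "koszul_cycle p (?Y m)" for m using dict_koszul_cycle[OF B(1)] .
  \<comment> \<open>Choosing v = 0 wherever the given element vanishes keeps the assembled family
    finitely supported.\<close>
  have "\<exists>v. koszul_cycle (Suc p) v \<and> (m \<noteq> [] \<longrightarrow> valid m \<longrightarrow> headsin (Sx (fst (hd m)) (snd (hd m) - 1)) v \<and> (\<forall>\<tau>. (\<Sum>x\<in>G. v (x # \<tau>)) = ?Y m \<tau>)) \<and>
     (?Y m = (\<lambda>_. 0) \<longrightarrow> v = (\<lambda>_. 0))" for m
  proof (cases "m \<noteq> [] \<and> valid m \<and> ?Y m \<noteq> (\<lambda>_. 0)")
    case False
    then show ?thesis by (intro exI[of _ "\<lambda>_. 0"]) (auto simp: koszul_cycle_zero headsin_def)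
  next
    case True
    then obtain b k m' where m: "m = (b, k) # m'" by (cases m rule: valid.cases) auto
    have v: "valid m" "valid m'" "adm m' b" "b \<in> V" "0 < k" "k \<le> rho b" using True unfolding m by auto
    \<comment> \<open>A head x outside \<open>Sx b k\<close> would open a new pair, and its
      coefficient would be the only term of the boundary at (x, 1) # m.\<close>
    have hd: "headsin (Sx b k) (?Y m)" unfolding headsin_def
    proof (intro allI impI, rule ccontr)
      fix x \<sigma> assume nz: "?Y m (x # \<sigma>) \<noteq> 0" and x: "x \<notin> Sx b k"
      have xV: "x \<in> V" using koszul_cycle_head[OF Y nz] .
      have "valid ((x, 1) # m)" using v x xV rho_pos[OF xV] unfolding m by simp
      from Z[OF this, of \<sigma>] have "?Y m (x # \<sigma>) = 0" using xV by simp
      then show False using nz by simp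
    qed
    \<comment> \<open>This is the boundary at (b, k + 1) # m'. For k = \<open>rho b\<close> that
      word is not valid, but then heads at depth k would have rank 0.\<close>
    have sm: "(\<Sum>x\<in>G. ?Y m (x # \<tau>)) = 0" for \<tau>
    proof (cases "Suc k \<le> rho b")
      case True
      have "valid ((b, Suc k) # m')" using v True by simp
      from Z[OF this, of \<tau>] have "(\<Sum>x\<in>Sx b k. ?Y m (x # \<tau>)) = 0" using v unfolding m by simp
      moreover have "(\<Sum>x\<in>Sx b k. ?Y m (x # \<tau>)) = (\<Sum>x\<in>G. ?Y m (x # \<tau>))"
        by (rule sum.mono_neutral_left) (use hd in \<open>auto simp: headsin_def Sx_def\<close>)
      ultimately show ?thesis by simp
    next
      case False
      have "?Y m (x # \<tau>) = 0" for x
      proof (rule ccontr)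
        assume nz: "?Y m (x # \<tau>) \<noteq> 0"
        then have "x \<in> V" "x \<in> Sx b k" using koszul_cycle_head[OF Y nz] hd unfolding headsin_def by blast+
        then show False using rho_pos[of x] False unfolding Sx_def by simp
      qed
      then show ?thesis by simp
    qed
    show ?thesis using DexE[OF D v(4,5,6) Y hd sm] True unfolding m by auto
  qed
  then have "\<forall>m. \<exists>v. koszul_cycle (Suc p) v \<and> (m \<noteq> [] \<longrightarrow> valid m \<longrightarrow> headsin (Sx (fst (hd m)) (snd (hd m) - 1)) v \<and> (\<forall>\<tau>. (\<Sum>x\<in>G. v (x # \<tau>)) = ?Y m \<tau>)) \<and>
     (?Y m = (\<lambda>_. 0) \<longrightarrow> v = (\<lambda>_. 0))" by blast
  then obtain vv where vv: "\<forall>m. koszul_cycle (Suc p) (vv m) \<and> (m \<noteq> [] \<longrightarrow> valid m \<longrightarrow> headsin (Sx (fst (hd m)) (snd (hd m) - 1)) (vv m) \<and> (\<forall>\<tau>. (\<Sum>x\<in>G. vv m (x # \<tau>)) = ?Y m \<tau>)) \<and>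
     (?Y m = (\<lambda>_. 0) \<longrightarrow> vv m = (\<lambda>_. 0))" by (rule choice[THEN exE])
  have vC: "koszul_cycle (Suc p) (vv m)" and v0: "?Y m = (\<lambda>_. 0) \<Longrightarrow> vv m = (\<lambda>_. 0)" for m using vv by blast+
  have vh: "headsin (Sx b (k - 1)) (vv ((b, k) # m))" "(\<Sum>x\<in>G. vv ((b, k) # m) (x # \<tau>)) = ?Y ((b, k) # m) \<tau>" if "valid ((b, k) # m)" for b k m \<tau>
    using vv[rule_format, of "(b, k) # m"] that by auto
  define Y' where "Y' m1 \<sigma> = (case \<sigma> of [] \<Rightarrow> 0 | x # \<sigma>' \<Rightarrow> (if valid m1 \<and> x \<in> V then vv (step m1 x) else (\<lambda>_. 0)) (x # \<sigma>'))" for m1 \<sigma>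
  have Y'c: "Y' m1 (x # \<sigma>) = (if valid m1 \<and> x \<in> V then vv (step m1 x) (x # \<sigma>) else 0)" for m1 x \<sigma> unfolding Y'_def by simp
  have Y'C: "koszul_cycle (Suc p) (Y' m1)" for m1
    unfolding Y'_def[abs_def] by (rule koszul_cycle_headwise) (simp add: vC koszul_cycle_zero)
  have Y'inv: "Y' m1 = (\<lambda>_. 0)" if "\<not> valid m1" for m1
    unfolding Y'_def using that by (auto split: list.splits)
  have "{m1. Y' m1 \<noteq> (\<lambda>_. 0)} \<subseteq> prevst ` {m. ?Y m \<noteq> (\<lambda>_. 0)}"
  proof
    fix m1 assume "m1 \<in> {m1. Y' m1 \<noteq> (\<lambda>_. 0)}"
    then obtain \<sigma> where "Y' m1 \<sigma> \<noteq> 0" by auto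
    moreover then obtain x \<sigma>' where "\<sigma> = x # \<sigma>'" using koszul_cycle_Nil[OF Y'C] by (cases \<sigma>) auto
    ultimately have *: "valid m1" "x \<in> V" "vv (step m1 x) (x # \<sigma>') \<noteq> 0" unfolding Y'c by (auto simp: Y'c split: if_splits)
    obtain q m where s: "step m1 x = q # m" by (cases "step m1 x") auto
    obtain b k where q: "q = (b, k)" by (cases q)
    have "m1 = prevst (step m1 x)" using step_eqD[OF *(1,2)] s unfolding q by metis
    moreover have "?Y (step m1 x) \<noteq> (\<lambda>_. 0)" using v0[of "step m1 x"] *(3) by auto
    ultimately show "m1 \<in> prevst ` {m. ?Y m \<noteq> (\<lambda>_. 0)}" by blast
  qed
  then have fin: "finite {m1. Y' m1 \<noteq> (\<lambda>_. 0)}" using dict_finite[OF y] finite_subset by blast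
  obtain y' where y': "y' \<in> TT (Suc p)" "\<And>m. dict (Suc p) y' m = Y' m"
    using dict_surj[OF B(2) Y'C fin Y'inv] by blast
  have "dict p y m \<sigma> = dict p (bb p y') m \<sigma>" if m: "valid m" for m \<sigma>
  proof (cases m)
    case Nil
    then show ?thesis using N dict_bb[OF y'(1) m] by simp
  next
    case (Cons q m')
    obtain b k where q: "q = (b, k)" by (cases q)
    have v: "valid ((b, k) # m')" using m unfolding Cons q .
    have "dict p (bb p y') m \<sigma> = (\<Sum>x\<in>Sx b (k - 1). Y' (prevst ((b, k) # m')) (x # \<sigma>))"
      unfolding dict_bb[OF y'(1) m] unfolding Cons q by (simp add: y'(2) del: prevst.simps)
    also have "\<dots> = (\<Sum>x\<in>Sx b (k - 1). vv ((b, k) # m') (x # \<sigma>))"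
    proof (rule sum.cong[OF refl])
      fix x assume x: "x \<in> Sx b (k - 1)"
      show "Y' (prevst ((b, k) # m')) (x # \<sigma>) = vv ((b, k) # m') (x # \<sigma>)"
      proof (cases "x \<in> V")
        case True then show ?thesis using prev_valid[OF v x True] unfolding Y'c by simp
      next
        case False then show ?thesis using koszul_cycle_head[OF vC, of "(b, k) # m'" x \<sigma>] unfolding Y'c by auto
      qed
    qed
    also have "\<dots> = (\<Sum>x\<in>G. vv ((b, k) # m') (x # \<sigma>))"
      by (rule sum.mono_neutral_left) (use vh(1)[OF v] in \<open>auto simp: headsin_def Sx_def\<close>)
    also have "\<dots> = dict p y m \<sigma>" using vh(2)[OF v] unfolding Cons q .
    finally show ?thesis by simp
  qed
  then show ?thesis using dict_eq_imp[OF B(1) y bb_TT[OF y'(1)]] y'(1) by blast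
qed

end

context rposet begin

lemma prevst_valid: "valid m \<Longrightarrow> valid (prevst m)"
  by (cases m rule: valid.cases) auto

lemma cycle_bd_cong: assumes "\<And>m \<sigma>. valid m \<Longrightarrow> Y m \<sigma> = Y' m \<sigma>" "valid m" shows "cycle_bd Y m \<tau> = cycle_bd Y' m \<tau>"
proof (cases m rule: valid.cases)
  case (2 b k m')
  have "valid (prevst ((b, k) # m'))" using prevst_valid assms(2) unfolding 2 by blast
  then show ?thesis unfolding 2 cycle_bd.simps using assms(1) by simp
qed simp

lemma cls_Nil: assumes "fsupp f" shows "cls f [] = f []"
proof -
  have "NF w = [] \<longleftrightarrow> w = []" for w using slen_NF[of w] by (auto simp: slen_def)
  then show ?thesis unfolding cls_def using lin_indicator[OF assms, of "[]"] by simp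
qed

lemma valid_single: "x \<in> V \<Longrightarrow> valid [(x, 1)]"
  using rho_pos[of x] by simp

end

context kdata begin

lemma congJ_dict0: assumes "x \<in> TT p" "congJ class_ker (d p) x (\<lambda>_ _. 0)" shows "dict p x m \<sigma> = 0"
  using dict_eqI[OF assms(1) zero_TT, of m \<sigma>] assms(2) unfolding congJ_def by simp

lemma dict0_congJ: assumes "BB p" "x \<in> TT p" "\<And>m \<sigma>. valid m \<Longrightarrow> dict p x m \<sigma> = 0" shows "congJ class_ker (d p) x (\<lambda>_ _. 0)"
  using dict_eq_imp[OF assms(1,2) zero_TT] assms(3) unfolding congJ_def by simp

lemma dict_bb_bb: assumes "x \<in> TT (Suc (Suc i))" "valid m"
  shows "dict i (bb i (bb (Suc i) x)) m \<sigma> = cycle_bd (cycle_bd (dict (Suc (Suc i)) x)) m \<sigma>"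
  unfolding dict_bb[OF bb_TT[OF assms(1)] assms(2)]
  by (rule cycle_bd_cong[OF _ assms(2)]) (rule dict_bb[OF assms(1)])

lemma resolution:
  assumes D: "koszul_exact TYPE('k)" and B: "\<And>p. BB p" and d0: "d 0 = 1"
  shows "koszul_pres E (class_ker :: (('a \<times> 'a) list \<Rightarrow> 'k) set)"
  unfolding koszul_pres_def
proof (rule exI[of _ d], rule exI[of _ M], intro conjI allI ballI impI)
  show "d 0 = 1" by (rule d0)
  show "M i k l \<in> tensor_alg E" "homog 1 (M i k l)" for i k l by (rule MT, rule Mh)
  show "congJ class_ker (d i) (bb i (bb (Suc i) x)) (\<lambda>_ _. 0)" if x: "x \<in> TT (Suc (Suc i))" for i x
    by (rule dict0_congJ[OF B bb_TT[OF bb_TT[OF x]]]) (simp add: dict_bb_bb[OF x] cycle_bd_cycle_bd[OF dict_koszul_cycle[OF B]])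
  show "\<exists>y\<in>TT 1. (\<lambda>w. x w - bb 0 y 0 w) \<in> class_ker" if x: "x \<in> tensor_alg E" "x [] = 0" for x
  proof -
    have yT: "(\<lambda>_. x) \<in> TT 0" unfolding tuples_def using x by simp
    have "\<exists>y'\<in>TT (Suc 0). \<forall>k<d 0. (\<lambda>w. x w - bb 0 y' k w) \<in> class_ker"
    proof (rule exactness[OF D B B yT])
      show "dict 0 (\<lambda>_. x) [] = (\<lambda>_. 0)" unfolding dict_def using x by (simp add: cls_Nil tensor_fsupp)
      have "dict 0 (\<lambda>_. x) m (z # \<tau>) = 0" for m z \<tau> using dict_koszul_cycle[OF B[of 0], of "\<lambda>_. x" m] unfolding koszul_cycle_0_iff by blast
      then show "cycle_bd (dict 0 (\<lambda>_. x)) m \<tau> = 0" for m \<tau> by (cases m rule: valid.cases) simp_all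
    qed
    then show ?thesis using d0 by auto
  qed
  show "\<exists>y\<in>TT (Suc (Suc i)). congJ class_ker (d (Suc i)) x (bb (Suc i) y)"
    if x: "x \<in> TT (Suc i)" "congJ class_ker (d i) (bb i x) (\<lambda>_ _. 0)" for i x
  proof -
    have Z: "cycle_bd (dict (Suc i) x) m \<tau> = 0" if "valid m" for m \<tau>
      using dict_bb[OF x(1) that, of \<tau>] congJ_dict0[OF bb_TT[OF x(1)] x(2)] by simp
    have C: "koszul_cycle (Suc i) (dict (Suc i) x [])" by (rule dict_koszul_cycle[OF B])
    \<comment> \<open>A head v over the empty word would be the only contribution to the boundary at
      [(v, 1)].\<close>
    have "dict (Suc i) x [] \<sigma> = 0" for \<sigma>
    proof (cases \<sigma>)
      case Nil then show ?thesis using koszul_cycle_Nil[OF C] by simp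
    next
      case (Cons v \<tau>)
      show ?thesis
      proof (rule ccontr)
        assume nz: "dict (Suc i) x [] \<sigma> \<noteq> 0"
        then have v: "v \<in> V" using koszul_cycle_head[OF C] unfolding Cons by blast
        have "cycle_bd (dict (Suc i) x) [(v, 1)] \<tau> = 0" by (rule Z[OF valid_single[OF v]])
        then show False using v nz unfolding Cons by simp
      qed
    qed
    then have N: "dict (Suc i) x [] = (\<lambda>_. 0)" by blast
    show ?thesis using exactness[OF D B B x(1) N Z] unfolding congJ_def .
  qed
qed

end

context rposet begin

text \<open>The matrices expand the slices of a basis of C_(p+1) in a basis of C_p, with one chosen
  edge from x representing the generator x. In degree 0 the basis is fixed to be \<open>dlt\<close>,
  because \<open>koszul_pres\<close> prescribes d 0 = 1.\<close>

lemma koszul_exact_koszul: assumes D: "koszul_exact TYPE('k::field)" shows "koszul_pres E (class_ker :: (('a \<times> 'a) list \<Rightarrow> 'k) set)"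
proof -
  have "\<forall>p. \<exists>bas. isbasis p (fst bas) (snd bas :: nat \<Rightarrow> 'a list \<Rightarrow> 'k)" using isbasis_exists by fastforce
  then obtain bas where bas: "\<forall>p. isbasis p (fst (bas p)) (snd (bas p) :: nat \<Rightarrow> 'a list \<Rightarrow> 'k)" by (rule choice[THEN exE])
  define d where "d p = (if p = 0 then Suc 0 else fst (bas p))" for p
  define c where "c p = (if p = 0 then (\<lambda>_. dlt) else snd (bas p))" for p
  have B: "isbasis p (d p) (c p)" for p using bas isbasis_0 unfolding d_def c_def by (cases "p = 0") auto
  have "\<exists>\<alpha>. k < d (Suc p) \<longrightarrow> (\<forall>\<sigma>. c (Suc p) k (x # \<sigma>) = (\<Sum>l<d p. \<alpha> l * c p l \<sigma>))" for p k x
    using isbasis_span[OF B koszul_cycle_slice[OF isbasis_koszul_cycle[OF B]], of k p x] by blast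
  then have "\<forall>t. \<exists>\<alpha>. case t of (p, k, x) \<Rightarrow> k < d (Suc p) \<longrightarrow> (\<forall>\<sigma>. c (Suc p) k (x # \<sigma>) = (\<Sum>l<d p. \<alpha> l * c p l \<sigma>))"
    by simp
  then obtain \<beta> where \<beta>: "\<forall>t. case t of (p, k, x) \<Rightarrow> k < d (Suc p) \<longrightarrow> (\<forall>\<sigma>. c (Suc p) k (x # \<sigma>) = (\<Sum>l<d p. \<beta> t l * c p l \<sigma>))"
    by (rule choice[THEN exE])
  define M :: "nat \<Rightarrow> nat \<Rightarrow> nat \<Rightarrow> ('a \<times> 'a) list \<Rightarrow> 'k"
    where "M p k l w = (\<Sum>x\<in>V. \<beta> (p, k, x) l * mono (pth x 1) w)" for p k l w
  have p1: "\<exists>e. pth x 1 = [e] \<and> e \<in> E \<and> fst e = x" if "x \<in> V" for x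
    using pth[of x 1] rho_pos[OF that] that by (cases "pth x 1") auto
  have MT: "M p k l \<in> tensor_alg E" for p k l unfolding M_def
    by (intro tensor_sum tensor_smult tensor_mono) (use p1 in fastforce)
  have Mh: "homog 1 (M p k l)" for p k l unfolding homog_def
  proof (intro allI impI)
    fix w assume "M p k l w \<noteq> 0"
    then obtain x where "x \<in> V" "\<beta> (p, k, x) l * mono (pth x 1) w \<noteq> 0"
      unfolding M_def by (rule sum.not_neutral_contains_not_neutral)
    then show "length w = 1" using p1[of x] by (auto simp: mono_def split: if_splits)
  qed
  have glM: "gl (M p k l) x = \<beta> (p, k, x) l" if x: "x \<in> V" for p k l x
  proof -
    have N: "NF (pth x' 1) = [(x', 1)]" if "x' \<in> V" for x' using p1[OF that] by (auto simp: NF_def)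
    have "gl (M p k l) x = (\<Sum>x'\<in>V. \<beta> (p, k, x') l * (if NF (pth x' 1) = [(x, 1)] then 1 else 0))"
      unfolding gl_def M_def by (subst cls_sum) (auto simp: cls_smult cls_mono fsupp_smult)
    also have "\<dots> = (\<Sum>x'\<in>V. if x' = x then \<beta> (p, k, x) l else 0)"
    proof (rule sum.cong[OF refl])
      fix x' assume "x' \<in> V"
      then show "\<beta> (p, k, x') l * (if NF (pth x' 1) = [(x, 1)] then 1 else 0) = (if x' = x then \<beta> (p, k, x) l else 0)"
        using N[of x'] by simp
    qed
    finally show ?thesis using x by simp
  qed
  interpret kdata G lt z0 d M c
  proof
    fix i k l p x \<tau>
    show "M i k l \<in> tensor_alg E" "homog 1 (M i k l)" by (rule MT, rule Mh)
    assume k: "k < d (Suc p)"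
    show "c (Suc p) k (x # \<tau>) = (\<Sum>l<d p. gl (M p k l) x * c p l \<tau>)"
    proof (cases "x \<in> V")
      case True
      then show ?thesis using \<beta>[rule_format, of "(p, k, x)"] k by (simp add: glM)
    next
      case False
      then have "c (Suc p) k (x # \<tau>) = 0" using koszul_cycle_head[OF isbasis_koszul_cycle[OF B k]] by blast
      then show ?thesis using gl_V[OF MT False] by simp
    qed
  qed
  show ?thesis by (rule resolution[OF D B]) (simp add: d_def)
qed

end

text \<open>An arbitrary linear resolution, with c the images of its generators in p-fold tensors.
  \<open>compat\<close> says nothing about the empty list, so its value is fixed separately.\<close>

locale kres = kdata G lt z0 d M c
  for G :: "'a set" and lt z0 d and M :: "nat \<Rightarrow> nat \<Rightarrow> nat \<Rightarrow> ('a \<times> 'a) list \<Rightarrow> 'k::field" and c +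
  assumes d0: "d 0 = 1" and c0: "c 0 = (\<lambda>_. dlt)" and cN: "c (Suc p) k [] = 0"
    and K1: "x \<in> TT (Suc (Suc i)) \<Longrightarrow> congJ class_ker (d i) (bb i (bb (Suc i) x)) (\<lambda>_ _. 0)"
    and K2: "f \<in> tensor_alg E \<Longrightarrow> f [] = 0 \<Longrightarrow> \<exists>y\<in>TT 1. (\<lambda>w. f w - bb 0 y 0 w) \<in> class_ker"
    and K3: "x \<in> TT (Suc i) \<Longrightarrow> congJ class_ker (d i) (bb i x) (\<lambda>_ _. 0) \<Longrightarrow> \<exists>y\<in>TT (Suc (Suc i)). congJ class_ker (d (Suc i)) x (bb (Suc i) y)"
begin

lemma exact_at:
  assumes y: "y \<in> TT p" and N: "\<And>k. cls (y k) [] = 0" and Z: "\<And>m \<tau> q. p = Suc q \<Longrightarrow> valid m \<Longrightarrow> cycle_bd (dict p y) m \<tau> = 0"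
    and B: "\<And>q. p = Suc q \<Longrightarrow> BB q"
  shows "\<exists>y'\<in>TT (Suc p). \<forall>k<d p. (\<lambda>w. y k w - bb p y' k w) \<in> class_ker"
proof (cases p)
  case 0
  have yT: "y 0 \<in> tensor_alg E" using TT_tensor[OF y, of 0] d0 0 by simp
  have "y 0 [] = 0" using N[of 0] cls_Nil[OF tensor_fsupp[OF yT]] by simp
  then show ?thesis using K2[OF yT] 0 d0 by simp
next
  case (Suc q)
  have yS: "y \<in> TT (Suc q)" using y Suc by simp
  have "congJ class_ker (d q) (bb q y) (\<lambda>_ _. 0)"
    by (rule dict0_congJ[OF B[OF Suc] bb_TT[OF yS]]) (simp add: dict_bb[OF yS] Z[OF Suc] flip: Suc)
  from K3[OF yS this] show ?thesis unfolding congJ_def Suc .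
qed

text \<open>Uniqueness of the linear resolution, by induction on p. Membership in C: two consecutive
  differentials compose to 0 on generators. Independence: a dependence gives a cycle with constant
  coefficients, while boundaries have no constant part. Spanning: for u in C_(p+1) the Koszul
  boundary of u is a cycle, and the constant part of a preimage gives the coefficients.\<close>

lemma BB_all: "BB p"
proof (induction p rule: less_induct)
  case (less p)
  show ?case
  proof (cases p)
    case 0 then show ?thesis using isbasis_0 c0 d0 by simp
  next
    case (Suc p')
    have B: "BB p'" "\<And>q. p' = Suc q \<Longrightarrow> BB q" using less Suc by auto
    have slice: "koszul_cycle p' (\<lambda>\<sigma>. c (Suc p') k (x # \<sigma>))" if "k < d (Suc p')" for k x
      unfolding compat[OF that] by (rule koszul_cycle_sum) (use B(1) isbasis_koszul_cycle in blast)
    have mem: "koszul_cycle (Suc p') (c (Suc p') k)" if k: "k < d (Suc p')" for k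
    proof -
      let ?c = "c (Suc p') k"
      have hV: "x \<in> V" if "?c (x # \<sigma>) \<noteq> 0" for x \<sigma>
      proof (rule ccontr)
        assume "x \<notin> V"
        then have "?c (x # \<sigma>) = 0" unfolding compat[OF k] using gl_V[OF MT] by simp
        then show False using that by simp
      qed
      have two: "(\<Sum>z\<in>G. ?c (x # z # \<tau>)) = 0 \<and> (\<forall>z. ?c (x # z # \<tau>) \<noteq> 0 \<longrightarrow> cov x z)" for x \<tau>
      proof (cases p')
        case 0
        then have "?c (x # z # \<tau>) = 0" for z using slice[OF k, of x] unfolding 0 koszul_cycle_0_iff by blast
        then show ?thesis by simp
      next
        case (Suc q)
        \<comment> \<open>The k-th generator. That its image under two differentials is 0 will be
          read at the words [(z, 1), (x, 1)] and [(x, 2)].\<close>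
        define U :: "nat \<Rightarrow> ('a \<times> 'a) list \<Rightarrow> 'k" where "U j = (if j = k then mono [] else (\<lambda>_. 0))" for j
        have UT: "U \<in> TT (Suc (Suc q))" unfolding tuples_def U_def by (auto simp: tensor_mono tensor_zero)
        have clU: "cls (U j) m = (if j = k \<and> m = [] then 1 else 0)" for j m
          unfolding U_def by (auto simp: cls_mono cls_zero)
        have dU: "dict (Suc (Suc q)) U m \<sigma> = (if m = [] then ?c \<sigma> else 0)" for m \<sigma>
        proof -
          have "dict (Suc (Suc q)) U m \<sigma> = (\<Sum>j<d (Suc (Suc q)). if j = k then (if m = [] then ?c \<sigma> else 0) else 0)"
            unfolding dict_def clU by (rule sum.cong) (auto simp: Suc)
          then show ?thesis using k Suc by simp
        qed
        have Z: "cycle_bd (cycle_bd (dict (Suc (Suc q)) U)) m \<sigma> = 0" if "valid m" for m \<sigma>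
          using dict_bb_bb[OF UT that, of \<sigma>] congJ_dict0[OF bb_TT[OF bb_TT[OF UT]] K1[OF UT]] by simp
        have cv: "cov x z" if nz: "?c (x # z # \<tau>) \<noteq> 0" for z
        proof (rule ccontr)
          assume n: "\<not> cov x z"
          have x: "x \<in> V" using hV[OF nz] .
          have z: "z \<in> V" using koszul_cycle_head[OF slice[OF k, of x, unfolded Suc] nz[unfolded Suc]] .
          have "z \<notin> Sx x 1" using n Sx_1 x by simp
          then have "valid [(z, 1), (x, 1)]" using x z rho_pos[OF x] rho_pos[OF z] by simp
          from Z[OF this, of \<tau>] have "?c (x # z # \<tau>) = 0" using x z by (simp add: dU)
          then show False using nz by simp
        qed
        have "(\<Sum>z\<in>G. ?c (x # z # \<tau>)) = 0"
        proof (cases "x \<in> V")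
          case False
          then have "?c (x # z # \<tau>) = 0" for z using hV by blast
          then show ?thesis by simp
        next
          case True
          have zz: "?c (x # z # \<tau>) \<noteq> 0 \<Longrightarrow> z \<in> Sx x 1 \<and> z \<in> V" for z
            using cv[of z] Sx_1[of x z] True koszul_cycle_head[OF slice[OF k, of x, unfolded Suc], of z \<tau>] Suc by auto
          show ?thesis
          proof (cases "2 \<le> rho x")
            case rx: True
            have "valid [(x, 2)]" using True rx by simp
            from Z[OF this, of \<tau>] have "(\<Sum>z\<in>Sx x 1. ?c (x # z # \<tau>)) = 0" using True by (simp add: dU)
            moreover have "(\<Sum>z\<in>Sx x 1. ?c (x # z # \<tau>)) = (\<Sum>z\<in>G. ?c (x # z # \<tau>))"
              by (rule sum.mono_neutral_left) (use zz in \<open>auto simp: Sx_def\<close>)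
            ultimately show ?thesis by simp
          next
            case False
            have "?c (x # z # \<tau>) = 0" for z
            proof (rule ccontr)
              assume "?c (x # z # \<tau>) \<noteq> 0"
              then have "rho x = rho z + 1" "0 < rho z" using zz[of z] rho_pos[of z] unfolding Sx_def by auto
              then show False using False by simp
            qed
            then show ?thesis by simp
          qed
        qed
        then show ?thesis using cv by blast
      qed
      show ?thesis by (rule koszul_cycle_SucI) (use slice[OF k] two hV cN in auto)
    qed
    have indep: "\<alpha> k = 0" if a: "\<And>\<sigma>. (\<Sum>k<d (Suc p'). \<alpha> k * c (Suc p') k \<sigma>) = 0" and k: "k < d (Suc p')" for \<alpha> k
    proof -
      define y where "y k w = \<alpha> k * mono [] w" for k and w :: "('a \<times> 'a) list"
      have yT: "y \<in> TT (Suc p')" unfolding tuples_def y_def by (simp add: tensor_smult tensor_mono)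
      have cy: "cls (y k) m = (if m = [] then \<alpha> k else 0)" for k m
        unfolding y_def by (simp add: cls_smult cls_mono)
      have "dict (Suc p') y m \<sigma> = 0" for m \<sigma> unfolding dict_def cy using a by (cases "m = []") simp_all
      then have "cycle_bd (dict (Suc p') y) m \<sigma> = 0" for m \<sigma> by (cases m rule: valid.cases) simp_all
      then have "congJ class_ker (d p') (bb p' y) (\<lambda>_ _. 0)"
        by (intro dict0_congJ[OF B(1) bb_TT[OF yT]]) (simp add: dict_bb[OF yT])
      from K3[OF yT this] obtain y' where y': "y' \<in> TT (Suc (Suc p'))" "(\<lambda>w. y k w - bb (Suc p') y' k w) \<in> class_ker"
        using k unfolding congJ_def by blast
      have "cls (\<lambda>w. y k w - bb (Suc p') y' k w) [] = 0" using y'(2) unfolding class_ker_def by blast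
      then have "cls (y k) [] = 0"
        using cls_bb_Nil[OF y'(1), of k]
        by (simp add: cls_diff[OF tensor_fsupp[OF TT_tensor[OF yT k]] tensor_fsupp[OF bb_tensor[OF y'(1)]]])
      then show ?thesis unfolding cy by simp
    qed
    have span: "\<exists>\<alpha>. \<forall>\<sigma>. u \<sigma> = (\<Sum>k<d (Suc p'). \<alpha> k * c (Suc p') k \<sigma>)" if u: "koszul_cycle (Suc p') u" for u
    proof -
      define U where "U m = (if m = [] then u else (\<lambda>_. 0))" for m :: "('a \<times> nat) list"
      have UC: "koszul_cycle (Suc p') (U m)" for m unfolding U_def using u by (simp add: koszul_cycle_zero)
      \<comment> \<open>The Koszul boundary of 1 (x) u, which lives on normal words of length
        one.\<close>
      define Y where "Y m \<sigma> = (if valid m then cycle_bd U m \<sigma> else 0)" for m \<sigma>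
      have Y1: "Y [(x, 1)] \<sigma> = u (x # \<sigma>)" if "x \<in> V" for x \<sigma>
        using valid_single[OF that] that unfolding Y_def by (simp add: U_def)
      have Y0: "\<exists>x\<in>V. m = [(x, 1)]" if "Y m \<sigma> \<noteq> 0" for m \<sigma>
      proof -
        have v: "valid m" "cycle_bd U m \<sigma> \<noteq> 0" using that unfolding Y_def by (auto split: if_splits)
        then obtain b k m' where m: "m = (b, k) # m'" by (cases m rule: valid.cases) auto
        have "U (prevst m) \<noteq> (\<lambda>_. 0)" using v(2) unfolding m by auto
        then have "prevst m = []" unfolding U_def by (auto split: if_splits)
        then show ?thesis using v(1) unfolding m by (auto split: if_splits)
      qed
      have "\<exists>y\<in>TT p'. \<forall>m. dict p' y m = Y m"
      proof (rule dict_surj[OF B(1)])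
        show "koszul_cycle p' (Y m)" for m
        proof (cases "\<exists>x\<in>V. m = [(x, 1)]")
          case True
          then obtain x where x: "x \<in> V" "m = [(x, 1)]" by blast
          have "Y m = (\<lambda>\<sigma>. u (x # \<sigma>))" using Y1[OF x(1)] unfolding x(2) by blast
          then show ?thesis using koszul_cycle_slice[OF u] by simp
        next
          case False
          then have "Y m = (\<lambda>_. 0)" using Y0 by blast
          then show ?thesis by (simp add: koszul_cycle_zero)
        qed
        have "{m. Y m \<noteq> (\<lambda>_. 0)} \<subseteq> (\<lambda>x. [(x, 1)]) ` V" using Y0 by fastforce
        then show "finite {m. Y m \<noteq> (\<lambda>_. 0)}" by (rule finite_subset) simp
        show "Y m = (\<lambda>_. 0)" if "\<not> valid m" for m using that unfolding Y_def by simp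
      qed
      then obtain y where y: "y \<in> TT p'" "\<And>m. dict p' y m = Y m" by blast
      \<comment> \<open>Entries with index outside the range are reset to 0, because
        \<open>exact_at\<close> asks for vanishing constant parts at every index.\<close>
      have "\<exists>y'\<in>TT (Suc p'). \<forall>k<d p'. (\<lambda>w. (if k < d p' then y k else (\<lambda>_. 0)) w - bb p' y' k w) \<in> class_ker"
      proof (rule exact_at[OF _ _ _ B(2)])
        let ?y = "\<lambda>k. if k < d p' then y k else (\<lambda>_. 0)"
        show "?y \<in> TT p'" using y(1) unfolding tuples_def by simp
        have "dict p' y [] \<sigma> = 0" for \<sigma> unfolding y(2) Y_def by simp
        then have "cls (y k) [] = 0" if "k < d p'" for k
          using isbasis_indep[OF B(1), of "\<lambda>k. cls (y k) []"] that unfolding dict_def by blast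
        then show "cls (?y k) [] = 0" for k by (simp add: cls_zero)
        fix m \<tau> q assume m: "valid m"
        have "dict p' ?y m' = Y m'" for m' using y(2)[of m'] unfolding dict_def[abs_def] by (auto intro!: ext sum.cong)
        then have "cycle_bd (dict p' ?y) m \<tau> = cycle_bd Y m \<tau>" by (intro cycle_bd_cong[OF _ m]) simp
        also have "\<dots> = cycle_bd (cycle_bd U) m \<tau>" by (rule cycle_bd_cong[OF _ m]) (simp add: Y_def)
        also have "\<dots> = 0" by (rule cycle_bd_cycle_bd[OF UC m])
        finally show "cycle_bd (dict p' ?y) m \<tau> = 0" .
      qed
      then obtain y' where y': "y' \<in> TT (Suc p')" "\<And>k. k < d p' \<Longrightarrow> (\<lambda>w. y k w - bb p' y' k w) \<in> class_ker" by force
      have Yd: "Y m \<sigma> = cycle_bd (dict (Suc p') y') m \<sigma>" if "valid m" for m \<sigma>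
        using dict_eqI[OF y(1) bb_TT[OF y'(1)] y'(2), of m \<sigma>] dict_bb[OF y'(1) that, of \<sigma>] y(2) by simp
      have "u \<sigma> = (\<Sum>k<d (Suc p'). cls (y' k) [] * c (Suc p') k \<sigma>)" for \<sigma>
      proof (cases \<sigma>)
        case Nil then show ?thesis using koszul_cycle_Nil[OF u] cN by simp
      next
        case (Cons x \<tau>)
        show ?thesis
        proof (cases "x \<in> V")
          case True
          have "u (x # \<tau>) = cycle_bd (dict (Suc p') y') [(x, 1)] \<tau>" using Yd[OF valid_single[OF True], of \<tau>] Y1[OF True] by simp
          then show ?thesis using True unfolding Cons by (simp add: dict_def)
        next
          case False
          have "u (x # \<tau>) = 0" using koszul_cycle_head[OF u] False by blast
          moreover have "c (Suc p') k (x # \<tau>) = 0" if "k < d (Suc p')" for k using koszul_cycle_head[OF mem[OF that]] False by blast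
          ultimately show ?thesis unfolding Cons by simp
        qed
      qed
      then show ?thesis by (intro exI[of _ "\<lambda>k. cls (y' k) []"]) blast
    qed
    show ?thesis unfolding Suc isbasis_def using mem indep span by blast
  qed
qed

text \<open>Placing u at the single normal word [(b, k)] gives a cycle: the head condition handles
  words with a new pair, the sum condition handles [(b, k + 1)]. A preimage restricted to heads at
  depth k - 1 is the required v.\<close>

lemma koszul_exact_kres: "koszul_exact TYPE('k)"
  unfolding koszul_exact_def
proof (intro ballI allI impI)
  fix b k p and u :: "'a list \<Rightarrow> 'k"
  assume b: "b \<in> V" and k: "0 < k" "k \<le> rho b" and u: "koszul_cycle p u" "headsin (Sx b k) u" "\<forall>\<tau>. (\<Sum>x\<in>G. u (x # \<tau>)) = 0"
  let ?m = "[(b, k)]"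
  have vm: "valid ?m" using b k by simp
  define Y where "Y m = (if m = ?m then u else (\<lambda>_. 0))" for m
  have "\<exists>y\<in>TT p. \<forall>m. dict p y m = Y m"
  proof (rule dict_surj[OF BB_all])
    show "koszul_cycle p (Y m)" for m unfolding Y_def using u(1) by (simp add: koszul_cycle_zero)
    show "finite {m. Y m \<noteq> (\<lambda>_. 0)}" by (rule finite_subset[of _ "{?m}"]) (auto simp: Y_def)
    show "Y m = (\<lambda>_. 0)" if "\<not> valid m" for m using that vm unfolding Y_def by auto
  qed
  then obtain y where y: "y \<in> TT p" "\<And>m. dict p y m = Y m" by blast
  have Z: "cycle_bd Y m \<tau> = 0" if m: "valid m" for m \<tau>
  proof (cases m rule: valid.cases)
    case (2 b' k' m')
    show ?thesis
    proof (cases "prevst m = ?m")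
      case False then show ?thesis unfolding 2 by (simp add: Y_def del: prevst.simps)
    next
      case True
      show ?thesis
      proof (cases "k' = 1")
        case k1: True
        then have m': "m' = ?m" using True unfolding 2 by simp
        have "b' \<notin> Sx b k" "b' \<in> G" using m unfolding 2 m' by auto
        then have "u (b' # \<tau>) = 0" using u(2) unfolding headsin_def by blast
        then show ?thesis using k1 \<open>b' \<in> G\<close> unfolding 2 m' by (simp add: Y_def)
      next
        case False
        then have "b' = b" "k' - 1 = k" "m' = []" using True unfolding 2 by auto
        then have "cycle_bd Y m \<tau> = (\<Sum>x\<in>Sx b k. u (x # \<tau>))" using True unfolding 2 by (simp add: Y_def)
        also have "\<dots> = (\<Sum>x\<in>G. u (x # \<tau>))"
          by (rule sum.mono_neutral_left) (use u(2) in \<open>auto simp: headsin_def Sx_def\<close>)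
        finally show ?thesis using u(3) by simp
      qed
    qed
  qed simp
  let ?y = "\<lambda>k. if k < d p then y k else (\<lambda>_. 0)"
  have yT: "?y \<in> TT p" using y(1) unfolding tuples_def by simp
  have dy: "dict p ?y m = Y m" for m using y(2)[of m] unfolding dict_def[abs_def] by (auto intro!: ext sum.cong)
  have "\<exists>y'\<in>TT (Suc p). \<forall>k<d p. (\<lambda>w. ?y k w - bb p y' k w) \<in> class_ker"
  proof (rule exact_at[OF yT _ _ BB_all])
    have "dict p y [] \<sigma> = 0" for \<sigma> unfolding y(2) Y_def by simp
    then have "cls (y k) [] = 0" if "k < d p" for k
      using isbasis_indep[OF BB_all, where \<alpha> = "\<lambda>k. cls (y k) []"] that unfolding dict_def by blast
    then show "cls (?y k) [] = 0" for k by (simp add: cls_zero)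
    fix m \<tau> q assume m: "valid m"
    have "cycle_bd (dict p ?y) m \<tau> = cycle_bd Y m \<tau>" by (rule cycle_bd_cong[OF _ m]) (simp add: dy)
    then show "cycle_bd (dict p ?y) m \<tau> = 0" using Z[OF m] by simp
  qed
  then obtain y' where y': "y' \<in> TT (Suc p)" "\<And>k. k < d p \<Longrightarrow> (\<lambda>w. ?y k w - bb p y' k w) \<in> class_ker" by blast
  have "u \<tau> = cycle_bd (dict (Suc p) y') ?m \<tau>" for \<tau>
    using dict_eqI[OF yT bb_TT[OF y'(1)] y'(2), of ?m \<tau>] dict_bb[OF y'(1) vm, of \<tau>] unfolding dy by (simp add: Y_def)
  then have ud: "u \<tau> = (\<Sum>x\<in>Sx b (k - 1). dict (Suc p) y' (prevst ?m) (x # \<tau>))" for \<tau> unfolding cycle_bd.simps .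
  define v where "v \<sigma> = (case \<sigma> of [] \<Rightarrow> 0 | x # \<sigma>' \<Rightarrow> (if x \<in> Sx b (k - 1) then dict (Suc p) y' (prevst ?m) else (\<lambda>_. 0)) (x # \<sigma>'))" for \<sigma>
  have vc: "v (x # \<sigma>) = (if x \<in> Sx b (k - 1) then dict (Suc p) y' (prevst ?m) (x # \<sigma>) else 0)" for x \<sigma>
    unfolding v_def by simp
  have "koszul_cycle (Suc p) v" unfolding v_def[abs_def]
    by (rule koszul_cycle_headwise) (simp add: dict_koszul_cycle[OF BB_all] koszul_cycle_zero del: prevst.simps)
  moreover have "headsin (Sx b (k - 1)) v" unfolding headsin_def vc by simp
  moreover have "(\<Sum>x\<in>G. v (x # \<tau>)) = u \<tau>" for \<tau>
    unfolding ud vc by (rule sum.mono_neutral_cong_right) (auto simp: Sx_def simp del: prevst.simps)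
  ultimately show "\<exists>v. koszul_cycle (Suc p) v \<and> headsin (Sx b (k - 1)) v \<and> (\<forall>\<tau>. (\<Sum>x\<in>G. v (x # \<tau>)) = u \<tau>)" by blast
qed

end

context rposet begin

text \<open>Images of the generators of the p-th term in p-fold tensors, obtained by composing the
  matrices and starting from the empty tensor.\<close>

primrec rescoef :: "(nat \<Rightarrow> nat) \<Rightarrow> (nat \<Rightarrow> nat \<Rightarrow> nat \<Rightarrow> ('a \<times> 'a) list \<Rightarrow> 'k::field) \<Rightarrow> nat \<Rightarrow> nat \<Rightarrow> 'a list \<Rightarrow> 'k" where
  "rescoef d M 0 = (\<lambda>_. dlt)"
| "rescoef d M (Suc p) = (\<lambda>k \<sigma>. case \<sigma> of [] \<Rightarrow> 0 | x # \<tau> \<Rightarrow> (\<Sum>l<d p. gl (M p k l) x * rescoef d M p l \<tau>))"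

lemma koszul_koszul_exact: assumes "koszul_pres E (class_ker :: (('a \<times> 'a) list \<Rightarrow> 'k::field) set)" shows "koszul_exact TYPE('k)"
proof -
  obtain d and M :: "nat \<Rightarrow> nat \<Rightarrow> nat \<Rightarrow> ('a \<times> 'a) list \<Rightarrow> 'k" where K: "d 0 = 1"
     "\<And>i k l. M i k l \<in> tensor_alg E \<and> homog 1 (M i k l)"
     "\<And>i x. x \<in> tuples E (d (Suc (Suc i))) \<Longrightarrow> congJ class_ker (d i) (bdry d M i (bdry d M (Suc i) x)) (\<lambda>_ _. 0)"
     "\<And>x. x \<in> tensor_alg E \<Longrightarrow> x [] = 0 \<Longrightarrow> \<exists>y \<in> tuples E (d 1). (\<lambda>w. x w - bdry d M 0 y 0 w) \<in> class_ker"
     "\<And>i x. x \<in> tuples E (d (Suc i)) \<Longrightarrow> congJ class_ker (d i) (bdry d M i x) (\<lambda>_ _. 0) \<Longrightarrow>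
          \<exists>y \<in> tuples E (d (Suc (Suc i))). congJ class_ker (d (Suc i)) x (bdry d M (Suc i) y)"
    using assms unfolding koszul_pres_def by blast
  interpret kdata G lt z0 d M "rescoef d M" by unfold_locales (use K(2) in simp_all)
  interpret kres G lt z0 d M "rescoef d M"
    by unfold_locales (fact K(1), simp, simp, fact K(3), fact K(4), fact K(5))
  show ?thesis by (rule koszul_exact_kres)
qed

theorem koszul_iff: "koszul_pres E (J :: (('a \<times> 'a) list \<Rightarrow> 'k::field) set) \<longleftrightarrow> cohen_macaulay TYPE('k) G lt"
  unfolding J_eq_class_ker cohen_macaulay_iff koszul_exact_iff_interval_acyclic[symmetric] using koszul_koszul_exact koszul_exact_koszul by blast

end

theorem theorem1p2:
  fixes G :: "'a set" and lt :: "'a \<Rightarrow> 'a \<Rightarrow> bool" and z0 :: 'a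
  assumes "ranked_poset G lt z0"
  shows "(quadratic_pres (edges G lt z0) (assoc_graded_ker G lt z0 :: (('a \<times> 'a) list \<Rightarrow> 'k::field) set)
            \<longleftrightarrow> uniform G lt z0)
       \<and> (koszul_pres (edges G lt z0) (assoc_graded_ker G lt z0 :: (('a \<times> 'a) list \<Rightarrow> 'k::field) set)
            \<longleftrightarrow> cohen_macaulay TYPE('k) G lt)"
proof -
  interpret rposet G lt z0 using assms by unfold_locales
  show ?thesis using quadratic_iff koszul_iff by blast
qed

end
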